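(* Let $d\ge3$. The only $T$-shape relations of degree $d$ are those with $d=3$ of the form $(\gamma_u|\lambda_u)$ and $(\lambda_u|\gamma_u)$, where $$\gamma_u=(t+u,\,t+u,\,t-2u),\qquad\lambda_u=(t+2u,\,t-u,\,t-u)$$ and $u$ varies in $\{1,\dots,\lfloor t/2\rfloor\}$.
   Context: $\Bbbk$ is a field of characteristic $0$, $1\le t\le m\le n$; $V,W$ are $\Bbbk$-vector spaces of dimensions $m,n$; $G=\mathrm{GL}(V)\times\mathrm{GL}(W)$, $E=\bigwedge^tV$, $F=\bigwedge^tW$, and $T_t=\bigoplus_dE^{\otimes d}\otimes(F^* )^{\otimes d}$ is the tensor algebra of $E\otimes F^*$. Schur modules: $L_{(d)}V=\bigwedge^dV$, $L_{(1^d)}V=\mathrm{Sym}^dV$; $L_\lambda W^*=(L_\lambda W)^*$. A partition $\lambda=(\lambda_1\ge\dots\ge\lambda_k\ge1)$ is $(t,d)$-admissible if $|\lambda|=td$ and $k\le d$ (trailing zeros ignored). A $t$-predecessor of a $(t,d)$-admissible $\lambda$ is a $(t,d-1)$-admissible $\alpha$ with $\alpha_1\le\lambda_1\le\alpha_1+t$ and $\alpha_i\le\lambda_i\le\alpha_{i-1}$ for $i\ge2$. A bi-diagram $(\gamma|\lambda)$ is a pair of diagrams, standing for the irreducible $G$-module $L_\gamma V\otimes L_\lambda W^*$ (so $\gamma_1\le m$, $\lambda_1\le n$); its bi-predecessors are the pairs $(\alpha|\beta)$ with $\alpha$ a $t$-predecessor of $\gamma$ and $\beta$ one of $\lambda$;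 it is symmetric if both entries coincide. A $T$-shape relation of degree $d$ is a bi-diagram $(\gamma|\lambda)$ of $(t,d)$-admissible diagrams with $\gamma\neq\lambda$ all of whose bi-predecessors are symmetric and have multiplicity $1$ in $T_t$. *)

theory Defs
  imports
    Complex_Main
    "HOL-Library.Function_Algebras"
    "HOL-Library.More_List"
    "HOL-Combinatorics.Permutations"
begin

section \<open>Diagrams\<close>

text \<open>
  A diagram is its sequence of row lengths, extended by zeros, so that trailing zeros do not
  matter. Rows are numbered from 0: the first part of \<open>\<mu>\<close> is \<open>\<mu> 0\<close>.
\<close>

definition diagram :: "(nat \<Rightarrow> nat) \<Rightarrow> bool" where
  "diagram \<mu> \<longleftrightarrow> antimono \<mu> \<and> finite {i. \<mu> i \<noteq> 0}"

definition num_rows :: "(nat \<Rightarrow> nat) \<Rightarrow> nat" where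
  "num_rows \<mu> = card {i. \<mu> i \<noteq> 0}"

definition diagram_size :: "(nat \<Rightarrow> nat) \<Rightarrow> nat" where
  "diagram_size \<mu> = (\<Sum>i | \<mu> i \<noteq> 0. \<mu> i)"

abbreviation diagram_of :: "nat list \<Rightarrow> nat \<Rightarrow> nat" where
  "diagram_of \<equiv> nth_default 0"

definition boxes :: "(nat \<Rightarrow> nat) \<Rightarrow> (nat \<times> nat) set" where
  "boxes \<mu> = {(i, j). j < \<mu> i}"

definition admissible :: "nat \<Rightarrow> nat \<Rightarrow> (nat \<Rightarrow> nat) \<Rightarrow> bool" where
  "admissible t d \<mu> \<longleftrightarrow> diagram \<mu> \<and> diagram_size \<mu> = t * d \<and> num_rows \<mu> \<le> d"

definition predecessor :: "nat \<Rightarrow> nat \<Rightarrow> (nat \<Rightarrow> nat) \<Rightarrow> (nat \<Rightarrow> nat) \<Rightarrow> bool" where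
  "predecessor t d \<alpha> \<mu> \<longleftrightarrow>
     admissible t d \<mu> \<and> admissible t (d - 1) \<alpha> \<and>
     \<alpha> 0 \<le> \<mu> 0 \<and> \<mu> 0 \<le> \<alpha> 0 + t \<and>
     (\<forall>i. \<alpha> (Suc i) \<le> \<mu> (Suc i) \<and> \<mu> (Suc i) \<le> \<alpha> i)"

definition bi_diagram :: "nat \<Rightarrow> nat \<Rightarrow> (nat \<Rightarrow> nat) \<Rightarrow> (nat \<Rightarrow> nat) \<Rightarrow> bool" where
  "bi_diagram m n \<gamma> \<mu> \<longleftrightarrow> diagram \<gamma> \<and> diagram \<mu> \<and> \<gamma> 0 \<le> m \<and> \<mu> 0 \<le> n"


section \<open>Multilinear algebra in spaces of functions\<close>

definition fscale :: "'k \<Rightarrow> ('p \<Rightarrow> 'k) \<Rightarrow> 'p \<Rightarrow> 'k::field" where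
  "fscale c f = (\<lambda>p. c * f p)"

definition dual_space :: "('k::field \<Rightarrow> 'v::ab_group_add \<Rightarrow> 'v) \<Rightarrow> ('v \<Rightarrow> 'k) set" where
  "dual_space s = {\<phi>. Vector_Spaces.linear s (*) \<phi>}"

text \<open>
  For a finite-dimensional space \<open>X\<close> (with scalar multiplication \<open>s\<close>), \<open>ext_power s X r\<close> is
  the space of alternating \<open>r\<close>-linear forms on \<open>X\<close>, that is, the dual of the \<open>r\<close>-th exterior
  power of \<open>X\<close>, or equivalently the \<open>r\<close>-th exterior power of the dual \<open>X\<^sup>*\<close>. The exterior
  powers of \<open>V\<close> itself are obtained by taking for \<open>X\<close> the dual of \<open>V\<close>.

  A form is a function of a sequence of arguments of which only the first \<open>r\<close> are used; to
  have a unique function for each form, it is set to 0 when some of these lies outside \<open>X\<close>.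
\<close>

definition ext_power ::
  "('k::field \<Rightarrow> 'x::ab_group_add \<Rightarrow> 'x) \<Rightarrow> 'x set \<Rightarrow> nat \<Rightarrow> ((nat \<Rightarrow> 'x) \<Rightarrow> 'k) set" where
  "ext_power s X r = {f.
     (\<forall>a b. (\<forall>i<r. a i = b i) \<longrightarrow> f a = f b) \<and>
     (\<forall>a. (\<exists>i<r. a i \<notin> X) \<longrightarrow> f a = 0) \<and>
     (\<forall>a. \<forall>i<r. \<forall>c. \<forall>x\<in>X. \<forall>y\<in>X. f (a(i := s c x + y)) = c * f (a(i := x)) + f (a(i := y))) \<and>
     (\<forall>a. \<forall>i j. i < j \<and> j < r \<and> a i = a j \<longrightarrow> f a = 0)}"

text \<open>
  The tensor product of spaces of functions on sets \<open>P\<close> and \<open>Q\<close> is the space of functions on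
  \<open>P \<times> Q\<close> spanned by the products \<open>f p * g q\<close>. In \<open>row_tensor k M\<close> there are \<open>k\<close> factors
  \<open>M 0\<close>, ..., \<open>M (k - 1)\<close>, the \<open>i\<close>-th one consisting of functions of the \<open>i\<close>-th row
  of an array of arguments.
\<close>

definition tensor :: "('p \<Rightarrow> 'k::field) set \<Rightarrow> ('q \<Rightarrow> 'k) set \<Rightarrow> ('p \<times> 'q \<Rightarrow> 'k) set" where
  "tensor A B = module.span fscale {\<lambda>(p, q). f p * g q | f g. f \<in> A \<and> g \<in> B}"

definition row_tensor ::
  "nat \<Rightarrow> (nat \<Rightarrow> ((nat \<Rightarrow> 'x) \<Rightarrow> 'k::field) set) \<Rightarrow> ((nat \<times> nat \<Rightarrow> 'x) \<Rightarrow> 'k) set" where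
  "row_tensor k M =
     module.span fscale {\<lambda>a. \<Prod>i<k. f i (\<lambda>j. a (i, j)) | f. \<forall>i<k. f i \<in> M i}"

definition direct_sum :: "(nat \<Rightarrow> ('p \<Rightarrow> 'k::field) set) \<Rightarrow> (nat \<times> 'p \<Rightarrow> 'k) set" where
  "direct_sum M = {F. (\<forall>d. (\<lambda>p. F (d, p)) \<in> M d) \<and> finite {d. \<exists>p. F (d, p) \<noteq> 0}}"

text \<open>
  The Schur module \<open>L\<^sub>\<mu>(X\<^sup>*)\<close> is the image of the map
  \<open>\<Lambda>\<^bsup>\<mu>\<^sub>1\<^esup> \<otimes> \<dots> \<otimes> \<Lambda>\<^bsup>\<mu>\<^sub>k\<^esup> \<longrightarrow> Sym\<^bsup>\<mu>'\<^sub>1\<^esup> \<otimes> Sym\<^bsup>\<mu>'\<^sub>2\<^esup> \<otimes> \<dots>\<close> that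
  embeds the exterior powers along the rows into the tensors indexed by the boxes of \<open>\<mu>\<close> and
  then multiplies along the columns (\<open>\<mu>'\<close> is the conjugate diagram). In characteristic 0 the
  symmetric powers are the spaces of symmetric tensors, and the multiplication is the
  symmetrization over the permutations of the boxes that preserve the columns. Thus a diagram
  with one row gives an exterior power and one with one column a symmetric power.
\<close>

definition column_group :: "(nat \<Rightarrow> nat) \<Rightarrow> (nat \<times> nat \<Rightarrow> nat \<times> nat) set" where
  "column_group \<mu> = {\<pi>. \<pi> permutes boxes \<mu> \<and> (\<forall>b. snd (\<pi> b) = snd b)}"

definition column_sym ::
  "(nat \<Rightarrow> nat) \<Rightarrow> ((nat \<times> nat \<Rightarrow> 'x) \<Rightarrow> 'k::field) \<Rightarrow> (nat \<times> nat \<Rightarrow> 'x) \<Rightarrow> 'k" where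
  "column_sym \<mu> f = (\<lambda>a. \<Sum>\<pi>\<in>column_group \<mu>. f (a \<circ> \<pi>))"

definition schur ::
  "('k::field \<Rightarrow> 'x::ab_group_add \<Rightarrow> 'x) \<Rightarrow> 'x set \<Rightarrow> (nat \<Rightarrow> nat) \<Rightarrow>
   ((nat \<times> nat \<Rightarrow> 'x) \<Rightarrow> 'k) set" where
  "schur s X \<mu> = column_sym \<mu> ` row_tensor (num_rows \<mu>) (\<lambda>i. ext_power s X (\<mu> i))"


section \<open>The group and its modules\<close>

definition GL :: "('k::field \<Rightarrow> 'v::ab_group_add \<Rightarrow> 'v) \<Rightarrow> ('v \<Rightarrow> 'v) set" where
  "GL s = {g. Vector_Spaces.linear s s g \<and> bij g}"

text \<open>
  The spaces below consist of functions of arrays \<open>a\<close> of linear forms on \<open>V\<close> and arrays \<open>b\<close>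
  of vectors of \<open>W\<close>. A vector \<open>v\<close> acts on linear forms by evaluation, so
  \<open>g \<cdot> v\<close> is the function \<open>\<phi> \<mapsto> \<phi> (g v)\<close> and \<open>g\<close> acts by \<open>\<phi> \<mapsto> \<phi> \<circ> g\<close> on the arguments; on
  linear forms on \<open>W\<close> the action of \<open>h\<close> is the contragredient one.
\<close>

type_synonym ('v, 'w, 'k) arrays = "(nat \<times> nat \<Rightarrow> ('v \<Rightarrow> 'k)) \<times> (nat \<times> nat \<Rightarrow> 'w)"

definition act ::
  "('v \<Rightarrow> 'v) \<times> ('w \<Rightarrow> 'w) \<Rightarrow> (('v, 'w, 'k) arrays \<Rightarrow> 'k) \<Rightarrow> ('v, 'w, 'k) arrays \<Rightarrow> 'k" where
  "act = (\<lambda>(g, h) f (a, b). f (\<lambda>x. a x \<circ> g, \<lambda>x. inv h (b x)))"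

text \<open>
  \<open>L\<^sub>\<gamma>V \<otimes> L\<^sub>\<mu>W\<^sup>*\<close>; here \<open>L\<^sub>\<mu>W\<^sup>* = (L\<^sub>\<mu>W)\<^sup>*\<close> is taken to be the Schur module of the space \<open>W\<^sup>*\<close>.
\<close>

definition bi_schur ::
  "('k::field \<Rightarrow> 'v::ab_group_add \<Rightarrow> 'v) \<Rightarrow> ('k \<Rightarrow> 'w::ab_group_add \<Rightarrow> 'w) \<Rightarrow>
   (nat \<Rightarrow> nat) \<Rightarrow> (nat \<Rightarrow> nat) \<Rightarrow> (('v, 'w, 'k) arrays \<Rightarrow> 'k) set" where
  "bi_schur sV sW \<gamma> \<mu> = tensor (schur fscale (dual_space sV) \<gamma>) (schur sW UNIV \<mu>)"

text \<open>\<open>T\<^sub>t\<close>, with \<open>E = \<Lambda>\<^sup>t V\<close> and \<open>F\<^sup>* = (\<Lambda>\<^sup>t W)\<^sup>*\<close>\<close>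

definition tensor_algebra ::
  "('k::field \<Rightarrow> 'v::ab_group_add \<Rightarrow> 'v) \<Rightarrow> ('k \<Rightarrow> 'w::ab_group_add \<Rightarrow> 'w) \<Rightarrow>
   nat \<Rightarrow> (nat \<times> ('v, 'w, 'k) arrays \<Rightarrow> 'k) set" where
  "tensor_algebra sV sW t = direct_sum (\<lambda>d.
     tensor (row_tensor d (\<lambda>_. ext_power fscale (dual_space sV) t))
            (row_tensor d (\<lambda>_. ext_power sW UNIV t)))"

definition act_graded ::
  "('v \<Rightarrow> 'v) \<times> ('w \<Rightarrow> 'w) \<Rightarrow>
   (nat \<times> ('v, 'w, 'k) arrays \<Rightarrow> 'k) \<Rightarrow> nat \<times> ('v, 'w, 'k) arrays \<Rightarrow> 'k" where
  "act_graded x F = (\<lambda>(d, p). act x (\<lambda>q. F (d, q)) p)"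

text \<open>
  \<open>Hom\<^sub>G(L, M)\<close>, for \<open>G\<close> acting on \<open>L\<close> by \<open>\<rho>\<close> and on \<open>M\<close> by \<open>\<tau>\<close>; a homomorphism is
  extended by 0 outside \<open>L\<close>.
\<close>

definition equivariant_homs ::
  "'g set \<Rightarrow> ('g \<Rightarrow> ('p \<Rightarrow> 'k) \<Rightarrow> 'p \<Rightarrow> 'k) \<Rightarrow> ('p \<Rightarrow> 'k) set \<Rightarrow>
   ('g \<Rightarrow> ('q \<Rightarrow> 'k) \<Rightarrow> 'q \<Rightarrow> 'k) \<Rightarrow> ('q \<Rightarrow> 'k) set \<Rightarrow> (('p \<Rightarrow> 'k::field) \<Rightarrow> 'q \<Rightarrow> 'k) set" where
  "equivariant_homs G \<rho> L \<tau> M = {\<Phi>.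
     (\<forall>x. x \<notin> L \<longrightarrow> \<Phi> x = 0) \<and> (\<forall>x\<in>L. \<Phi> x \<in> M) \<and>
     (\<forall>x\<in>L. \<forall>y\<in>L. \<Phi> (x + y) = \<Phi> x + \<Phi> y) \<and>
     (\<forall>c. \<forall>x\<in>L. \<Phi> (fscale c x) = fscale c (\<Phi> x)) \<and>
     (\<forall>g\<in>G. \<forall>x\<in>L. \<Phi> (\<rho> g x) = \<tau> g (\<Phi> x))}"

text \<open>
  The multiplicity of an irreducible module \<open>L\<close> in \<open>M\<close> is the dimension of \<open>Hom\<^sub>G(L, M)\<close>
  (the Schur modules are absolutely irreducible in characteristic 0).
\<close>

definition multiplicity_in ::
  "'g set \<Rightarrow> ('g \<Rightarrow> ('p \<Rightarrow> 'k) \<Rightarrow> 'p \<Rightarrow> 'k) \<Rightarrow> ('p \<Rightarrow> 'k) set \<Rightarrow>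
   ('g \<Rightarrow> ('q \<Rightarrow> 'k) \<Rightarrow> 'q \<Rightarrow> 'k) \<Rightarrow> ('q \<Rightarrow> 'k::field) set \<Rightarrow> nat" where
  "multiplicity_in G \<rho> L \<tau> M =
     vector_space.dim (\<lambda>c \<Phi> x. fscale c (\<Phi> x)) (equivariant_homs G \<rho> L \<tau> M)"

definition T_multiplicity ::
  "('k::field \<Rightarrow> 'v::ab_group_add \<Rightarrow> 'v) \<Rightarrow> ('k \<Rightarrow> 'w::ab_group_add \<Rightarrow> 'w) \<Rightarrow>
   nat \<Rightarrow> (nat \<Rightarrow> nat) \<Rightarrow> (nat \<Rightarrow> nat) \<Rightarrow> nat" where
  "T_multiplicity sV sW t \<alpha> \<beta> =
     multiplicity_in (GL sV \<times> GL sW) act (bi_schur sV sW \<alpha> \<beta>)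
       act_graded (tensor_algebra sV sW t)"

definition T_shape_relation ::
  "('k::field \<Rightarrow> 'v::ab_group_add \<Rightarrow> 'v) \<Rightarrow> ('k \<Rightarrow> 'w::ab_group_add \<Rightarrow> 'w) \<Rightarrow>
   nat \<Rightarrow> nat \<Rightarrow> (nat \<Rightarrow> nat) \<Rightarrow> (nat \<Rightarrow> nat) \<Rightarrow> bool" where
  "T_shape_relation sV sW t d \<gamma> \<mu> \<longleftrightarrow>
     bi_diagram (vector_space.dim sV UNIV) (vector_space.dim sW UNIV) \<gamma> \<mu> \<and>
     admissible t d \<gamma> \<and> admissible t d \<mu> \<and> \<gamma> \<noteq> \<mu> \<and>
     (\<forall>\<alpha> \<beta>. predecessor t d \<alpha> \<gamma> \<and> predecessor t d \<beta> \<mu> \<longrightarrow>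
        \<alpha> = \<beta> \<and> T_multiplicity sV sW t \<alpha> \<beta> = 1)"

definition gamma_diagram :: "nat \<Rightarrow> nat \<Rightarrow> nat \<Rightarrow> nat" where
  "gamma_diagram t u = diagram_of [t + u, t + u, t - 2 * u]"

definition lambda_diagram :: "nat \<Rightarrow> nat \<Rightarrow> nat \<Rightarrow> nat" where
  "lambda_diagram t u = diagram_of [t + 2 * u, t - u, t - u]"

end

theory Submission
  imports Defs
begin

text \<open>
  A predecessor of \<open>\<mu>\<close> is obtained by choosing \<open>\<mu>\<^sub>i\<^sub>+\<^sub>1 \<le> \<alpha>\<^sub>i \<le> \<mu>\<^sub>i\<close> with prescribed sum, so predecessors
  always exist, and there is only one if and only if \<open>\<mu>\<close> is a rectangle or has exactly two
  distinct row lengths (zeros included) among its \<open>d\<close> rows. If all bi-predecessors of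
  \<open>(\<gamma>|\<mu>)\<close> are symmetric, then \<open>\<gamma>\<close> and \<open>\<mu>\<close> have the same unique predecessor; comparing its
  rows leaves only the diagrams \<open>\<gamma>\<^sub>u\<close> and \<open>\<lambda>\<^sub>u\<close> of degree 3, with predecessor \<open>(t + u, t - u)\<close>.

  Conversely, the multiplicity of \<open>L\<^sub>\<alpha>V \<otimes> L\<^sub>\<alpha>W\<^sup>*\<close> for \<open>\<alpha> = (t + u, t - u)\<close> is computed without the
  general theory of highest weights. The Garnir relations show that \<open>L\<^sub>\<alpha>V\<close> is spanned by the
  translates of its highest weight vector, so a homomorphism is determined by the image of
  this vector. Scalings and permutations of basis vectors already force that image into degree
  2 and determine it up to a factor. Finally, an explicit antisymmetrization is a nonzero
  homomorphism, because its value at one place is a sum of zeros and ones, not all of them zero.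
\<close>


section \<open>Diagrams with a unique predecessor\<close>

text \<open>No characters and no complete reducibility enter, so the multiplicity is found from
  values of functions. This works for \<alpha> = (t + u, t - u) because a vector with the weight of
  the highest one contains each of the first t - u basis indices twice, each of the next 2u once and
  no other, while its two rows, being alternating, contain no repetition. Only the distribution of
  the 2u middle indices over the two rows is left open, and permutations of these indices, which act
  on the highest weight vector by their sign, reach every distribution. One value therefore
  determines all the others, and no raising operators appear. A second obstacle is that the modules
  of V consist of functions of linear forms and those of W* of functions of vectors. Both are
  instances of one locale about a subspace \<open>X\<close> with a group acting on the arguments:
  \<open>X\<close> is the dual space of V in one case and the whole of W in the other.\<close>

lemma support_initial:
  assumes "diagram \<mu>" and "num_rows \<mu> \<le> d" and "d \<le> i"
  shows "\<mu> i = 0"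
proof (rule ccontr)
  assume "\<mu> i \<noteq> 0"
  have "antimono \<mu>" and fin: "finite {i. \<mu> i \<noteq> 0}"
    using assms(1) by (auto simp: diagram_def)
  then have "{..i} \<subseteq> {i. \<mu> i \<noteq> 0}"
    using \<open>\<mu> i \<noteq> 0\<close> by (fastforce dest: antimonoD)
  then have "card {..i} \<le> num_rows \<mu>"
    unfolding num_rows_def using fin by (rule card_mono[rotated])
  then show False using assms by simp
qed

text \<open>Summing over a fixed range of \<open>d\<close> rows, zero rows included, removes the set
  of nonzero rows from all later arguments, so diagrams with different numbers of rows are compared
  by the same formula.\<close>

lemma admissible_iff:
  "admissible t d \<mu> \<longleftrightarrow> antimono \<mu> \<and> (\<forall>i\<ge>d. \<mu> i = 0) \<and> (\<Sum>i<d. \<mu> i) = t * d"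
  (is "_ \<longleftrightarrow> ?R")
proof -
  have size: "diagram_size \<mu> = (\<Sum>i<d. \<mu> i)" and fin: "finite {i. \<mu> i \<noteq> 0}"
    and card: "num_rows \<mu> \<le> d" if z: "\<forall>i\<ge>d. \<mu> i = 0"
  proof -
    have sub: "{i. \<mu> i \<noteq> 0} \<subseteq> {..<d}" by (rule subsetI, rule ccontr) (use z in simp)
    show "diagram_size \<mu> = (\<Sum>i<d. \<mu> i)"
      unfolding diagram_size_def using sub by (intro sum.mono_neutral_left) auto
    show "finite {i. \<mu> i \<noteq> 0}" using sub by (rule finite_subset) simp
    show "num_rows \<mu> \<le> d"
      unfolding num_rows_def using card_mono[OF _ sub] by simp
  qed
  show ?thesis
  proof
    assume a: "admissible t d \<mu>"
    then have "\<forall>i\<ge>d. \<mu> i = 0" unfolding admissible_def using support_initial by blast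
    with a size show ?R by (auto simp: admissible_def diagram_def)
  next
    assume ?R
    with size fin card show "admissible t d \<mu>" by (auto simp: admissible_def diagram_def)
  qed
qed

text \<open>A discrete intermediate value property: the integer points of a box attain every total
  between those of its two extreme corners.\<close>

lemma sum_between:
  fixes l h :: "nat \<Rightarrow> nat"
  assumes "\<And>i. i < N \<Longrightarrow> l i \<le> h i" and "(\<Sum>i<N. l i) \<le> T" and "T \<le> (\<Sum>i<N. h i)"
  shows "\<exists>f. (\<forall>i<N. l i \<le> f i \<and> f i \<le> h i) \<and> (\<Sum>i<N. f i) = T"
  using assms
proof (induction N arbitrary: T)
  case (Suc N)
  \<comment> \<open>Greedy choice: row \<open>N\<close> takes as much as it may while the lower
    bounds of the remaining rows can still be met.\<close>
  define x where "x = max (l N) (min (h N) (T - (\<Sum>i<N. l i)))"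
  have lh: "l N \<le> h N" "(\<Sum>i<N. l i) \<le> (\<Sum>i<N. h i)"
    using Suc.prems(1) by (auto intro: sum_mono)
  have x: "l N \<le> x" "x \<le> h N" "x \<le> T" "(\<Sum>i<N. l i) \<le> T - x" "T - x \<le> (\<Sum>i<N. h i)"
    using Suc.prems(2,3) lh unfolding x_def by (auto simp: max_def min_def)
  obtain f where f: "\<forall>i<N. l i \<le> f i \<and> f i \<le> h i" "(\<Sum>i<N. f i) = T - x"
    using Suc.IH[of "T - x"] Suc.prems(1) x by auto
  show ?case
    by (rule exI[of _ "f(N := x)"]) (use f x in \<open>auto simp: less_Suc_eq\<close>)
qed simp

text \<open>The bound \<mu> 0 \<le> \<alpha> 0 + t is derived instead of assumed: the differences
  \<mu> i - \<alpha> i are nonnegative and add up to t, so none of them exceeds t.\<close>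

lemma predecessorI:
  assumes "admissible t d \<mu>" and d: "1 \<le> d"
    and b: "\<And>i. i < d - 1 \<Longrightarrow> \<mu> (Suc i) \<le> \<alpha> i \<and> \<alpha> i \<le> \<mu> i"
    and z: "\<And>i. d - 1 \<le> i \<Longrightarrow> \<alpha> i = 0"
    and s: "(\<Sum>i<d-1. \<alpha> i) = t * (d - 1)"
  shows "predecessor t d \<alpha> \<mu>"
proof -
  have \<mu>: "antimono \<mu>" "\<forall>i\<ge>d. \<mu> i = 0" "(\<Sum>i<d. \<mu> i) = t * d"
    using assms(1) by (auto simp: admissible_iff)
  obtain e where e: "d = Suc e" using d by (cases d) auto
  have up: "\<alpha> i \<le> \<mu> i" and lo: "\<mu> (Suc i) \<le> \<alpha> i" for i
    using b[of i] z[of i] \<mu>(2) e by (cases "i < d - 1"; auto)+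
  have "antimono \<alpha>"
    unfolding antimono_iff_le_Suc using up lo order.trans by blast
  then have adm: "admissible t (d - 1) \<alpha>"
    using z s by (auto simp: admissible_iff)
  have "\<mu> 0 \<le> \<alpha> 0 + t"
  proof -
    have "(\<Sum>i<d. \<mu> i) = \<mu> 0 + (\<Sum>i<e. \<mu> (Suc i))"
      unfolding e by (rule sum.lessThan_Suc_shift)
    moreover have "(\<Sum>i<d. \<alpha> i) = \<alpha> 0 + (\<Sum>i<e. \<alpha> (Suc i))"
      unfolding e by (rule sum.lessThan_Suc_shift)
    moreover have "(\<Sum>i<d. \<alpha> i) = t * e" using s z e by simp
    moreover have "(\<Sum>i<e. \<alpha> (Suc i)) \<le> (\<Sum>i<e. \<mu> (Suc i))"
      by (intro sum_mono up)
    ultimately show ?thesis using \<mu>(3) e by (simp add: algebra_simps)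
  qed
  then show ?thesis
    unfolding predecessor_def using assms(1) adm up lo by auto
qed

lemma predecessorD:
  assumes "predecessor t d \<alpha> \<mu>" and "1 \<le> d"
  shows "admissible t d \<mu>" and "\<mu> (Suc i) \<le> \<alpha> i" and "\<alpha> i \<le> \<mu> i"
    and "d - 1 \<le> i \<Longrightarrow> \<alpha> i = 0" and "(\<Sum>i<d-1. \<alpha> i) = t * (d - 1)"
  using assms unfolding predecessor_def admissible_iff
  by (auto, metis not0_implies_Suc)

text \<open>The number t is the average of the \<open>Suc e\<close> rows, and an extreme row equals
  the average only if all rows do.\<close>

lemma admissible_first_last:
  assumes "admissible t (Suc e) \<mu>"
  shows "t \<le> \<mu> 0" and "\<mu> e \<le> t"
    and "\<mu> 0 = t \<or> \<mu> e = t \<Longrightarrow> i \<le> e \<Longrightarrow> \<mu> i = t"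
proof -
  have \<mu>: "antimono \<mu>" "(\<Sum>i<Suc e. \<mu> i) = t * Suc e"
    using assms by (auto simp: admissible_iff)
  have le0: "\<mu> i \<le> \<mu> 0" for i using \<mu>(1) by (simp add: antimonoD)
  have lee: "i \<le> e \<Longrightarrow> \<mu> e \<le> \<mu> i" for i using \<mu>(1) by (simp add: antimonoD)
  have "(\<Sum>i<Suc e. \<mu> i) \<le> (\<Sum>i<Suc e. \<mu> 0)" by (intro sum_mono le0)
  then have "t * Suc e \<le> \<mu> 0 * Suc e" using \<mu>(2) by (simp add: mult.commute)
  then show 1: "t \<le> \<mu> 0" by (metis mult_le_cancel2 zero_less_Suc)
  have "(\<Sum>i<Suc e. \<mu> e) \<le> (\<Sum>i<Suc e. \<mu> i)" by (intro sum_mono lee) auto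
  then have "\<mu> e * Suc e \<le> t * Suc e" using \<mu>(2) by (simp add: mult.commute)
  then show "\<mu> e \<le> t" by (metis mult_le_cancel2 zero_less_Suc)
  assume h: "\<mu> 0 = t \<or> \<mu> e = t" and i: "i \<le> e"
  show "\<mu> i = t"
  proof (rule ccontr)
    assume ne: "\<mu> i \<noteq> t"
    from h show False
    proof
      assume "\<mu> 0 = t"
      then have "(\<Sum>i<Suc e. \<mu> i) < (\<Sum>i<Suc e. t)"
        using le0 ne i by (intro sum_strict_mono_ex1) (auto intro!: bexI[of _ i] simp: le_less)
      then show False using \<mu>(2) by simp
    next
      assume "\<mu> e = t"
      moreover from this have "\<mu> e < \<mu> i" using lee[OF i] ne by simp
      ultimately have "(\<Sum>i<Suc e. t) < (\<Sum>i<Suc e. \<mu> i)"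
        using lee i by (intro sum_strict_mono_ex1) (auto intro!: bexI[of _ i])
      then show False using \<mu>(2) by simp
    qed
  qed
qed

text \<open>Omitting the first row removes at least the average t, omitting the last row at most t.
  Hence \<open>t * e\<close> lies between the smallest and the largest total that interlacing
  permits.\<close>

lemma predecessor_exists:
  assumes "admissible t d \<mu>" and "1 \<le> d"
  obtains \<alpha> where "predecessor t d \<alpha> \<mu>"
proof -
  obtain e where e: "d = Suc e" using assms(2) by (cases d) auto
  have \<mu>: "antimono \<mu>" "(\<Sum>i<Suc e. \<mu> i) = t * Suc e"
    using assms e by (auto simp: admissible_iff)
  have "(\<Sum>i<e. \<mu> (Suc i)) \<le> t * e"
    using \<mu>(2) admissible_first_last(1)[of t e \<mu>] assms e
    by (simp add: sum.lessThan_Suc_shift del: sum.lessThan_Suc)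
  moreover have "t * e \<le> (\<Sum>i<e. \<mu> i)"
    using \<mu>(2) admissible_first_last(2)[of t e \<mu>] assms e by simp
  ultimately obtain f where f: "\<forall>i<e. \<mu> (Suc i) \<le> f i \<and> f i \<le> \<mu> i" "(\<Sum>i<e. f i) = t * e"
    using sum_between[of e "\<lambda>i. \<mu> (Suc i)" \<mu> "t * e"] \<mu>(1) by (auto simp: antimono_iff_le_Suc)
  have "predecessor t d (\<lambda>i. if i < e then f i else 0) \<mu>"
    using assms f e by (intro predecessorI) auto
  then show ?thesis by (rule that)
qed

text \<open>\<mu> has the two lengths a > b, dropping after row \<open>k\<close>; interlacing then
  fixes every row of \<alpha> except row \<open>k\<close>, whose length \<open>c\<close> lies
  strictly between. Here \<open>e\<close> is d - 1: the rows of \<mu> are 0 to \<open>e\<close>,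
  those of \<alpha> are 0 to \<open>e\<close> - 1, and \<open>b\<close> may be 0.\<close>

definition step_at :: "nat \<Rightarrow> nat \<Rightarrow> nat \<Rightarrow> nat \<Rightarrow> nat \<Rightarrow> (nat \<Rightarrow> nat) \<Rightarrow> (nat \<Rightarrow> nat) \<Rightarrow> bool" where
  "step_at e k a c b \<alpha> \<mu> \<longleftrightarrow> k < e \<and> b < c \<and> c < a \<and>
     (\<forall>i\<le>k. \<mu> i = a) \<and> (\<forall>i. k < i \<and> i \<le> e \<longrightarrow> \<mu> i = b) \<and>
     (\<forall>i<k. \<alpha> i = a) \<and> \<alpha> k = c \<and> (\<forall>i. k < i \<and> i < e \<longrightarrow> \<alpha> i = b)"

text \<open>
  If some row of \<open>\<alpha>\<close> can be lengthened and another one shortened, then moving one box from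
  the latter to the former gives a second predecessor.
\<close>

lemma unique_predecessor_cases:
  assumes p: "predecessor t (Suc e) \<alpha> \<mu>"
    and uniq: "\<And>\<beta>. predecessor t (Suc e) \<beta> \<mu> \<Longrightarrow> \<beta> = \<alpha>"
  shows "(\<forall>i\<le>e. \<mu> i = t) \<or> (\<exists>k a c b. step_at e k a c b \<alpha> \<mu>)"
proof (rule disjCI)
  assume nt: "\<nexists>k a c b. step_at e k a c b \<alpha> \<mu>"
  have adm: "admissible t (Suc e) \<mu>" using predecessorD(1)[OF p] by simp
  have \<mu>: "antimono \<mu>" "(\<Sum>i<Suc e. \<mu> i) = t * Suc e"
    using adm by (auto simp: admissible_iff)
  have lo: "\<mu> (Suc i) \<le> \<alpha> i" and up: "\<alpha> i \<le> \<mu> i" for i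
    using predecessorD(2,3)[OF p] by auto
  have \<alpha>0: "e \<le> i \<Longrightarrow> \<alpha> i = 0" for i using predecessorD(4)[OF p] by simp
  have s: "(\<Sum>i<e. \<alpha> i) = t * e" using predecessorD(5)[OF p] by simp
  have move: "i = j" if ij: "i < e" "j < e" "\<alpha> i < \<mu> i" "\<mu> (Suc j) < \<alpha> j" for i j
  proof (rule ccontr)
    assume ne: "i \<noteq> j"
    let ?\<beta> = "\<alpha>(i := Suc (\<alpha> i), j := \<alpha> j - 1)"
    have ds: "(\<Sum>k<e. g k) = g i + g j + (\<Sum>k\<in>{..<e} - {i} - {j}. g k)" for g :: "nat \<Rightarrow> nat"
      using ij ne by (simp add: sum.remove[of "{..<e}" i] sum.remove[of "{..<e} - {i}" j])
    have "(\<Sum>k<e. ?\<beta> k) = (\<Sum>k<e. \<alpha> k)"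
      unfolding ds using ij ne by (auto intro!: sum.cong)
    then have "predecessor t (Suc e) ?\<beta> \<mu>"
      using ij ne lo up \<alpha>0 s adm
      by (intro predecessorI) (auto simp: le_diff_conv Suc_le_eq less_diff_conv
          intro: le_SucI order.trans[OF diff_le_self] less_imp_le Suc_leI)
    then have "?\<beta> = \<alpha>" by (rule uniq)
    then have "?\<beta> i = \<alpha> i" by simp
    then show False using ne by simp
  qed
  have "\<mu> 0 = t \<or> \<mu> e = t"
  proof (rule ccontr)
    assume "\<not> ?thesis"
    then have lt: "t < \<mu> 0" "\<mu> e < t" using admissible_first_last(1,2)[OF adm] by auto
    have "\<exists>j<e. \<mu> (Suc j) < \<alpha> j"
    proof (rule ccontr)
      assume "\<not> ?thesis"
      then have "(\<Sum>i<e. \<mu> (Suc i)) = (\<Sum>i<e. \<alpha> i)" using lo by (intro sum.cong refl) (metis lessThan_iff le_antisym not_less)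
      then show False using lt \<mu>(2) s by (simp add: sum.lessThan_Suc_shift del: sum.lessThan_Suc)
    qed
    then obtain k where k: "k < e" "\<mu> (Suc k) < \<alpha> k" by blast
    have "\<exists>j<e. \<alpha> j < \<mu> j"
    proof (rule ccontr)
      assume "\<not> ?thesis"
      then have "(\<Sum>i<e. \<mu> i) = (\<Sum>i<e. \<alpha> i)" using up by (intro sum.cong refl) (metis lessThan_iff le_antisym not_less)
      then show False using lt \<mu>(2) s by simp
    qed
    then obtain j where j: "j < e" "\<alpha> j < \<mu> j" by blast
    have jk: "j = k" using move j k by blast
    \<comment> \<open>Row \<open>k\<close> can be both lengthened and shortened, so any other row
      that could move either way would contradict \<open>move\<close>. Away from \<open>k\<close>
      the chain \<mu> (Suc i) \<le> \<alpha> i \<le> \<mu> i thus collapses to equalities.\<close>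
    have eq: "\<alpha> i = \<mu> i \<and> \<mu> (Suc i) = \<mu> i" if "i < e" "i \<noteq> k" for i
      using move[of i k] move[of k i] that j k jk lo[of i] up[of i] by (metis le_antisym le_neq_implies_less)
    have A: "i \<le> k \<Longrightarrow> \<mu> i = \<mu> 0" for i
      using k(1) by (induction i) (auto simp: eq)
    have B: "i \<le> e \<Longrightarrow> \<mu> i = \<mu> (Suc k)" if "Suc k \<le> i" for i
      using that by (induction i rule: dec_induct) (auto simp: eq)
    have "step_at e k (\<mu> 0) (\<alpha> k) (\<mu> (Suc k)) \<alpha> \<mu>"
      unfolding step_at_def
    proof (intro conjI allI impI)
      show "\<alpha> k < \<mu> 0" using j jk A[of k] by simp
      show "\<alpha> i = \<mu> 0" if "i < k" for i using eq[of i] that k(1) A[of i] by auto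
      show "\<alpha> i = \<mu> (Suc k)" if "k < i \<and> i < e" for i using eq[of i] that B[of i] by auto
      show "\<mu> i = \<mu> (Suc k)" if "k < i \<and> i \<le> e" for i using that B[of i] by auto
      show "\<mu> i = \<mu> 0" if "i \<le> k" for i using A[OF that] .
      show "k < e" "\<mu> (Suc k) < \<alpha> k" by fact+
    qed (rule refl)
    then show False using nt by blast
  qed
  then show "\<forall>i\<le>e. \<mu> i = t" using admissible_first_last(3)[OF adm] by blast
qed

section \<open>Two diagrams with the same unique predecessor\<close>

lemma step_at_sum:
  assumes "step_at e k a c b \<alpha> \<mu>" and "(\<Sum>i<Suc e. \<mu> i) = t * Suc e"
  shows "Suc k * a + (e - k) * b = t * Suc e"
proof -
  have k: "k < e" using assms(1) by (simp add: step_at_def)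
  then have "{..<Suc e} = {..k} \<union> {Suc k..<Suc e}" by auto
  then have "(\<Sum>i<Suc e. \<mu> i) = (\<Sum>i\<le>k. \<mu> i) + (\<Sum>i=Suc k..<Suc e. \<mu> i)"
    by (metis (no_types, lifting) sum.union_disjoint finite_atMost finite_atLeastLessThan ivl_disj_int_one(7) atMost_iff atLeastLessThan_iff disjoint_iff Suc_n_not_le_n order.trans)
  also have "(\<Sum>i\<le>k. \<mu> i) = (\<Sum>i\<le>k. a)"
    using assms(1) by (intro sum.cong) (auto simp: step_at_def)
  also have "(\<Sum>i=Suc k..<Suc e. \<mu> i) = (\<Sum>i=Suc k..<Suc e. b)"
    using assms(1) by (intro sum.cong) (auto simp: step_at_def)
  finally show ?thesis using assms(2) by simp
qed

text \<open>\<alpha> displays one of the two lengths, namely a = \<alpha> 0 if \<open>k\<close> > 0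
  and b = \<alpha> 1 if \<open>k\<close> = 0 (row 1 exists because 2 \<le> e). The total size then
  gives the other length.\<close>

lemma step_at_same:
  assumes e: "2 \<le> e" and g: "admissible t (Suc e) \<gamma>" and l: "admissible t (Suc e) \<mu>"
    and sg: "step_at e k a c b \<alpha> \<gamma>" and sl: "step_at e k a' c' b' \<alpha> \<mu>"
  shows "\<gamma> = \<mu>"
proof -
  have k: "k < e" using sg by (simp add: step_at_def)
  have S: "Suc k * a + (e - k) * b = Suc k * a' + (e - k) * b'"
    using step_at_sum[OF sg] step_at_sum[OF sl] g l by (simp add: admissible_iff)
  have "a = a' \<and> b = b'"
  proof (cases "k = 0")
    case True
    then have "b = \<alpha> 1" "b' = \<alpha> 1" using sg sl e by (auto simp: step_at_def)
    then show ?thesis using S True by simp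
  next
    case False
    then have "a = \<alpha> 0" "a' = \<alpha> 0" using sg sl by (auto simp: step_at_def)
    then show ?thesis using S k by simp
  qed
  then have "\<gamma> i = \<mu> i" for i
    using sg sl g l unfolding step_at_def admissible_iff
    by (cases "i \<le> k"; cases "i \<le> e") auto
  then show ?thesis by blast
qed

text \<open>Read from \<gamma>, the rows of \<alpha> are a, .., a, c, b, .., b with strict drops
  next to row \<open>k\<close>; read from \<mu>, the drops lie next to row \<open>k'\<close>. Both
  readings can hold only if \<alpha> has exactly two rows, whose single drop comes after row 0 in
  one reading and before row 1 in the other.\<close>

lemma step_at_less:
  assumes e: "2 \<le> e"
    and sg: "step_at e k a c b \<alpha> \<gamma>" and sl: "step_at e k' a' c' b' \<alpha> \<mu>" and "k < k'"
  shows "e = 2 \<and> k = 0 \<and> k' = 1"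
proof -
  have "k = 0"
  proof (rule ccontr)
    assume "k \<noteq> 0"
    then have "\<alpha> 0 = a" "\<alpha> k = c" "\<alpha> 0 = a'" "\<alpha> k = a'" "c < a"
      using sg sl assms(4) by (auto simp: step_at_def)
    then show False by simp
  qed
  moreover have "k' = 1"
  proof (rule ccontr)
    assume "k' \<noteq> 1"
    then have "\<alpha> 0 = a'" "\<alpha> 1 = a'"
      using sl assms(4) \<open>k = 0\<close> by (simp_all add: step_at_def)
    moreover have "\<alpha> 0 = c" "\<alpha> 1 = b" "b < c"
      using sg \<open>k = 0\<close> e by (simp_all add: step_at_def)
    ultimately show False by simp
  qed
  moreover have "e = 2"
  proof (rule ccontr)
    assume "e \<noteq> 2"
    then have "\<alpha> 1 = b" "\<alpha> 2 = b"
      using sg \<open>k = 0\<close> e by (simp_all add: step_at_def)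
    moreover have "\<alpha> 1 = c'" "\<alpha> 2 = b'" "b' < c'"
      using sl \<open>k' = 1\<close> \<open>e \<noteq> 2\<close> e by (simp_all add: step_at_def)
    ultimately show False by simp
  qed
  ultimately show ?thesis by simp
qed

lemma step_at_three:
  assumes g: "admissible t 3 \<gamma>" and l: "admissible t 3 \<mu>"
    and p: "(\<Sum>i<2. \<alpha> i) = t * 2"
    and sg: "step_at 2 0 a c b \<alpha> \<gamma>" and sl: "step_at 2 1 a' c' b' \<alpha> \<mu>"
  shows "\<exists>u\<in>{1..t div 2}. \<gamma> = lambda_diagram t u \<and> \<mu> = gamma_diagram t u"
proof -
  have \<gamma>: "\<gamma> 0 = a" "\<gamma> 1 = b" "\<gamma> 2 = b" "\<alpha> 0 = c" "\<alpha> 1 = b" "b < c"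
    and \<mu>: "\<mu> 0 = a'" "\<mu> 1 = a'" "\<mu> 2 = b'" "\<alpha> 0 = a'"
    using sg sl by (auto simp: step_at_def)
  have s: "c + b = 2 * t" using p \<gamma> by (simp add: numeral_2_eq_2)
  have s1: "a + 2 * b = 3 * t" using step_at_sum[OF sg, of t] g by (simp add: admissible_iff)
  have s2: "2 * a' + b' = 3 * t" using step_at_sum[OF sl, of t] l by (simp add: admissible_iff)
  \<comment> \<open>\<open>u\<close> is the deviation of \<alpha> = (c, b) from a rectangle. It is
    positive since b < c, and 2u \<le> t since the third row b' = t - 2u of \<mu> cannot be
    negative.\<close>
  define u where "u = t - b"
  have u: "u \<in> {1..t div 2}" "a = t + 2 * u" "b = t - u" "a' = t + u" "b' = t - 2 * u"
    using s s1 s2 \<gamma> \<mu> unfolding u_def by auto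
  have z: "\<gamma> i = 0" "\<mu> i = 0" if "3 \<le> i" for i using g l that by (auto simp: admissible_iff)
  have cs: "i = 0 \<or> i = 1 \<or> i = 2 \<or> 3 \<le> i" for i :: nat by auto
  have nd: "nth_default 0 [x, y, w] i = (if i = 0 then x else if i = 1 then y else if i = 2 then w else 0)"
    for x y w i :: nat
    using cs[of i] by (auto simp: nth_default_def numeral_2_eq_2)
  have "\<gamma> i = lambda_diagram t u i \<and> \<mu> i = gamma_diagram t u i" for i
    unfolding lambda_diagram_def gamma_diagram_def nd using cs[of i] z \<gamma>(1-3) \<mu>(1-3) u by auto
  then show ?thesis using u(1) by blast
qed

lemma T_shape_relation_cases:
  assumes T: "T_shape_relation sV sW t d \<gamma> \<mu>" and d: "3 \<le> d"
  shows "d = 3 \<and> (\<exists>u\<in>{1..t div 2}. (\<gamma>, \<mu>) = (gamma_diagram t u, lambda_diagram t u) \<or>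
          (\<gamma>, \<mu>) = (lambda_diagram t u, gamma_diagram t u))"
proof -
  obtain e where e: "d = Suc e" "2 \<le> e" using d by (cases d) auto
  have g: "admissible t (Suc e) \<gamma>" and l: "admissible t (Suc e) \<mu>" and ne: "\<gamma> \<noteq> \<mu>"
    and sym: "\<And>\<alpha> \<beta>. predecessor t (Suc e) \<alpha> \<gamma> \<Longrightarrow> predecessor t (Suc e) \<beta> \<mu> \<Longrightarrow> \<alpha> = \<beta>"
    using T e by (auto simp: T_shape_relation_def)
  obtain \<alpha> where pg: "predecessor t (Suc e) \<alpha> \<gamma>" using predecessor_exists[OF g] by auto
  obtain \<alpha>' where "predecessor t (Suc e) \<alpha>' \<mu>" using predecessor_exists[OF l] by auto
  then have pl: "predecessor t (Suc e) \<alpha> \<mu>" using sym[OF pg] by auto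
  have s: "(\<Sum>i<e. \<alpha> i) = t * e" using predecessorD(5)[OF pg] by simp
  have cg: "(\<forall>i\<le>e. \<gamma> i = t) \<or> (\<exists>k a c b. step_at e k a c b \<alpha> \<gamma>)"
    by (rule unique_predecessor_cases[OF pg]) (use sym pl in blast)
  have cl: "(\<forall>i\<le>e. \<mu> i = t) \<or> (\<exists>k a c b. step_at e k a c b \<alpha> \<mu>)"
    by (rule unique_predecessor_cases[OF pl]) (use sym pg in blast)
  \<comment> \<open>This excludes a rectangle paired with a diagram having a drop: the rectangle
    makes every row of \<alpha> equal to t, whereas the drop makes two rows of \<alpha>
    differ.\<close>
  have const: False if "predecessor t (Suc e) \<alpha> \<nu>" "\<forall>i\<le>e. \<nu> i = t" "step_at e k a c b \<alpha> \<nu>'" for \<nu> \<nu>' k a c b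
  proof -
    have "\<alpha> i = t" if "i < e" for i
      using predecessorD(2,3)[OF \<open>predecessor t (Suc e) \<alpha> \<nu>\<close>, of i] that \<open>\<forall>i\<le>e. \<nu> i = t\<close> by (simp add: le_antisym)
    then have "\<alpha> 0 = t" "\<alpha> 1 = t" using e by auto
    moreover have "\<alpha> 0 \<noteq> \<alpha> 1 \<or> (k > 0 \<and> \<alpha> 0 \<noteq> \<alpha> k)"
      using that(3) e(2) by (cases k) (auto simp: step_at_def)
    ultimately show False using \<open>\<And>i. i < e \<Longrightarrow> \<alpha> i = t\<close> that(3) by (auto simp: step_at_def)
  qed
  have "\<not> ((\<forall>i\<le>e. \<gamma> i = t) \<and> (\<forall>i\<le>e. \<mu> i = t))"
  proof
    assume "(\<forall>i\<le>e. \<gamma> i = t) \<and> (\<forall>i\<le>e. \<mu> i = t)"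
    then have "\<gamma> i = \<mu> i" for i using g l by (cases "i \<le> e") (auto simp: admissible_iff)
    then show False using ne by blast
  qed
  then obtain k a c b k' a' c' b' where
    sg: "step_at e k a c b \<alpha> \<gamma>" and sl: "step_at e k' a' c' b' \<alpha> \<mu>"
    using cg cl const[OF pg] const[OF pl] by blast
  have "k \<noteq> k'" using step_at_same[OF e(2) g l sg] sl ne by blast
  then consider "k < k'" | "k' < k" by linarith
  then show ?thesis
  proof cases
    case 1
    then have *: "e = 2" "k = 0" "k' = 1" using step_at_less[OF e(2) sg sl] by auto
    show ?thesis
      using step_at_three[of t \<gamma> \<mu> \<alpha> a c b a' c' b'] g l s sg sl e(1) unfolding * by auto
  next
    case 2
    then have *: "e = 2" "k' = 0" "k = 1" using step_at_less[OF e(2) sl sg] by auto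
    show ?thesis
      using step_at_three[of t \<mu> \<gamma> \<alpha> a' c' b' a c b] g l s sg sl e(1) unfolding * by auto
  qed
qed


section \<open>Multilinear functions in coordinates\<close>

lemma vector_space_fscale: "vector_space (fscale :: 'k::field \<Rightarrow> ('p \<Rightarrow> 'k) \<Rightarrow> 'p \<Rightarrow> 'k)"
  by unfold_locales (auto simp: fscale_def fun_eq_iff algebra_simps)

interpretation fs: vector_space "fscale :: 'k::field \<Rightarrow> ('p \<Rightarrow> 'k) \<Rightarrow> 'p \<Rightarrow> 'k"
  by (rule vector_space_fscale)

lemma fscale_apply [simp]: "fscale r f p = r * f p"
  by (simp add: fscale_def)

lemma sum_fun_apply: "(\<Sum>i\<in>A. f i) p = (\<Sum>i\<in>A. f i p)"
  for f :: "'i \<Rightarrow> 'p \<Rightarrow> 'k::comm_monoid_add"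
  by (induction A rule: infinite_finite_induct) auto

lemma sum_PiE_insert:
  assumes "b \<notin> J"
  shows "(\<Sum>x\<in>PiE (insert b J) (\<lambda>_. A). F x) = (\<Sum>x\<in>PiE J (\<lambda>_. A). \<Sum>i\<in>A. F (x(b := i)))"
proof -
  have "(\<Sum>x\<in>PiE (insert b J) (\<lambda>_. A). F x) = (\<Sum>(i, x)\<in>A \<times> PiE J (\<lambda>_. A). F (x(b := i)))"
    unfolding PiE_insert_eq
    by (subst sum.reindex[OF inj_combinator[OF assms]]) (auto intro!: sum.cong)
  also have "\<dots> = (\<Sum>i\<in>A. \<Sum>x\<in>PiE J (\<lambda>_. A). F (x(b := i)))"
    by (simp add: sum.cartesian_product)
  also have "\<dots> = (\<Sum>x\<in>PiE J (\<lambda>_. A). \<Sum>i\<in>A. F (x(b := i)))" by (rule sum.swap)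
  finally show ?thesis .
qed

lemma permutation_of_bounded: "\<sigma> permutes {..<r::nat} \<Longrightarrow> permutation \<sigma>"
  using permutation_permutes by blast

lemma permutes_bounded [simp]: "\<sigma> permutes {..<r::nat} \<Longrightarrow> \<sigma> i < r \<longleftrightarrow> i < r"
  using permutes_in_image[of \<sigma> "{..<r}" i] by simp

lemma of_int_sign_idem: "of_int (sign p) * (of_int (sign p) * x) = (x :: 'k::comm_ring_1)"
  by (metis mult.assoc mult_1 of_int_1 of_int_mult sign_idempotent)

text \<open>
  The coordinate functions vanish outside \<open>X\<close>, so that products of them follow the convention
  on arguments outside \<open>X\<close> in the definition of \<open>ext_power\<close>.
\<close>

locale coord_space = vector_space s
  for s :: "'k::field_char_0 \<Rightarrow> 'x::ab_group_add \<Rightarrow> 'x" +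
  fixes X :: "'x set" and m :: nat and e :: "nat \<Rightarrow> 'x" and co :: "nat \<Rightarrow> 'x \<Rightarrow> 'k"
  assumes subspace_X: "subspace X"
    and e_in: "i < m \<Longrightarrow> e i \<in> X"
    and co_e: "i < m \<Longrightarrow> j < m \<Longrightarrow> co i (e j) = (if i = j then 1 else 0)"
    and co_linear: "i < m \<Longrightarrow> x \<in> X \<Longrightarrow> y \<in> X \<Longrightarrow> co i (s r x + y) = r * co i x + co i y"
    and co_outside: "i < m \<Longrightarrow> x \<notin> X \<Longrightarrow> co i x = 0"
    and co_expand: "x \<in> X \<Longrightarrow> (\<Sum>i<m. s (co i x) (e i)) = x"
begin

lemma X_scale: "x \<in> X \<Longrightarrow> s r x \<in> X" and X_add: "x \<in> X \<Longrightarrow> y \<in> X \<Longrightarrow> x + y \<in> X"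
  and X_0: "0 \<in> X" and X_sum: "(\<And>i. i \<in> A \<Longrightarrow> h i \<in> X) \<Longrightarrow> sum h A \<in> X"
  using subspace_X by (auto intro: subspace_scale subspace_add subspace_0 subspace_sum)

lemma co_0: "i < m \<Longrightarrow> co i 0 = 0"
  using co_linear[of i 0 0 1] X_0 by simp

lemma co_scale: "i < m \<Longrightarrow> x \<in> X \<Longrightarrow> co i (s r x) = r * co i x"
  using co_linear[of i x 0 r] X_0 co_0 by simp

lemma co_add: "i < m \<Longrightarrow> x \<in> X \<Longrightarrow> y \<in> X \<Longrightarrow> co i (x + y) = co i x + co i y"
  using co_linear[of i x y 1] by simp

lemma co_sum:
  assumes "i < m" and "\<And>j. j \<in> A \<Longrightarrow> h j \<in> X"
  shows "co i (sum h A) = (\<Sum>j\<in>A. co i (h j))"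
  using assms(2) by (induction A rule: infinite_finite_induct) (auto simp: co_0 co_add X_sum assms(1))

lemma co_eqI: "x \<in> X \<Longrightarrow> y \<in> X \<Longrightarrow> (\<And>i. i < m \<Longrightarrow> co i x = co i y) \<Longrightarrow> x = y"
  by (subst co_expand[symmetric], assumption, subst (2) co_expand[symmetric], assumption)
    (intro sum.cong refl, simp)

text \<open>The conventions of \<open>ext_power\<close> without alternation and for an arbitrary
  index set, so that single rows, ragged arrays and the boxes of a diagram are treated
  alike.\<close>

definition multilinear :: "'i set \<Rightarrow> (('i \<Rightarrow> 'x) \<Rightarrow> 'k) \<Rightarrow> bool" where
  "multilinear I f \<longleftrightarrow>
     (\<forall>a b. (\<forall>i\<in>I. a i = b i) \<longrightarrow> f a = f b) \<and>
     (\<forall>a. (\<exists>i\<in>I. a i \<notin> X) \<longrightarrow> f a = 0) \<and>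
     (\<forall>a. \<forall>i\<in>I. \<forall>r. \<forall>x\<in>X. \<forall>y\<in>X. f (a(i := s r x + y)) = r * f (a(i := x)) + f (a(i := y)))"

lemma multilinear_cong: "multilinear I f \<Longrightarrow> (\<And>i. i \<in> I \<Longrightarrow> a i = b i) \<Longrightarrow> f a = f b"
  and multilinear_outside: "multilinear I f \<Longrightarrow> i \<in> I \<Longrightarrow> a i \<notin> X \<Longrightarrow> f a = 0"
  and multilinear_linear: "multilinear I f \<Longrightarrow> i \<in> I \<Longrightarrow> x \<in> X \<Longrightarrow> y \<in> X \<Longrightarrow>
      f (a(i := s r x + y)) = r * f (a(i := x)) + f (a(i := y))"
  by (simp_all add: multilinear_def) blast+

lemma multilinear_add:
  "multilinear I f \<Longrightarrow> i \<in> I \<Longrightarrow> x \<in> X \<Longrightarrow> y \<in> X \<Longrightarrow> f (a(i := x + y)) = f (a(i := x)) + f (a(i := y))"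
  using multilinear_linear[of I f i x y a 1] by simp

lemma multilinear_zero: "multilinear I f \<Longrightarrow> i \<in> I \<Longrightarrow> f (a(i := 0)) = 0"
  using multilinear_add[of I f i 0 0 a] X_0 by simp

lemma multilinear_sum:
  assumes "multilinear I f" and "i \<in> I" and "\<And>j. j \<in> A \<Longrightarrow> h j \<in> X"
  shows "f (a(i := (\<Sum>j\<in>A. s (g j) (h j)))) = (\<Sum>j\<in>A. g j * f (a(i := h j)))"
  using assms(3)
  by (induction A rule: infinite_finite_induct)
     (auto simp: multilinear_zero[OF assms(1,2)] multilinear_linear[OF assms(1,2)] X_sum X_scale)

lemma multilinear_subspace: "fs.subspace (Collect (multilinear I))" for I :: "'i set"
proof (rule fs.subspaceI)
  fix f g :: "('i \<Rightarrow> 'x) \<Rightarrow> 'k" and r :: 'k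
  assume f: "f \<in> Collect (multilinear I)" and g: "g \<in> Collect (multilinear I)"
  show "f + g \<in> Collect (multilinear I)"
    using f g unfolding multilinear_def mem_Collect_eq plus_fun_apply
    by (intro conjI allI ballI impI; elim conjE) (metis, metis add_0, simp add: algebra_simps)
  show "fscale r f \<in> Collect (multilinear I)"
    using f unfolding multilinear_def mem_Collect_eq fscale_apply
    by (intro conjI allI ballI impI; elim conjE) (metis, metis mult_zero_right, simp add: algebra_simps)
qed (auto simp: multilinear_def)

lemma multilinear_fscale:
  "multilinear I f \<Longrightarrow> multilinear I (fscale c f)"
  using fs.subspace_scale[OF multilinear_subspace, of f I c] by simp

lemma multilinear_permute:
  fixes I :: "'i set"
  assumes "multilinear I f" and "\<pi> permutes I"
  shows "multilinear I (\<lambda>a. f (a \<circ> \<pi>))"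
proof -
  have in_I: "\<pi> i \<in> I \<longleftrightarrow> i \<in> I" for i using permutes_in_image[OF assms(2)] .
  have upd: "a(i := x) \<circ> \<pi> = (a \<circ> \<pi>)(inv \<pi> i := x)" for a :: "'i \<Rightarrow> 'x" and i x
    using permutes_inverses[OF assms(2)] by (auto simp: fun_eq_iff)
  have inv_I: "inv \<pi> i \<in> I \<longleftrightarrow> i \<in> I" for i
    using permutes_in_image[OF permutes_inv[OF assms(2)]] .
  show ?thesis
    unfolding multilinear_def upd
  proof (intro conjI allI ballI impI)
    fix a b :: "'i \<Rightarrow> 'x" assume "\<forall>i\<in>I. a i = b i"
    then show "f (a \<circ> \<pi>) = f (b \<circ> \<pi>)" using in_I by (intro multilinear_cong[OF assms(1)]) auto
  next
    fix a :: "'i \<Rightarrow> 'x" assume "\<exists>i\<in>I. a i \<notin> X"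
    then obtain i where "i \<in> I" "a i \<notin> X" by blast
    then show "f (a \<circ> \<pi>) = 0"
      using inv_I permutes_inverses[OF assms(2)]
      by (intro multilinear_outside[OF assms(1), of "inv \<pi> i"]) auto
  qed (use multilinear_linear[OF assms(1)] inv_I in blast)
qed

lemma multilinear_monomial:
  assumes "finite I" and x: "\<And>i. i \<in> I \<Longrightarrow> x i < m"
  shows "multilinear I (\<lambda>a. \<Prod>i\<in>I. co (x i) (a i))"
  unfolding multilinear_def
proof (intro conjI allI ballI impI)
  fix a assume "\<exists>i\<in>I. a i \<notin> X"
  then show "(\<Prod>i\<in>I. co (x i) (a i)) = 0"
    using assms co_outside by (auto simp: prod_zero_iff)
next
  fix a i r u v assume i: "i \<in> I" and uv: "u \<in> X" "v \<in> X"
  have *: "(\<Prod>j\<in>I. co (x j) ((a(i := w)) j)) = co (x i) w * (\<Prod>j\<in>I - {i}. co (x j) (a j))" for w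
    using assms(1) i by (subst prod.remove[of I i]) auto
  show "(\<Prod>j\<in>I. co (x j) ((a(i := s r u + v)) j)) =
    r * (\<Prod>j\<in>I. co (x j) ((a(i := u)) j)) + (\<Prod>j\<in>I. co (x j) ((a(i := v)) j))"
    unfolding * using co_linear[OF x[OF i] uv] by (simp add: algebra_simps)
qed (auto intro: prod.cong)

text \<open>The arguments are expanded one at a time; the set \<open>J\<close> holds the slots
  already filled with basis vectors. No membership in \<open>X\<close> is asked for: at an argument
  outside \<open>X\<close> both \<open>f\<close> and the coordinate functions vanish.\<close>

lemma multilinear_expand:
  fixes I :: "'i set"
  assumes f: "multilinear I f" and "finite I"
  shows "f a = (\<Sum>x\<in>PiE I (\<lambda>_. {..<m}). f (\<lambda>i. e (x i)) * (\<Prod>i\<in>I. co (x i) (a i)))"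
proof -
  have "f a = (\<Sum>x\<in>PiE J (\<lambda>_. {..<m}).
      f (\<lambda>i. if i \<in> J then e (x i) else a i) * (\<Prod>i\<in>J. co (x i) (a i)))"
    if "J \<subseteq> I" "finite J" for J
    using that(2,1)
  proof (induction J rule: finite_induct)
    case (insert b J)
    have b: "b \<in> I" using insert.prems by simp
    have one: "f (\<lambda>i. if i \<in> J then e (x i) else a i) =
       (\<Sum>k<m. co k (a b) * f (\<lambda>i. if i \<in> insert b J then e ((x(b := k)) i) else a i))" for x
    proof -
      let ?g = "\<lambda>i. if i \<in> J then e (x i) else a i"
      have "(?g(b := e k)) = (\<lambda>i. if i \<in> insert b J then e ((x(b := k)) i) else a i)" for k
        using insert.hyps by auto
      then have *: "f (\<lambda>i. if i \<in> insert b J then e ((x(b := k)) i) else a i) = f (?g(b := e k))" for k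
        by simp
      show ?thesis
      proof (cases "a b \<in> X")
        case True
        have "f ?g = f (?g(b := (\<Sum>k<m. s (co k (a b)) (e k))))"
          using insert.hyps co_expand[OF True] by (simp add: fun_upd_idem)
        also have "\<dots> = (\<Sum>k<m. co k (a b) * f (?g(b := e k)))"
          using e_in by (intro multilinear_sum[OF f b]) auto
        finally show ?thesis unfolding * .
      next
        case False
        then have "f ?g = 0" using insert.hyps by (intro multilinear_outside[OF f b]) auto
        then show ?thesis using co_outside[OF _ False] by simp
      qed
    qed
    have pr: "(\<Prod>i\<in>insert b J. co ((x(b := k)) i) (a i)) = co k (a b) * (\<Prod>i\<in>J. co (x i) (a i))" for x k
      using insert.hyps by (auto intro!: prod.cong)
    have "f a = (\<Sum>x\<in>PiE J (\<lambda>_. {..<m}).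
      f (\<lambda>i. if i \<in> J then e (x i) else a i) * (\<Prod>i\<in>J. co (x i) (a i)))"
      using insert by simp
    also have "\<dots> = (\<Sum>x\<in>PiE (insert b J) (\<lambda>_. {..<m}).
      f (\<lambda>i. if i \<in> insert b J then e (x i) else a i) * (\<Prod>i\<in>insert b J. co (x i) (a i)))"
      unfolding sum_PiE_insert[OF insert.hyps(2)] pr one
      by (auto simp: sum_distrib_right sum_distrib_left mult_ac intro!: sum.cong)
    finally show ?case .
  qed simp
  note this[OF order.refl assms(2)]
  also have "(\<Sum>x\<in>PiE I (\<lambda>_. {..<m}). f (\<lambda>i. if i \<in> I then e (x i) else a i) * (\<Prod>i\<in>I. co (x i) (a i))) =
    (\<Sum>x\<in>PiE I (\<lambda>_. {..<m}). f (\<lambda>i. e (x i)) * (\<Prod>i\<in>I. co (x i) (a i)))"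
    by (intro sum.cong refl arg_cong2[of _ _ _ _ "(*)"] multilinear_cong[OF f]) auto
  finally show ?thesis .
qed

lemma multilinear_eqI:
  assumes "multilinear I f" and "multilinear I g" and "finite I"
    and "\<And>x. (\<And>i. i \<in> I \<Longrightarrow> x i < m) \<Longrightarrow> f (\<lambda>i. e (x i)) = g (\<lambda>i. e (x i))"
  shows "f = g"
proof
  fix a
  show "f a = g a"
    unfolding multilinear_expand[OF assms(1,3), of a] multilinear_expand[OF assms(2,3), of a]
    using assms(4) by (intro sum.cong refl) (auto simp: PiE_mem)
qed

lemma multilinear_scale_all:
  assumes f: "multilinear I f" and "finite I" and a: "\<And>i. i \<in> I \<Longrightarrow> a i \<in> X"
  shows "f (\<lambda>i. s (g i) (a i)) = (\<Prod>i\<in>I. g i) * f a"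
proof -
  have "(\<Prod>i\<in>I. co (x i) (s (g i) (a i))) = (\<Prod>i\<in>I. g i) * (\<Prod>i\<in>I. co (x i) (a i))"
    if "x \<in> PiE I (\<lambda>_. {..<m})" for x
    unfolding prod.distrib[symmetric] using that a by (intro prod.cong refl co_scale) auto
  then show ?thesis
    unfolding multilinear_expand[OF f assms(2), of a]
      multilinear_expand[OF f assms(2), of "\<lambda>i. s (g i) (a i)"]
    by (simp add: sum_distrib_left mult_ac cong: sum.cong)
qed

lemma multilinear_transpose:
  assumes f: "multilinear I f" and ij: "i \<in> I" "j \<in> I" "i \<noteq> j"
    and alt: "\<And>a. a i = a j \<Longrightarrow> f a = 0"
  shows "f (a \<circ> transpose i j) = - f a"
proof (cases "a i \<in> X \<and> a j \<in> X")
  case True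
  define h where "h u v = f (a(i := u, j := v))" for u v
  have h0: "h u u = 0" for u unfolding h_def by (rule alt) (use ij in simp)
  have 1: "h (u + u') v = h u v + h u' v" if "u \<in> X" "u' \<in> X" for u u' v
    using multilinear_add[OF f ij(1) that, of "a(j := v)"] ij(3) by (simp add: h_def fun_upd_twist)
  have 2: "h u (v + v') = h u v + h u v'" if "v \<in> X" "v' \<in> X" for u v v'
    using multilinear_add[OF f ij(2) that, of "a(i := u)"] by (simp add: h_def)
  have "h (a i + a j) (a i + a j) = 0" by (rule h0)
  moreover have "h (a i + a j) (a i + a j) = h (a i) (a i + a j) + h (a j) (a i + a j)"
    using True by (intro 1) auto
  moreover have "\<dots> = h (a i) (a j) + h (a j) (a i)" using True by (simp add: 2 h0)
  ultimately have "h (a i) (a j) + h (a j) (a i) = 0" by simp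
  moreover have "h (a i) (a j) = f a" by (simp add: h_def)
  moreover have "h (a j) (a i) = f (a \<circ> transpose i j)"
    unfolding h_def by (rule arg_cong[of _ _ f]) (use ij in \<open>auto simp: transpose_def\<close>)
  ultimately show ?thesis by (simp add: eq_neg_iff_add_eq_0 add.commute)
next
  case False
  then have "f a = 0" using ij multilinear_outside[OF f] by blast
  moreover have "(a \<circ> transpose i j) i \<notin> X \<or> (a \<circ> transpose i j) j \<notin> X" using False by auto
  then have "f (a \<circ> transpose i j) = 0" using ij multilinear_outside[OF f] by blast
  ultimately show ?thesis by simp
qed


section \<open>Determinants of coordinates\<close>

text \<open>The wedge product of the coordinate functions with indices x 0, .., x (r - 1), written
  as the determinant of the matrix of all \<open>co (x i) (a j)\<close>.\<close>

definition coord_det :: "nat \<Rightarrow> (nat \<Rightarrow> nat) \<Rightarrow> (nat \<Rightarrow> 'x) \<Rightarrow> 'k" where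
  "coord_det r x a = (\<Sum>\<sigma> | \<sigma> permutes {..<r}. of_int (sign \<sigma>) * (\<Prod>i<r. co (x i) (a (\<sigma> i))))"

lemma coord_det_cong:
  "(\<And>i. i < r \<Longrightarrow> x i = y i) \<Longrightarrow> (\<And>i. i < r \<Longrightarrow> a i = b i) \<Longrightarrow> coord_det r x a = coord_det r y b"
  unfolding coord_det_def by (intro sum.cong refl arg_cong2[of _ _ _ _ "(*)"] prod.cong) auto

lemma coord_det_permute_args:
  assumes "\<rho> permutes {..<r}"
  shows "coord_det r x (a \<circ> \<rho>) = of_int (sign \<rho>) * coord_det r x a"
proof -
  have "coord_det r x a = (\<Sum>\<sigma> | \<sigma> permutes {..<r}. of_int (sign (\<rho> \<circ> \<sigma>)) *
      (\<Prod>i<r. co (x i) (a ((\<rho> \<circ> \<sigma>) i))))"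
    unfolding coord_det_def by (rule setum_permutations_compose_left[OF assms])
  also have "\<dots> = (\<Sum>\<sigma> | \<sigma> permutes {..<r}. of_int (sign \<rho>) * (of_int (sign \<sigma>) *
      (\<Prod>i<r. co (x i) (a (\<rho> (\<sigma> i))))))"
    by (intro sum.cong refl)
      (simp add: sign_compose[OF permutation_of_bounded[OF assms] permutation_of_bounded])
  also have "\<dots> = of_int (sign \<rho>) * coord_det r x (a \<circ> \<rho>)"
    by (simp add: coord_det_def sum_distrib_left)
  finally show ?thesis by (simp add: of_int_sign_idem)
qed

lemma coord_det_permute_index:
  assumes "\<rho> permutes {..<r}"
  shows "coord_det r (x \<circ> \<rho>) a = of_int (sign \<rho>) * coord_det r x a"
proof -
  have "coord_det r (x \<circ> \<rho>) a = (\<Sum>\<sigma> | \<sigma> permutes {..<r}. of_int (sign (\<sigma> \<circ> \<rho>)) *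
      (\<Prod>i<r. co (x (\<rho> i)) (a ((\<sigma> \<circ> \<rho>) i))))"
    unfolding coord_det_def comp_apply[of x \<rho>] by (rule sum_permutations_compose_right[OF assms])
  also have "\<dots> = (\<Sum>\<sigma> | \<sigma> permutes {..<r}. of_int (sign \<rho>) * (of_int (sign \<sigma>) *
      (\<Prod>i<r. co (x i) (a (\<sigma> i)))))"
  proof (intro sum.cong refl)
    fix \<sigma> assume "\<sigma> \<in> {\<sigma>. \<sigma> permutes {..<r}}"
    moreover have "(\<Prod>i<r. co (x (\<rho> i)) (a (\<sigma> (\<rho> i)))) = (\<Prod>i<r. co (x i) (a (\<sigma> i)))"
      using prod.permute[OF assms, of "\<lambda>i. co (x i) (a (\<sigma> i))"] by (simp add: comp_def)
    ultimately show "of_int (sign (\<sigma> \<circ> \<rho>)) * (\<Prod>i<r. co (x (\<rho> i)) (a ((\<sigma> \<circ> \<rho>) i))) =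
        of_int (sign \<rho>) * (of_int (sign \<sigma>) * (\<Prod>i<r. co (x i) (a (\<sigma> i))))"
      using assms by (simp add: sign_compose permutation_of_bounded)
  qed
  finally show ?thesis by (simp add: coord_det_def sum_distrib_left)
qed

lemma coord_det_repeated_arg:
  assumes "i < r" "j < r" "i \<noteq> j" "a i = a j"
  shows "coord_det r x a = 0"
proof -
  have "a \<circ> transpose i j = a" using assms(4) by (auto simp: fun_eq_iff transpose_def)
  moreover have "transpose i j permutes {..<r}" using assms by (intro permutes_swap_id) auto
  ultimately have "coord_det r x a = - coord_det r x a"
    using coord_det_permute_args[of "transpose i j" r x a] assms(3) by (simp add: sign_swap_id)
  then show ?thesis by simp
qed

lemma coord_det_repeated_index:
  assumes "\<not> inj_on x {..<r}"
  shows "coord_det r x a = 0"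
proof -
  obtain i j where ij: "i < r" "j < r" "i \<noteq> j" "x i = x j"
    using assms by (auto simp: inj_on_def)
  have "x \<circ> transpose i j = x" using ij(4) by (auto simp: fun_eq_iff transpose_def)
  moreover have "transpose i j permutes {..<r}" using ij by (intro permutes_swap_id) auto
  ultimately have "coord_det r x a = - coord_det r x a"
    using coord_det_permute_index[of "transpose i j" r x a] ij(3) by (simp add: sign_swap_id)
  then show ?thesis by simp
qed

lemma ext_power_iff:
  "f \<in> ext_power s X r \<longleftrightarrow>
     multilinear {..<r} f \<and> (\<forall>a i j. i < j \<and> j < r \<and> a i = a j \<longrightarrow> f a = 0)"
  by (simp add: ext_power_def multilinear_def Ball_def Bex_def)

lemma coord_det_in_ext_power:
  assumes x: "\<And>i. i < r \<Longrightarrow> x i < m"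
  shows "coord_det r x \<in> ext_power s X r"
  unfolding ext_power_iff
proof (intro conjI allI impI)
  have "coord_det r x = (\<Sum>\<sigma> | \<sigma> permutes {..<r}.
      fscale (of_int (sign \<sigma>)) (\<lambda>a. \<Prod>i<r. co (x i) ((a \<circ> \<sigma>) i)))"
    by (simp add: fun_eq_iff sum_fun_apply coord_det_def)
  also have "\<dots> \<in> Collect (multilinear {..<r})"
    using x by (intro fs.subspace_sum[OF multilinear_subspace] fs.subspace_scale[OF multilinear_subspace]
        CollectI multilinear_permute[where f = "\<lambda>a. \<Prod>i<r. co (x i) (a i)"] multilinear_monomial) auto
  finally show "multilinear {..<r} (coord_det r x)" by simp
next
  fix a :: "nat \<Rightarrow> 'x" and i j assume "i < j \<and> j < r \<and> a i = a j"
  then show "coord_det r x a = 0" by (intro coord_det_repeated_arg[of i r j]) auto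
qed

lemma ext_power_permute:
  assumes f: "f \<in> ext_power s X r" and "\<rho> permutes {..<r}"
  shows "f (a \<circ> \<rho>) = of_int (sign \<rho>) * f a"
  using assms(2) finite_lessThan
proof (induction arbitrary: a rule: permutes_induct)
  case (swap i j p)
  have ml: "multilinear {..<r} f" using f by (simp add: ext_power_iff)
  have alt: "b i = b j \<Longrightarrow> f b = 0" for b
    using f swap.hyps unfolding ext_power_iff by (metis lessThan_iff linorder_neqE_nat)
  have "f (a \<circ> (transpose i j \<circ> p)) = of_int (sign p) * f (a \<circ> transpose i j)"
    using swap.IH[of "a \<circ> transpose i j"] unfolding o_assoc .
  also have "f (a \<circ> transpose i j) = - f a"
    using swap.hyps by (intro multilinear_transpose[OF ml] alt) auto
  also have "of_int (sign p) * - f a = of_int (sign (transpose i j \<circ> p)) * f a"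
    using swap.hyps by (simp add: sign_compose sign_swap_id permutation_of_bounded permutation_swap_id)
  finally show ?case .
qed auto

text \<open>Averaging the coordinate expansion over all permutations of the arguments turns its
  monomials into determinants. Summing over all index maps, not just the increasing ones, avoids
  choosing a basis of the exterior power; the repetition is compensated by \<open>fact r\<close>,
  which is invertible in characteristic 0.\<close>

lemma ext_power_expand:
  assumes f: "f \<in> ext_power s X r"
  shows "f = (\<Sum>x\<in>PiE {..<r} (\<lambda>_. {..<m}). fscale (f (\<lambda>i. e (x i)) / fact r) (coord_det r x))"
proof
  fix a
  let ?S = "PiE {..<r} (\<lambda>_. {..<m})"
  have ml: "multilinear {..<r} f" using f by (simp add: ext_power_iff)
  have "fact r * f a = (\<Sum>\<rho> | \<rho> permutes {..<r}. of_int (sign \<rho>) * f (a \<circ> \<rho>))"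
  proof -
    have "(\<Sum>\<rho> | \<rho> permutes {..<r}. of_int (sign \<rho>) * f (a \<circ> \<rho>)) = (\<Sum>\<rho> | \<rho> permutes {..<r}. f a)"
      by (intro sum.cong refl) (simp add: ext_power_permute[OF f] of_int_sign_idem)
    then show ?thesis by (simp add: card_permutations)
  qed
  also have "\<dots> = (\<Sum>\<rho> | \<rho> permutes {..<r}. \<Sum>x\<in>?S. of_int (sign \<rho>) *
      (f (\<lambda>i. e (x i)) * (\<Prod>i<r. co (x i) (a (\<rho> i)))))"
    by (subst multilinear_expand[OF ml]) (auto simp: sum_distrib_left)
  also have "\<dots> = (\<Sum>x\<in>?S. f (\<lambda>i. e (x i)) * coord_det r x a)"
    by (subst sum.swap) (auto simp: coord_det_def sum_distrib_left mult_ac intro!: sum.cong)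
  finally have "f a = (\<Sum>x\<in>?S. f (\<lambda>i. e (x i)) * coord_det r x a) / fact r"
    by (simp add: field_simps)
  then show "f a = (\<Sum>x\<in>?S. fscale (f (\<lambda>i. e (x i)) / fact r) (coord_det r x)) a"
    by (simp add: sum_fun_apply sum_divide_distrib)
qed

text \<open>On basis vectors each factor is 0 or 1, so a nonzero determinant has a surviving term,
  and the permutation of that term is a right inverse of \<open>z\<close> on the first
  \<open>r\<close> indices.\<close>

lemma coord_det_basis_nonzero:
  assumes "coord_det r (\<lambda>i. i) (\<lambda>i. e (z i)) \<noteq> 0" and "r \<le> m" and z: "\<And>i. i < r \<Longrightarrow> z i < m"
  shows "bij_betw z {..<r} {..<r}"
proof -
  obtain \<sigma> where \<sigma>: "\<sigma> permutes {..<r}" "(\<Prod>i<r. co i (e (z (\<sigma> i)))) \<noteq> 0"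
    using assms(1) unfolding coord_det_def by (metis (no_types, lifting) mem_Collect_eq mult_zero_right sum.neutral)
  have "z (\<sigma> i) = i" if "i < r" for i
  proof -
    have "co i (e (z (\<sigma> i))) \<noteq> 0" using \<sigma>(2) that by (simp add: prod_zero_iff)
    then show ?thesis using that \<sigma>(1) assms(2) z[of "\<sigma> i"] by (auto simp: co_e split: if_splits)
  qed
  then have "bij_betw (z \<circ> \<sigma>) {..<r} {..<r}" by (intro bij_betwI'[of _ _ _]) auto
  then show ?thesis
    using bij_betw_comp_iff[OF permutes_imp_bij[OF \<sigma>(1)], of z "{..<r}"] by simp
qed

lemma coord_det_basis_permutes:
  assumes "z permutes {..<r}" and "r \<le> m"
  shows "coord_det r (\<lambda>i. i) (\<lambda>i. e (z i)) = of_int (sign z)"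
proof -
  have "coord_det r (\<lambda>i. i) (\<lambda>i. e (z i)) = of_int (sign z) * coord_det r (\<lambda>i. i) e"
    using coord_det_permute_args[OF assms(1), of "\<lambda>i. i" e] by (simp add: comp_def)
  also have "coord_det r (\<lambda>i. i) e = (\<Sum>\<sigma> | \<sigma> permutes {..<r}. if \<sigma> = id then 1 else 0)"
    unfolding coord_det_def
  proof (intro sum.cong refl)
    fix \<sigma> assume s: "\<sigma> \<in> {\<sigma>. \<sigma> permutes {..<r}}"
    show "of_int (sign \<sigma>) * (\<Prod>i<r. co i (e (\<sigma> i))) = (if \<sigma> = id then 1 else 0)"
    proof (cases "\<sigma> = id")
      case True
      then show ?thesis using assms(2) by (simp add: co_e)
    next
      case False
      then obtain i where "\<sigma> i \<noteq> i" by (auto simp: fun_eq_iff)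
      moreover from this have "i < r" using s by (metis lessThan_iff mem_Collect_eq permutes_not_in)
      moreover from this have "\<sigma> i < r" using s by simp
      ultimately have "co i (e (\<sigma> i)) = 0" using assms(2) by (simp add: co_e)
      then have "(\<Prod>i<r. co i (e (\<sigma> i))) = 0" using \<open>i < r\<close> by (auto simp: prod_zero_iff)
      then show ?thesis using False by simp
    qed
  qed
  also have "\<dots> = 1" by (simp add: finite_permutations)
  finally show ?thesis by simp
qed

lemma ext_power_subspace: "fs.subspace (ext_power s X r)"
proof (rule fs.subspaceI)
  show "0 \<in> ext_power s X r"
    using fs.subspace_0[OF multilinear_subspace] by (simp add: ext_power_iff)
next
  fix f g assume f: "f \<in> ext_power s X r" and g: "g \<in> ext_power s X r"
  have "(f + g) a = 0" if "i < j \<and> j < r \<and> a i = a j" for a :: "nat \<Rightarrow> 'x" and i j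
  proof -
    have "f a = 0" "g a = 0" using f g that unfolding ext_power_iff by blast+
    then show ?thesis by simp
  qed
  moreover have "multilinear {..<r} (f + g)"
    using f g fs.subspace_add[OF multilinear_subspace, of f "{..<r}" g] by (simp add: ext_power_iff)
  ultimately show "f + g \<in> ext_power s X r"
    unfolding ext_power_iff by (intro conjI allI impI)
next
  fix f c assume f: "f \<in> ext_power s X r"
  have "fscale c f a = 0" if "i < j \<and> j < r \<and> a i = a j" for a :: "nat \<Rightarrow> 'x" and i j
  proof -
    have "f a = 0" using f that unfolding ext_power_iff by blast
    then show ?thesis by simp
  qed
  moreover have "multilinear {..<r} (fscale c f)"
    using f fs.subspace_scale[OF multilinear_subspace, of f "{..<r}" c] by (simp add: ext_power_iff)
  ultimately show "fscale c f \<in> ext_power s X r"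
    unfolding ext_power_iff by (intro conjI allI impI)
qed

section \<open>Row tensors as functions of a single row\<close>

definition replace_row :: "nat \<Rightarrow> (nat \<Rightarrow> 'x) \<Rightarrow> (nat \<times> nat \<Rightarrow> 'x) \<Rightarrow> nat \<times> nat \<Rightarrow> 'x" where
  "replace_row i r a = (\<lambda>(k, j). if k = i then r j else a (k, j))"

lemma row_tensor_multilinear:
  assumes "f \<in> row_tensor d (\<lambda>i. ext_power s X (\<nu> i))"
  shows "multilinear (SIGMA i:{..<d}. {..<\<nu> i}) f"
proof -
  let ?I = "SIGMA i:{..<d}. {..<\<nu> i}"
  have "row_tensor d (\<lambda>i. ext_power s X (\<nu> i)) \<subseteq> Collect (multilinear ?I)"
    unfolding row_tensor_def
  proof (rule fs.span_minimal[OF _ multilinear_subspace], safe)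
    fix g assume g: "\<forall>i<d. g i \<in> ext_power s X (\<nu> i)"
    have ml: "multilinear {..<\<nu> i} (g i)" if "i < d" for i
      using g that by (simp add: ext_power_iff)
    show "multilinear ?I (\<lambda>a. \<Prod>i<d. g i (\<lambda>j. a (i, j)))"
      unfolding multilinear_def
    proof (intro conjI allI ballI impI)
      fix a b :: "nat \<times> nat \<Rightarrow> 'x" assume ab: "\<forall>i\<in>?I. a i = b i"
      show "(\<Prod>i<d. g i (\<lambda>j. a (i, j))) = (\<Prod>i<d. g i (\<lambda>j. b (i, j)))"
        using ab by (intro prod.cong refl multilinear_cong[OF ml]) auto
    next
      fix a :: "nat \<times> nat \<Rightarrow> 'x" assume "\<exists>i\<in>?I. a i \<notin> X"
      then obtain i j where "i < d" "j < \<nu> i" "a (i, j) \<notin> X" by auto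
      then have "g i (\<lambda>j. a (i, j)) = 0"
        using multilinear_outside[OF ml[of i], of j] by simp
      then show "(\<Prod>i<d. g i (\<lambda>j. a (i, j))) = 0" using \<open>i < d\<close> by (intro prod_zero) auto
    next
      fix a :: "nat \<times> nat \<Rightarrow> 'x" and b r x y assume "b \<in> ?I" and xy: "x \<in> X" "y \<in> X"
      then obtain i j where b: "b = (i, j)" "i < d" "j < \<nu> i" by auto
      have *: "(\<Prod>k<d. g k (\<lambda>l. (a(b := v)) (k, l))) =
          g i ((\<lambda>l. a (i, l))(j := v)) * (\<Prod>k\<in>{..<d} - {i}. g k (\<lambda>l. a (k, l)))" for v
      proof -
        have "(\<lambda>l. (a(b := v)) (i, l)) = (\<lambda>l. a (i, l))(j := v)" by (auto simp: b(1))
        moreover have "(\<lambda>l. (a(b := v)) (k, l)) = (\<lambda>l. a (k, l))" if "k \<noteq> i" for k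
          using that by (auto simp: b(1))
        ultimately show ?thesis using b(2) by (subst prod.remove[of "{..<d}" i]) (auto intro!: prod.cong)
      qed
      show "(\<Prod>k<d. g k (\<lambda>l. (a(b := s r x + y)) (k, l))) =
          r * (\<Prod>k<d. g k (\<lambda>l. (a(b := x)) (k, l))) + (\<Prod>k<d. g k (\<lambda>l. (a(b := y)) (k, l)))"
        unfolding * using multilinear_linear[OF ml[OF b(2)], of j x y _ r] b(3) xy
        by (simp add: algebra_simps)
    qed
  qed
  then show ?thesis using assms by blast
qed

lemma row_tensor_row:
  assumes "f \<in> row_tensor d (\<lambda>i. ext_power s X (\<nu> i))" and i: "i < d"
  shows "(\<lambda>r. f (replace_row i r a)) \<in> ext_power s X (\<nu> i)"
  using assms(1) unfolding row_tensor_def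
proof (induction rule: fs.span_induct_alt)
  case base
  show ?case using fs.subspace_0[OF ext_power_subspace] by (simp add: zero_fun_def)
next
  case (step c f h)
  then obtain g where g: "f = (\<lambda>a. \<Prod>i<d. g i (\<lambda>j. a (i, j)))" "\<forall>i<d. g i \<in> ext_power s X (\<nu> i)"
    by blast
  have "f (replace_row i r a) = (\<Prod>k\<in>{..<d} - {i}. g k (\<lambda>j. a (k, j))) * g i r" for r
    unfolding g(1) using i by (subst prod.remove[of "{..<d}" i]) (auto simp: replace_row_def mult_ac intro!: prod.cong)
  then have "(\<lambda>r. (fscale c f + h) (replace_row i r a)) =
      fscale c (fscale (\<Prod>k\<in>{..<d} - {i}. g k (\<lambda>j. a (k, j))) (g i)) + (\<lambda>r. h (replace_row i r a))"
    by (intro ext) simp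
  also have "\<dots> \<in> ext_power s X (\<nu> i)"
    using g(2) i step.IH
    by (intro fs.subspace_add[OF ext_power_subspace] fs.subspace_scale[OF ext_power_subspace]) auto
  finally show ?case .
qed

end


section \<open>Two-row diagrams\<close>

lemma extend_to_permutation:
  assumes "inj_on x {..<k}" and "x ` {..<k} \<subseteq> {..<m::nat}"
  shows "\<exists>\<zeta>. \<zeta> permutes {..<m} \<and> (\<forall>i<k. \<zeta> i = x i)"
proof -
  have km: "k \<le> m"
    using card_inj_on_le[OF assms] by simp
  have "card ({..<m} - x ` {..<k}) = card {k..<m}"
    using assms by (simp add: card_Diff_subset card_image)
  then obtain h where h: "bij_betw h {k..<m} ({..<m} - x ` {..<k})"
    using finite_same_card_bij[of "{k..<m}" "{..<m} - x ` {..<k}"] by auto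
  define \<zeta> where "\<zeta> i = (if i < k then x i else if i < m then h i else i)" for i
  have "bij_betw \<zeta> {..<k} (x ` {..<k})"
    using assms(1) by (auto simp: \<zeta>_def bij_betw_def inj_on_def)
  moreover have "bij_betw \<zeta> {k..<m} ({..<m} - x ` {..<k})"
    using h by (rule bij_betw_cong[THEN iffD1, rotated]) (auto simp: \<zeta>_def)
  ultimately have "bij_betw \<zeta> ({..<k} \<union> {k..<m}) (x ` {..<k} \<union> ({..<m} - x ` {..<k}))"
    by (rule bij_betw_combine) auto
  moreover have "{..<k} \<union> {k..<m} = {..<m}" "x ` {..<k} \<union> ({..<m} - x ` {..<k}) = {..<m}"
    using km assms(2) by auto
  ultimately have "bij_betw \<zeta> {..<m} {..<m}" by simp
  then have "\<zeta> permutes {..<m}"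
    using km by (intro bij_imp_permutes) (auto simp: \<zeta>_def)
  then show ?thesis by (auto simp: \<zeta>_def)
qed

definition two_row :: "nat \<Rightarrow> nat \<Rightarrow> nat \<Rightarrow> nat" where
  "two_row t u = diagram_of [t + u, t - u]"

lemma two_row_simps [simp]:
  "two_row t u 0 = t + u" "two_row t u (Suc 0) = t - u" "two_row t u (Suc (Suc i)) = 0"
  by (auto simp: two_row_def nth_default_def)

lemma two_row_apply: "two_row t u i = (if i = 0 then t + u else if i = 1 then t - u else 0)"
proof (cases i)
  case (Suc k)
  then show ?thesis by (cases k) auto
qed auto

lemma num_rows_two_row:
  assumes "u < t"
  shows "num_rows (two_row t u) = 2"
proof -
  have "{i. two_row t u i \<noteq> 0} = {0, 1}" using assms by (auto simp: two_row_apply)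
  then show ?thesis by (simp add: num_rows_def)
qed

lemma boxes_two_row:
  "(i, j) \<in> boxes (two_row t u) \<longleftrightarrow> i = 0 \<and> j < t + u \<or> i = 1 \<and> j < t - u"
  by (auto simp: boxes_def two_row_apply)

lemma finite_boxes_two_row: "finite (boxes (two_row t u))"
  by (rule finite_subset[of _ "{0, 1} \<times> {..<t + u}"]) (auto simp: boxes_two_row)

lemma finite_column_group: "finite (column_group (two_row t u))"
  by (rule finite_subset[OF _ finite_permutations[OF finite_boxes_two_row]])
    (auto simp: column_group_def)

lemma transpose_in_column_group:
  "l < t - u \<Longrightarrow> transpose (0, l) (1, l) \<in> column_group (two_row t u)"
  by (auto simp: column_group_def boxes_two_row transpose_def intro!: permutes_swap_id)

lemma comp_in_column_group:
  "\<pi> \<in> column_group \<mu> \<Longrightarrow> \<rho> \<in> column_group \<mu> \<Longrightarrow> \<pi> \<circ> \<rho> \<in> column_group \<mu>"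
  by (simp add: column_group_def permutes_compose del: split_paired_All)

text \<open>Columns have at most two boxes, so the column group is a product of groups of order two,
  one for each of the t - u full columns. \<open>S\<close> is the set of columns whose boxes are
  exchanged.\<close>

lemma column_group_cases:
  assumes "\<pi> \<in> column_group (two_row t u)"
  obtains S where "S \<subseteq> {..<t - u}"
    and "\<And>j. \<pi> (0, j) = (if j \<in> S then (1, j) else (0, j))"
    and "\<And>j. \<pi> (1, j) = (if j \<in> S then (0, j) else (1, j))"
proof -
  let ?B = "boxes (two_row t u)"
  have \<pi>: "\<pi> permutes ?B" and snd: "snd (\<pi> b) = snd b" for b
    using assms unfolding column_group_def by blast+
  define S where "S = {j. \<pi> (0, j) = (1, j)}"
  have in_B: "\<pi> b \<in> ?B \<longleftrightarrow> b \<in> ?B" for b using permutes_in_image[OF \<pi>] .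
  have rows: "\<pi> (i, j) = (0, j) \<or> \<pi> (i, j) = (1, j)" if "i \<le> 1" for i j
  proof (cases "(i, j) \<in> ?B")
    case True
    then have "\<pi> (i, j) \<in> ?B" by (simp add: in_B)
    then show ?thesis using snd[of "(i, j)"] by (cases "\<pi> (i, j)") (auto simp: boxes_two_row)
  next
    case False
    then have "\<pi> (i, j) = (i, j)" by (rule permutes_not_in[OF \<pi>])
    then show ?thesis using that by (auto simp: le_Suc_eq)
  qed
  have S: "S \<subseteq> {..<t - u}"
  proof
    fix j assume "j \<in> S"
    then have "\<pi> (0, j) = (1, j)" by (simp add: S_def)
    moreover from this have "(0, j) \<in> ?B" using permutes_not_in[OF \<pi>, of "(0, j)"] by fastforce
    ultimately show "j \<in> {..<t - u}" using in_B[of "(0, j)"] by (simp add: boxes_two_row)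
  qed
  have 0: "\<pi> (0, j) = (if j \<in> S then (1, j) else (0, j))" for j
    using rows[of 0 j] by (auto simp: S_def)
  have ne: "\<pi> (0, j) \<noteq> \<pi> (1, j)" for j
    using permutes_inj[OF \<pi>] by (metis inj_eq prod.inject zero_neq_one)
  have "\<pi> (1, j) = (if j \<in> S then (0, j) else (1, j))" for j
    using rows[of 1 j] ne[of j] 0[of j] by auto
  with S 0 show ?thesis by (rule that)
qed

text \<open>Right translation permutes the column group, so symmetrization forgets a preceding
  column permutation. A function that such a permutation negates is therefore symmetrized to 0,
  which is how \<open>garnir\<close> uses this.\<close>

lemma column_sym_comp:
  assumes "\<rho> \<in> column_group (two_row t u)"
  shows "column_sym (two_row t u) (\<lambda>a. f (a \<circ> \<rho>)) = column_sym (two_row t u) f"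
proof
  fix a
  let ?C = "column_group (two_row t u)"
  have inv: "inj \<rho>" using assms by (auto simp: column_group_def dest: permutes_inj)
  have inj: "inj_on (\<lambda>\<pi>. \<pi> \<circ> \<rho>) ?C"
  proof (rule inj_onI)
    fix \<pi> \<pi>' assume "\<pi> \<circ> \<rho> = \<pi>' \<circ> \<rho>"
    moreover have "surj \<rho>" using assms by (auto simp: column_group_def dest: permutes_surj)
    ultimately show "\<pi> = \<pi>'" by (metis surj_fun_eq UNIV_I comp_apply ext)
  qed
  have "(\<lambda>\<pi>. \<pi> \<circ> \<rho>) ` ?C \<subseteq> ?C" using comp_in_column_group assms by blast
  then have "(\<lambda>\<pi>. \<pi> \<circ> \<rho>) ` ?C = ?C"
    using finite_column_group inj by (intro endo_inj_surj) auto
  then have "column_sym (two_row t u) f a = (\<Sum>\<pi>\<in>(\<lambda>\<pi>. \<pi> \<circ> \<rho>) ` ?C. f (a \<circ> \<pi>))"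
    by (simp add: column_sym_def)
  also have "\<dots> = (\<Sum>\<pi>\<in>?C. f ((a \<circ> \<pi>) \<circ> \<rho>))"
    by (subst sum.reindex[OF inj]) (simp add: o_assoc comp_def)
  finally show "column_sym (two_row t u) (\<lambda>a. f (a \<circ> \<rho>)) a = column_sym (two_row t u) f a"
    by (simp add: column_sym_def)
qed

lemma column_sym_add: "column_sym \<mu> (f + g) = column_sym \<mu> f + column_sym \<mu> g"
  and column_sym_scale: "column_sym \<mu> (fscale r f) = fscale r (column_sym \<mu> f)"
  and column_sym_zero: "column_sym \<mu> 0 = 0"
  by (auto simp: column_sym_def fun_eq_iff sum.distrib sum_distrib_left)

lemma column_sym_sum: "column_sym \<mu> (\<Sum>i\<in>A. f i) = (\<Sum>i\<in>A. column_sym \<mu> (f i))"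
  unfolding column_sym_def fun_eq_iff sum_fun_apply by (intro allI sum.swap)

lemma column_sym_diff: "column_sym \<mu> (f - g) = column_sym \<mu> f - column_sym \<mu> (g :: _ \<Rightarrow> 'k::field)"
  by (auto simp: column_sym_def fun_eq_iff sum_subtractf)

text \<open>One permutation \<kappa> supported on \<open>B\<close> accounts for both exchanges: the
  first exchanged map is \<sigma> \<circ> \<kappa>, and \<tau> is the second exchanged map composed
  with the same \<kappa>. Its sign occurs twice and cancels.\<close>

lemma exchange_sign:
  fixes r :: nat
  assumes \<sigma>: "\<sigma> permutes {..<r}" and \<tau>: "\<tau> permutes {..<r}"
    and \<rho>: "(\<lambda>j. if j \<in> B then \<tau> j else \<sigma> j) permutes {..<r}"
    and \<rho>': "(\<lambda>j. if j \<in> B then \<sigma> j else \<tau> j) permutes {..<r}"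
  shows "sign (\<lambda>j. if j \<in> B then \<tau> j else \<sigma> j) * sign (\<lambda>j. if j \<in> B then \<sigma> j else \<tau> j) =
    sign \<sigma> * sign \<tau>"
proof -
  define R where "R = (\<lambda>j. if j \<in> B then \<tau> j else \<sigma> j)"
  define R' where "R' = (\<lambda>j. if j \<in> B then \<sigma> j else \<tau> j)"
  define \<kappa> where "\<kappa> = inv \<sigma> \<circ> R"
  note perm = permutation_of_bounded
  have R: "R permutes {..<r}" "R' permutes {..<r}" using \<rho> \<rho>' by (simp_all add: R_def R'_def)
  have \<kappa>: "\<kappa> permutes {..<r}"
    unfolding \<kappa>_def using R(1) permutes_inv[OF \<sigma>] by (rule permutes_compose)
  have \<sigma>\<kappa>: "\<sigma> \<circ> \<kappa> = R" using permutes_inv_o(1)[OF \<sigma>] by (simp add: \<kappa>_def o_assoc)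
  have outside: "\<kappa> j = j" if "j \<notin> B" for j
    using that permutes_inverses(2)[OF \<sigma>] by (simp add: \<kappa>_def R_def)
  have "R' \<circ> \<kappa> = \<tau>"
  proof
    fix j
    show "(R' \<circ> \<kappa>) j = \<tau> j"
    proof (cases "j \<in> B")
      case True
      have "\<kappa> j \<in> B" using outside[of "\<kappa> j"] permutes_inj[OF \<kappa>] True by (metis injD)
      then show ?thesis using fun_cong[OF \<sigma>\<kappa>, of j] True by (simp add: R'_def R_def)
    qed (simp add: outside R'_def)
  qed
  then have "sign \<tau> = sign R' * sign \<kappa>" using sign_compose[OF perm[OF R(2)] perm[OF \<kappa>]] by simp
  moreover have "sign R = sign \<sigma> * sign \<kappa>"
    using sign_compose[OF perm[OF \<sigma>] perm[OF \<kappa>]] by (simp add: \<sigma>\<kappa>)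
  ultimately show ?thesis unfolding R_def[symmetric] R'_def[symmetric] by simp
qed

lemma sum_zero_one_nonzero:
  assumes "finite Z" and "\<And>z. z \<in> Z \<Longrightarrow> h z = 0 \<or> h z = 1" and "z \<in> Z" and "h z = 1"
  shows "sum h Z \<noteq> (0::'k::field_char_0)"
proof -
  have "sum h Z = (\<Sum>z\<in>Z. if h z = 1 then 1 else 0)"
    using assms(2) by (intro sum.cong) auto
  also have "\<dots> = of_nat (card {z \<in> Z. h z = 1})"
    using assms(1) by (simp add: sum.If_cases Int_def)
  finally have *: "sum h Z = of_nat (card {z \<in> Z. h z = 1})" .
  have "{z \<in> Z. h z = 1} \<noteq> {}" using assms(3,4) by blast
  then show ?thesis unfolding * of_nat_eq_0_iff using assms(1) by simp
qed


section \<open>Schur modules of two-row diagrams\<close>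

text \<open>
  \<open>\<Gamma>\<close> is the group of automorphisms of \<open>X\<close>; its elements are maps of the whole type, of which
  only the values on \<open>X\<close> matter.
\<close>

locale two_row_space = coord_space s X m e co
  for s :: "'k::field_char_0 \<Rightarrow> 'x::ab_group_add \<Rightarrow> 'x" and X m e co +
  fixes \<Gamma> :: "('x \<Rightarrow> 'x) set" and t u :: nat
  assumes u_less: "u < t" and t_u_le: "t + u \<le> m"
    and \<Gamma>_in: "\<kappa> \<in> \<Gamma> \<Longrightarrow> \<kappa> x \<in> X \<longleftrightarrow> x \<in> X"
    and \<Gamma>_linear: "\<kappa> \<in> \<Gamma> \<Longrightarrow> x \<in> X \<Longrightarrow> y \<in> X \<Longrightarrow> \<kappa> (s r x + y) = s r (\<kappa> x) + \<kappa> y"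
    and \<Gamma>_comp: "\<kappa> \<in> \<Gamma> \<Longrightarrow> \<kappa>' \<in> \<Gamma> \<Longrightarrow> \<kappa> \<circ> \<kappa>' \<in> \<Gamma>"
    and \<Gamma>_id: "id \<in> \<Gamma>"
    and \<Gamma>_ex: "(\<And>x. x \<in> X \<Longrightarrow> k x \<in> X) \<Longrightarrow> (\<And>x. x \<in> X \<Longrightarrow> k' x \<in> X) \<Longrightarrow>
      (\<And>r x y. x \<in> X \<Longrightarrow> y \<in> X \<Longrightarrow> k (s r x + y) = s r (k x) + k y) \<Longrightarrow>
      (\<And>x. x \<in> X \<Longrightarrow> k' (k x) = x) \<Longrightarrow> (\<And>x. x \<in> X \<Longrightarrow> k (k' x) = x) \<Longrightarrow>
      \<exists>\<kappa>\<in>\<Gamma>. \<forall>x\<in>X. \<kappa> x = k x"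
begin

abbreviation "p \<equiv> t + u"
abbreviation "q \<equiv> t - u"
abbreviation "\<mu> \<equiv> two_row t u"

lemma q_le_p: "q \<le> p" and p_le_m: "p \<le> m" and q_le_m: "q \<le> m" and t_le_m: "t \<le> m"
  using t_u_le by auto

lemma co_combination: "i < m \<Longrightarrow> co i (\<Sum>l<m. s (g l) (e l)) = g i"
  by (subst co_sum) (auto simp: X_scale e_in co_scale co_e if_distrib[of "(*) _"] cong: if_cong)

lemma combination_in: "(\<Sum>l<m. s (g l) (e l)) \<in> X"
  by (intro X_sum X_scale e_in) auto

text \<open>\<open>g\<close> and \<open>g'\<close> are the coordinates of a linear map and of its
  inverse. This reduces the existence of group elements to identities between coordinates, which
  suffices for basis permutations, transvections and dilations.\<close>

lemma \<Gamma>_coords: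
  assumes lin: "\<And>l r x y. l < m \<Longrightarrow> x \<in> X \<Longrightarrow> y \<in> X \<Longrightarrow> g l (s r x + y) = r * g l x + g l y"
    and inv1: "\<And>l x. l < m \<Longrightarrow> x \<in> X \<Longrightarrow> g' l (\<Sum>i<m. s (g i x) (e i)) = co l x"
    and inv2: "\<And>l x. l < m \<Longrightarrow> x \<in> X \<Longrightarrow> g l (\<Sum>i<m. s (g' i x) (e i)) = co l x"
  shows "\<exists>\<kappa>\<in>\<Gamma>. \<forall>x\<in>X. \<forall>l<m. co l (\<kappa> x) = g l x"
proof -
  have "\<exists>\<kappa>\<in>\<Gamma>. \<forall>x\<in>X. \<kappa> x = (\<Sum>i<m. s (g i x) (e i))"
  proof (rule \<Gamma>_ex[where k' = "\<lambda>x. \<Sum>i<m. s (g' i x) (e i)"])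
    fix r x y assume x: "x \<in> X" "y \<in> X"
    show "(\<Sum>i<m. s (g i (s r x + y)) (e i)) = s r (\<Sum>i<m. s (g i x) (e i)) + (\<Sum>i<m. s (g i y) (e i))"
      using x by (intro co_eqI combination_in X_add X_scale)
        (simp add: co_combination co_linear combination_in lin)
  qed (auto intro!: co_eqI combination_in simp: co_combination inv1 inv2)
  then obtain \<kappa> where \<kappa>: "\<kappa> \<in> \<Gamma>" "\<And>x. x \<in> X \<Longrightarrow> \<kappa> x = (\<Sum>i<m. s (g i x) (e i))" by blast
  have "co l (\<kappa> x) = g l x" if "x \<in> X" "l < m" for x l
    unfolding \<kappa>(2)[OF that(1)] by (rule co_combination[OF that(2)])
  with \<kappa>(1) show ?thesis by blast
qed

lemma \<Gamma>_permute:
  assumes \<zeta>: "\<zeta> permutes {..<m}"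
  obtains \<kappa> where "\<kappa> \<in> \<Gamma>" and "\<And>l x. l < m \<Longrightarrow> co l (\<kappa> x) = co (\<zeta> l) x"
proof -
  have inv: "inv \<zeta> permutes {..<m}" using permutes_inv[OF \<zeta>] .
  have "\<exists>\<kappa>\<in>\<Gamma>. \<forall>x\<in>X. \<forall>l<m. co l (\<kappa> x) = co (\<zeta> l) x"
    by (rule \<Gamma>_coords[where g' = "\<lambda>l. co (inv \<zeta> l)"])
      (use \<zeta> inv permutes_inverses[OF \<zeta>] in \<open>auto simp: co_linear co_combination\<close>)
  then obtain \<kappa> where \<kappa>: "\<kappa> \<in> \<Gamma>" "\<forall>x\<in>X. \<forall>l<m. co l (\<kappa> x) = co (\<zeta> l) x" by blast
  have "co l (\<kappa> x) = co (\<zeta> l) x" if "l < m" for l x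
    using \<kappa> that \<zeta> by (cases "x \<in> X") (auto simp: co_outside \<Gamma>_in)
  with \<kappa>(1) show ?thesis by (rule that)
qed

lemma \<Gamma>_transvection:
  assumes ij: "i < m" "j < m" "i \<noteq> j"
  obtains \<kappa> where "\<kappa> \<in> \<Gamma>" and "\<And>l x. l < m \<Longrightarrow> co l (\<kappa> x) = (if l = i then co i x + co j x else co l x)"
proof -
  have "\<exists>\<kappa>\<in>\<Gamma>. \<forall>x\<in>X. \<forall>l<m. co l (\<kappa> x) = (if l = i then co i x + co j x else co l x)"
    by (rule \<Gamma>_coords[where g' = "\<lambda>l x. if l = i then co i x - co j x else co l x"])
      (use ij in \<open>auto simp: co_linear co_linear[unfolded add.commute[of "s _ _"]] co_combination algebra_simps\<close>)
  then obtain \<kappa> where \<kappa>: "\<kappa> \<in> \<Gamma>"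
    "\<forall>x\<in>X. \<forall>l<m. co l (\<kappa> x) = (if l = i then co i x + co j x else co l x)" by blast
  have "co l (\<kappa> x) = (if l = i then co i x + co j x else co l x)" if "l < m" for l x
    using \<kappa> that ij by (cases "x \<in> X") (auto simp: co_outside \<Gamma>_in)
  with \<kappa>(1) show ?thesis by (rule that)
qed

lemma \<Gamma>_dilation:
  assumes i: "i < m"
  obtains \<kappa> where "\<kappa> \<in> \<Gamma>" and "\<And>l x. l < m \<Longrightarrow> co l (\<kappa> x) = (if l = i then 2 else 1) * co l x"
proof -
  have "\<exists>\<kappa>\<in>\<Gamma>. \<forall>x\<in>X. \<forall>l<m. co l (\<kappa> x) = (if l = i then 2 else 1) * co l x"
    by (rule \<Gamma>_coords[where g' = "\<lambda>l x. (if l = i then 1 / 2 else 1) * co l x"])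
      (use i in \<open>auto simp: co_linear co_linear[unfolded add.commute[of "s _ _"]] co_combination algebra_simps\<close>)
  then obtain \<kappa> where \<kappa>: "\<kappa> \<in> \<Gamma>"
    "\<forall>x\<in>X. \<forall>l<m. co l (\<kappa> x) = (if l = i then 2 else 1) * co l x" by blast
  have "co l (\<kappa> x) = (if l = i then 2 else 1) * co l x" if "l < m" for l x
    using \<kappa> that i by (cases "x \<in> X") (auto simp: co_outside \<Gamma>_in)
  with \<kappa>(1) show ?thesis by (rule that)
qed

section \<open>Tableaux as products of two minors\<close>

definition row_det :: "(nat \<Rightarrow> nat) \<Rightarrow> (nat \<Rightarrow> nat) \<Rightarrow> (nat \<times> nat \<Rightarrow> 'x) \<Rightarrow> 'k" where
  "row_det x y a = coord_det p x (\<lambda>j. a (0, j)) * coord_det q y (\<lambda>j. a (1, j))"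

text \<open>The element of the Schur module attached to the tableau with rows \<open>x\<close> and
  \<open>y\<close>. The tableau may be of any kind; repeated or unordered entries are
  allowed.\<close>

definition straight :: "(nat \<Rightarrow> nat) \<Rightarrow> (nat \<Rightarrow> nat) \<Rightarrow> (nat \<times> nat \<Rightarrow> 'x) \<Rightarrow> 'k" where
  "straight x y = column_sym \<mu> (row_det x y)"

text \<open>The canonical tableau: index \<open>i\<close> occurs once in each row longer than
  \<open>i\<close>, hence twice below q, once from q to p - 1, and never from p on.\<close>

definition highest :: "(nat \<times> nat \<Rightarrow> 'x) \<Rightarrow> 'k" where
  "highest = straight (\<lambda>i. i) (\<lambda>i. i)"

definition translates :: "((nat \<times> nat \<Rightarrow> 'x) \<Rightarrow> 'k) set" where
  "translates = fs.span {\<lambda>a. highest (\<kappa> \<circ> a) | \<kappa>. \<kappa> \<in> \<Gamma>}"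

lemma straight_comp: "straight x y (\<kappa> \<circ> a) = column_sym \<mu> (\<lambda>a. row_det x y (\<kappa> \<circ> a)) a"
  by (simp add: straight_def column_sym_def comp_assoc)

lemma straight_cong:
  "(\<And>i. i < p \<Longrightarrow> x i = x' i) \<Longrightarrow> (\<And>i. i < q \<Longrightarrow> y i = y' i) \<Longrightarrow> straight x y = straight x' y'"
  unfolding straight_def row_det_def
  by (intro arg_cong[of _ _ "column_sym _"] ext arg_cong2[of _ _ _ _ "(*)"] coord_det_cong) auto

lemma straight_repeated:
  assumes "\<not> inj_on x {..<p} \<or> \<not> inj_on y {..<q}"
  shows "straight x y = 0"
proof -
  have "row_det x y = 0"
    using assms by (auto simp: row_det_def fun_eq_iff coord_det_repeated_index)
  then show ?thesis by (simp add: straight_def column_sym_zero)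
qed

lemma translates_stable:
  assumes "f \<in> translates" and \<kappa>: "\<kappa> \<in> \<Gamma>"
  shows "(\<lambda>a. f (\<kappa> \<circ> a)) \<in> translates"
  using assms(1) unfolding translates_def
proof (induction rule: fs.span_induct_alt)
  case base
  show ?case using fs.span_zero unfolding zero_fun_def .
next
  case (step r f g)
  then obtain \<kappa>' where \<kappa>': "\<kappa>' \<in> \<Gamma>" "f = (\<lambda>a. highest (\<kappa>' \<circ> a))" by blast
  have "(\<lambda>a. f (\<kappa> \<circ> a)) = (\<lambda>a. highest ((\<kappa>' \<circ> \<kappa>) \<circ> a))" by (simp add: \<kappa>'(2) comp_assoc)
  then have f: "(\<lambda>a. f (\<kappa> \<circ> a)) \<in> {\<lambda>a. highest (\<kappa> \<circ> a) | \<kappa>. \<kappa> \<in> \<Gamma>}" using \<Gamma>_comp[OF \<kappa>'(1) \<kappa>] by blast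
  have "(\<lambda>a. (fscale r f + g) (\<kappa> \<circ> a)) = fscale r (\<lambda>a. f (\<kappa> \<circ> a)) + (\<lambda>a. g (\<kappa> \<circ> a))"
    by (simp add: fun_eq_iff)
  moreover have "\<dots> \<in> fs.span {\<lambda>a. highest (\<kappa> \<circ> a) | \<kappa>. \<kappa> \<in> \<Gamma>}"
    by (intro fs.span_add fs.span_scale fs.span_base f step.IH)
  ultimately show ?case by (simp only:)
qed

text \<open>Reordering \<open>x\<close> costs only a sign and brings the entries of \<open>y\<close>
  to the front, in their order. The tableau is then the canonical one with its entries relabelled by
  a permutation \<zeta> of the basis, that is, a translate.\<close>

lemma straight_contained:
  assumes x: "\<And>i. i < p \<Longrightarrow> x i < m" and sub: "y ` {..<q} \<subseteq> x ` {..<p}"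
  shows "straight x y \<in> translates"
proof (cases "inj_on x {..<p} \<and> inj_on y {..<q}")
  case False
  then have "straight x y = 0" using straight_repeated by blast
  then show ?thesis using fs.span_zero by (simp add: translates_def)
next
  case True
  then have inj: "inj_on x {..<p}" "inj_on y {..<q}" by auto
  \<comment> \<open>The position in \<open>x\<close> of the entry \<open>y j\<close>.\<close>
  define r where "r j = the_inv_into {..<p} x (y j)" for j
  have r: "r j < p" "x (r j) = y j" if "j < q" for j
    using that sub inj(1) the_inv_into_into[of x "{..<p}" "y j" "{..<p}"]
    by (auto simp: r_def f_the_inv_into_f)
  have "inj_on r {..<q}" using inj(2) r by (metis (no_types, lifting) inj_on_def lessThan_iff)
  then obtain \<rho> where \<rho>: "\<rho> permutes {..<p}" "\<forall>j<q. \<rho> j = r j"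
    using extend_to_permutation[of r q p] r by auto
  let ?x = "x \<circ> \<rho>"
  have "inj_on ?x {..<p}"
    using inj(1) \<rho>(1) by (simp add: comp_inj_on permutes_inj_on permutes_image)
  then obtain \<zeta> where \<zeta>: "\<zeta> permutes {..<m}" "\<forall>i<p. \<zeta> i = ?x i"
    using extend_to_permutation[of ?x p m] x \<rho>(1) by (force simp: image_subset_iff)
  obtain \<kappa> where \<kappa>: "\<kappa> \<in> \<Gamma>" "\<And>l x. l < m \<Longrightarrow> co l (\<kappa> x) = co (\<zeta> l) x"
    using \<Gamma>_permute[OF \<zeta>(1)] by blast
  have "coord_det k (\<lambda>i. i) (\<kappa> \<circ> a) = coord_det k \<zeta> a" if "k \<le> m" for a k
    unfolding coord_det_def using that \<kappa>(2) by (intro sum.cong refl arg_cong2[of _ _ _ _ "(*)"] prod.cong) auto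
  then have "row_det (\<lambda>i. i) (\<lambda>i. i) (\<kappa> \<circ> a) = row_det \<zeta> \<zeta> a" for a
    using p_le_m q_le_m by (simp add: row_det_def comp_def)
  then have "straight \<zeta> \<zeta> = (\<lambda>a. highest (\<kappa> \<circ> a))"
    unfolding highest_def straight_comp by (simp add: straight_def)
  then have 1: "straight \<zeta> \<zeta> \<in> translates"
    unfolding translates_def using \<kappa>(1) by (intro fs.span_base) blast
  have "straight \<zeta> \<zeta> = straight ?x y"
    using \<zeta>(2) \<rho>(2) r q_le_p by (intro straight_cong) auto
  also have "row_det ?x y = fscale (of_int (sign \<rho>)) (row_det x y)"
    by (auto simp: row_det_def coord_det_permute_index[OF \<rho>(1)])
  then have "straight ?x y = fscale (of_int (sign \<rho>)) (straight x y)"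
    by (simp add: straight_def column_sym_scale)
  finally have "straight x y = fscale (of_int (sign \<rho>)) (straight \<zeta> \<zeta>)"
    by (auto simp: fun_eq_iff of_int_sign_idem)
  then show ?thesis using fs.span_scale[OF 1[unfolded translates_def]] by (simp add: translates_def)
qed

lemma row_det_transpose:
  assumes "i < p" "j < p" "i \<noteq> j"
  shows "row_det x y (b \<circ> transpose (0, i) (0, j)) = - row_det x y b"
proof -
  have "(\<lambda>l. (b \<circ> transpose (0, i) (0, j)) (0, l)) = (\<lambda>l. b (0, l)) \<circ> transpose i j"
    by (auto simp: fun_eq_iff transpose_def)
  moreover have "(\<lambda>l. (b \<circ> transpose (0, i) (0, j)) (1, l)) = (\<lambda>l. b (1, l))"
    by (auto simp: fun_eq_iff transpose_def)
  moreover have "transpose i j permutes {..<p}" using assms by (intro permutes_swap_id) auto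
  ultimately show ?thesis
    unfolding row_det_def using assms(3)
    by (simp only: coord_det_permute_args) (simp add: sign_swap_id)
qed

text \<open>
  The difference of the two sides, before symmetrization, is alternating in the arguments of
  row 0 together with the argument \<open>(1, l)\<close>, so it changes sign under the exchange of two
  boxes in column \<open>l\<close>.
\<close>

lemma garnir:
  assumes l: "l < q"
  shows "(\<Sum>k<p. column_sym \<mu> (\<lambda>a. row_det x y (a \<circ> transpose (0, k) (1, l)))) = straight x y"
proof -
  let ?tr = "\<lambda>k. transpose (0::nat, k::nat) (1::nat, l)"
  define H where "H a = row_det x y a - (\<Sum>k<p. row_det x y (a \<circ> ?tr k))" for a
  have lp: "l < p" using l by simp
  have exch: "row_det x y ((a \<circ> ?tr l) \<circ> ?tr k) = - row_det x y (a \<circ> ?tr k)" if "k < p" "k \<noteq> l" for a k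
  proof -
    have "(a \<circ> ?tr l) \<circ> ?tr k = (a \<circ> ?tr k) \<circ> transpose (0, k) (0, l)"
      using that by (auto simp: fun_eq_iff transpose_def)
    then show ?thesis using row_det_transpose[OF that(1) lp that(2)] by simp
  qed
  have anti: "H (a \<circ> ?tr l) = - H a" for a
  proof -
    have "(\<Sum>k<p. row_det x y ((a \<circ> ?tr l) \<circ> ?tr k)) =
      row_det x y ((a \<circ> ?tr l) \<circ> ?tr l) + (\<Sum>k\<in>{..<p} - {l}. row_det x y ((a \<circ> ?tr l) \<circ> ?tr k))"
      using lp by (intro sum.remove) auto
    also have "\<dots> = row_det x y a - (\<Sum>k\<in>{..<p} - {l}. row_det x y (a \<circ> ?tr k))"
      using exch by (simp add: comp_assoc sum_negf[symmetric])
    finally have "(\<Sum>k<p. row_det x y ((a \<circ> ?tr l) \<circ> ?tr k)) =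
      row_det x y a - (\<Sum>k\<in>{..<p} - {l}. row_det x y (a \<circ> ?tr k))" .
    moreover have "(\<Sum>k<p. row_det x y (a \<circ> ?tr k)) =
      row_det x y (a \<circ> ?tr l) + (\<Sum>k\<in>{..<p} - {l}. row_det x y (a \<circ> ?tr k))"
      using lp by (intro sum.remove) auto
    ultimately show ?thesis by (simp add: H_def)
  qed
  have "column_sym \<mu> H = column_sym \<mu> (\<lambda>a. H (a \<circ> ?tr l))"
    by (rule column_sym_comp[OF transpose_in_column_group[OF l], symmetric])
  then have "column_sym \<mu> H a = column_sym \<mu> (\<lambda>a. - H a) a" for a
    unfolding anti by (rule fun_cong)
  then have "column_sym \<mu> H a = - column_sym \<mu> H a" for a
    by (simp add: column_sym_def sum_negf)
  then have "column_sym \<mu> H a = 0" for a by simp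
  then have 0: "column_sym \<mu> H = 0" by (intro ext) (simp only: zero_fun_apply)
  have "H = row_det x y - (\<Sum>k<p. (\<lambda>a. row_det x y (a \<circ> ?tr k)))"
    by (rule ext) (simp add: H_def sum_fun_apply)
  then have "column_sym \<mu> H = straight x y -
      (\<Sum>k<p. column_sym \<mu> (\<lambda>a. row_det x y (a \<circ> ?tr k)))"
    by (simp only: column_sym_diff column_sym_sum straight_def)
  with 0 show ?thesis by (metis eq_iff_diff_eq_0)
qed

text \<open>In the monomial belonging to \<sigma> and \<tau>, exchanging the indices of factors i
  and j has the same effect as exchanging the arguments in boxes (0, \<sigma> i) and (1, \<tau> j).
  Summing over all i and j removes the dependence of the boxes on \<sigma> and \<tau>.\<close>

lemma polarization:
  "(\<Sum>i<p. \<Sum>j<q. row_det (x(i := y j)) (y(j := x i)) a) =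
    (\<Sum>k<p. \<Sum>l<q. row_det x y (a \<circ> transpose (0, k) (1, l)))"
proof -
  define P where "P \<sigma> \<tau> x y a = (\<Prod>i<p. co (x i) (a (0::nat, \<sigma> i))) * (\<Prod>j<q. co (y j) (a (1::nat, \<tau> j)))"
    for \<sigma> \<tau> :: "nat \<Rightarrow> nat" and x y and a :: "nat \<times> nat \<Rightarrow> 'x"
  let ?A = "{\<sigma>. \<sigma> permutes {..<p}}" and ?B = "{\<tau>. \<tau> permutes {..<q}}"
  define c :: "(nat \<Rightarrow> nat) \<Rightarrow> (nat \<Rightarrow> nat) \<Rightarrow> 'k" where "c \<sigma> \<tau> = of_int (sign \<sigma>) * of_int (sign \<tau>)" for \<sigma> \<tau>
  have expand: "row_det x y a = (\<Sum>\<sigma>\<in>?A. \<Sum>\<tau>\<in>?B. c \<sigma> \<tau> * P \<sigma> \<tau> x y a)" for x y a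
    by (simp add: row_det_def coord_det_def sum_product P_def c_def mult_ac)
  have key: "(\<Sum>i<p. \<Sum>j<q. P \<sigma> \<tau> (x(i := y j)) (y(j := x i)) a) =
      (\<Sum>k<p. \<Sum>l<q. P \<sigma> \<tau> x y (a \<circ> transpose (0, k) (1, l)))"
    if \<sigma>: "\<sigma> \<in> ?A" and \<tau>: "\<tau> \<in> ?B" for \<sigma> \<tau>
  proof -
    have "(\<Sum>k<p. \<Sum>l<q. P \<sigma> \<tau> x y (a \<circ> transpose (0, k) (1, l))) =
      (\<Sum>i<p. \<Sum>j<q. P \<sigma> \<tau> x y (a \<circ> transpose (0, \<sigma> i) (1, \<tau> j)))"
      using sum.permute[of \<sigma> "{..<p}" "\<lambda>k. \<Sum>l<q. P \<sigma> \<tau> x y (a \<circ> transpose (0, k) (1, l))"]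
        sum.permute[of \<tau> "{..<q}" "\<lambda>l. P \<sigma> \<tau> x y (a \<circ> transpose (0, k) (1, l))" for k] \<sigma> \<tau>
      by (simp add: comp_def)
    also have "\<dots> = (\<Sum>i<p. \<Sum>j<q. P \<sigma> \<tau> (x(i := y j)) (y(j := x i)) a)"
    proof (intro sum.cong refl)
      fix i j assume ij: "i \<in> {..<p}" "j \<in> {..<q}"
      have inj: "\<sigma> k = \<sigma> k' \<longleftrightarrow> k = k'" "\<tau> k = \<tau> k' \<longleftrightarrow> k = k'" for k k'
        using \<sigma> \<tau> permutes_inj[of \<sigma> "{..<p}"] permutes_inj[of \<tau> "{..<q}"] by (auto simp: inj_eq)
      have "P \<sigma> \<tau> x y (a \<circ> transpose (0, \<sigma> i) (1, \<tau> j)) =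
        (co (x i) (a (1, \<tau> j)) * (\<Prod>k\<in>{..<p} - {i}. co (x k) (a (0, \<sigma> k)))) *
        (co (y j) (a (0, \<sigma> i)) * (\<Prod>k\<in>{..<q} - {j}. co (y k) (a (1, \<tau> k))))"
        unfolding P_def using ij
        by (subst prod.remove[of "{..<p}" i], simp, simp, subst prod.remove[of "{..<q}" j], simp, simp)
          (auto simp: transpose_def inj intro!: arg_cong2[of _ _ _ _ "(*)"] prod.cong)
      moreover have "P \<sigma> \<tau> (x(i := y j)) (y(j := x i)) a =
        (co (y j) (a (0, \<sigma> i)) * (\<Prod>k\<in>{..<p} - {i}. co (x k) (a (0, \<sigma> k)))) *
        (co (x i) (a (1, \<tau> j)) * (\<Prod>k\<in>{..<q} - {j}. co (y k) (a (1, \<tau> k))))"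
        unfolding P_def using ij
        by (subst prod.remove[of "{..<p}" i], simp, simp, subst prod.remove[of "{..<q}" j], simp, simp)
          (auto intro!: arg_cong2[of _ _ _ _ "(*)"] prod.cong)
      ultimately show "P \<sigma> \<tau> x y (a \<circ> transpose (0, \<sigma> i) (1, \<tau> j)) =
        P \<sigma> \<tau> (x(i := y j)) (y(j := x i)) a" by (simp add: mult_ac)
    qed
    finally show ?thesis by simp
  qed
  have swap: "(\<Sum>i<p. \<Sum>j<q. \<Sum>\<sigma>\<in>?A. \<Sum>\<tau>\<in>?B. c \<sigma> \<tau> * R i j \<sigma> \<tau>) =
      (\<Sum>\<sigma>\<in>?A. \<Sum>\<tau>\<in>?B. c \<sigma> \<tau> * (\<Sum>i<p. \<Sum>j<q. R i j \<sigma> \<tau>))" for R :: "nat \<Rightarrow> nat \<Rightarrow> _ \<Rightarrow> _ \<Rightarrow> 'k"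
  proof -
    have inner: "(\<Sum>j<r. \<Sum>\<sigma>\<in>?A. \<Sum>\<tau>\<in>?B. G j \<sigma> \<tau>) = (\<Sum>\<sigma>\<in>?A. \<Sum>\<tau>\<in>?B. \<Sum>j<r. G j \<sigma> \<tau>)"
      for r :: nat and G :: "nat \<Rightarrow> _ \<Rightarrow> _ \<Rightarrow> 'k"
      by (subst sum.swap) (intro sum.cong refl sum.swap)
    show ?thesis unfolding inner sum_distrib_left ..
  qed
  show ?thesis
    unfolding expand swap using key by (intro sum.cong refl) simp
qed

text \<open>\<open>garnir\<close> exchanges arguments, and \<open>polarization\<close> turns this
  into exchanging tableau entries. Each of the q boxes in row 1 contributes one copy of the original
  tableau.\<close>

lemma straight_exchange:
  "(\<Sum>j<q. \<Sum>i<p. straight (x(i := y j)) (y(j := x i))) = fscale (of_nat q) (straight x y)"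
proof -
  let ?f = "\<lambda>k l a. row_det x y (a \<circ> transpose (0, k) (1, l))"
  have "(\<Sum>j<q. \<Sum>i<p. straight (x(i := y j)) (y(j := x i))) =
      column_sym \<mu> (\<Sum>i<p. \<Sum>j<q. row_det (x(i := y j)) (y(j := x i)))"
    unfolding column_sym_sum straight_def by (rule sum.swap)
  also have "(\<Sum>i<p. \<Sum>j<q. row_det (x(i := y j)) (y(j := x i))) = (\<Sum>k<p. \<Sum>l<q. ?f k l)"
    by (rule ext) (simp only: sum_fun_apply polarization)
  also have "column_sym \<mu> \<dots> = (\<Sum>l<q. \<Sum>k<p. column_sym \<mu> (?f k l))"
    unfolding column_sym_sum by (rule sum.swap)
  also have "\<dots> = (\<Sum>l<q. straight x y)"
    by (intro sum.cong refl garnir) simp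
  also have "\<dots> = fscale (of_nat q) (straight x y)"
    by (rule ext) (simp add: sum_fun_apply)
  finally show ?thesis .
qed

lemma coord_det_transvection:
  assumes "\<And>l x. l < m \<Longrightarrow> co l (\<kappa> x) = (if l = v then co v x + co w x else co l x)"
    and "i < r" and "x i = v" and "inj_on x {..<r}" and "\<And>l. l < r \<Longrightarrow> x l < m"
  shows "coord_det r x (\<lambda>j. \<kappa> (a j)) = coord_det r x a + coord_det r (x(i := w)) a"
proof -
  have "(\<Prod>l<r. co (x l) (\<kappa> (a (\<sigma> l)))) =
      (\<Prod>l<r. co (x l) (a (\<sigma> l))) + (\<Prod>l<r. co ((x(i := w)) l) (a (\<sigma> l)))" for \<sigma>
  proof -
    have ne: "l \<noteq> i \<Longrightarrow> l < r \<Longrightarrow> x l \<noteq> v" for l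
      using assms(2-4) by (metis inj_onD lessThan_iff)
    have "(\<Prod>l<r. co (x l) (\<kappa> (a (\<sigma> l)))) =
        (co v (a (\<sigma> i)) + co w (a (\<sigma> i))) * (\<Prod>l\<in>{..<r} - {i}. co (x l) (a (\<sigma> l)))"
      using assms ne by (subst prod.remove[of "{..<r}" i]) auto
    moreover have "(\<Prod>l<r. co (x l) (a (\<sigma> l))) = co v (a (\<sigma> i)) * (\<Prod>l\<in>{..<r} - {i}. co (x l) (a (\<sigma> l)))"
      using assms(2,3) by (subst prod.remove[of "{..<r}" i]) auto
    moreover have "(\<Prod>l<r. co ((x(i := w)) l) (a (\<sigma> l))) =
        co w (a (\<sigma> i)) * (\<Prod>l\<in>{..<r} - {i}. co (x l) (a (\<sigma> l)))"
      using assms(2) by (subst prod.remove[of "{..<r}" i]) (auto intro!: prod.cong)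
    ultimately show ?thesis by (simp add: distrib_right)
  qed
  then show ?thesis by (simp add: coord_det_def distrib_left sum.distrib)
qed

text \<open>The tableau with rows \<open>x\<close> and \<open>y(j := x i)\<close> contains
  \<open>x i\<close> in both rows. The transvection adding coordinate \<open>y j\<close> to
  coordinate \<open>x i\<close> sends it to a sum of four tableaux; two of them are covered by the
  last two premises, and the other two form the asserted sum.\<close>

lemma straight_swap_step:
  assumes x: "\<And>i. i < p \<Longrightarrow> x i < m" "inj_on x {..<p}" and y: "\<And>j. j < q \<Longrightarrow> y j < m" "inj_on y {..<q}"
    and i: "i < p" "x i \<notin> y ` {..<q}" and j: "j < q" "y j \<notin> x ` {..<p}"
    and 1: "straight x (y(j := x i)) \<in> translates" and 2: "straight (x(i := y j)) y \<in> translates"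
  shows "straight x y + straight (x(i := y j)) (y(j := x i)) \<in> translates"
proof -
  let ?x = "x(i := y j)" and ?y = "y(j := x i)"
  have "x i \<noteq> y j" using i j by auto
  then obtain \<kappa> where \<kappa>: "\<kappa> \<in> \<Gamma>"
      "\<And>l w. l < m \<Longrightarrow> co l (\<kappa> w) = (if l = x i then co (x i) w + co (y j) w else co l w)"
    using \<Gamma>_transvection[of "x i" "y j"] x(1)[OF i(1)] y(1)[OF j(1)] by blast
  have dx: "coord_det p x (\<lambda>j. \<kappa> (a j)) = coord_det p x a + coord_det p ?x a" for a
    using \<kappa>(2) i(1) x by (intro coord_det_transvection) auto
  have inj: "inj_on ?y {..<q}" using y(2) i(2) by (rule inj_on_fun_updI)
  have "coord_det q ?y (\<lambda>j. \<kappa> (a j)) = coord_det q ?y a + coord_det q (?y(j := y j)) a" for a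
    by (rule coord_det_transvection[OF \<kappa>(2) j(1) _ inj]) (use i(1) x(1) y(1) in auto)
  then have dy: "coord_det q ?y (\<lambda>j. \<kappa> (a j)) = coord_det q ?y a + coord_det q y a" for a
    by simp
  have "(\<lambda>a. row_det x ?y (\<kappa> \<circ> a)) = row_det x ?y + row_det x y + (row_det ?x ?y + row_det ?x y)"
    by (rule ext) (simp only: row_det_def comp_apply dx dy plus_fun_apply, simp add: algebra_simps)
  then have "(\<lambda>a. straight x ?y (\<kappa> \<circ> a)) =
      straight x ?y + straight x y + (straight ?x ?y + straight ?x y)"
    unfolding straight_comp by (simp only: straight_def column_sym_add)
  then have "straight x y + straight ?x ?y =
      (\<lambda>a. straight x ?y (\<kappa> \<circ> a)) - straight x ?y - straight ?x y"
    by (simp only:) (simp add: algebra_simps)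
  also have "\<dots> \<in> translates"
    using translates_stable[OF 1 \<kappa>(1)] 1 2 unfolding translates_def by (intro fs.span_diff)
  finally show ?thesis .
qed

text \<open>
  Induction on the number of entries of \<open>y\<close> that do not occur in \<open>x\<close>: modulo the translates,
  exchanging such an entry with an entry of \<open>x\<close> changes the sign, so \<open>straight_exchange\<close>
  turns into a relation with a positive coefficient at \<open>straight x y\<close>.
\<close>

lemma straight_in_translates:
  assumes "\<And>i. i < p \<Longrightarrow> x i < m" and "\<And>j. j < q \<Longrightarrow> y j < m"
  shows "straight x y \<in> translates"
  using assms
proof (induction "card (y ` {..<q} - x ` {..<p})" arbitrary: x y rule: less_induct)
  case less
  let ?X = "x ` {..<p}" and ?Y = "y ` {..<q}" and ?R = "straight x y"
  note span = translates_def
  consider "\<not> inj_on x {..<p} \<or> \<not> inj_on y {..<q}" | "?Y \<subseteq> ?X" |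
    "inj_on x {..<p}" "inj_on y {..<q}" "\<not> ?Y \<subseteq> ?X" by blast
  then show ?case
  proof cases
    case 1
    then have "?R = 0" by (rule straight_repeated)
    then show ?thesis unfolding span by (simp only: fs.span_zero)
  next
    case 2
    then show ?thesis using less.prems(1) by (intro straight_contained) auto
  next
    case 3
    define T where "T i j = straight (x(i := y j)) (y(j := x i))" for i j
    \<comment> \<open>Modulo translates, the exchanges at \<open>j\<close> add up to (1 - w) times
      \<open>?R\<close>. The witness is 0 if \<open>y j\<close> occurs in \<open>x\<close>, and
      otherwise one more than the number of entries of \<open>x\<close> missing from
      \<open>y\<close>.\<close>
    have "\<exists>w::nat. fscale (of_nat w) ?R + ((\<Sum>i<p. T i j) - ?R) \<in> translates \<and> (y j \<notin> ?X \<longrightarrow> 0 < w)"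
      if j: "j < q" for j
    proof (cases "y j \<in> ?X")
      case True
      then obtain k where k: "k < p" "y j = x k" by auto
      have "T i j = 0" if "i \<in> {..<p} - {k}" for i
        unfolding T_def
      proof (rule straight_repeated, intro disjI1 notI)
        assume "inj_on (x(i := y j)) {..<p}"
        then have "i = k" using that k by (auto dest: inj_onD[of _ _ i k])
        then show False using that by simp
      qed
      moreover have "T k j = ?R" by (simp add: T_def k(2)[symmetric]) (simp add: k(2))
      ultimately have "(\<Sum>i<p. T i j) = ?R" using k(1) by (subst sum.remove[of _ k]) auto
      then have "fscale (of_nat 0) ?R + ((\<Sum>i<p. T i j) - ?R) = 0" by (simp add: fs.scale_zero_left)
      then have "fscale (of_nat 0) ?R + ((\<Sum>i<p. T i j) - ?R) \<in> translates"
        unfolding span by (simp only: fs.span_zero)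
      then show ?thesis using True by blast
    next
      case False
      define N where "N = card {i\<in>{..<p}. x i \<notin> ?Y}"
      \<comment> \<open>Both auxiliary tableaux of \<open>straight_swap_step\<close> have fewer
        entries of the second row missing from the first, so the induction hypothesis applies to
        them.\<close>
      have good: "?R + T i j \<in> translates" if "i < p" "x i \<notin> ?Y" for i
        unfolding T_def
      proof (rule straight_swap_step[OF less.prems(1) 3(1) less.prems(2) 3(2) that j False])
        have fin: "finite (?Y - ?X)" by simp
        have yj: "y j \<in> ?Y - ?X" using False j by auto
        have "(y(j := x i)) ` {..<q} - ?X \<subset> ?Y - ?X"
        proof
          show "(y(j := x i)) ` {..<q} - ?X \<subseteq> ?Y - ?X" using that by auto
          have "y j \<noteq> x i" using False that(1) by (metis imageI lessThan_iff)
          then have "y j \<notin> (y(j := x i)) ` {..<q}"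
            using 3(2) j by (auto simp: inj_on_def)
          then show "(y(j := x i)) ` {..<q} - ?X \<noteq> ?Y - ?X" using yj by blast
        qed
        then show "straight x (y(j := x i)) \<in> translates"
          using less.prems that by (intro less.hyps psubset_card_mono[OF fin]) auto
        have "?Y - (x(i := y j)) ` {..<p} \<subset> ?Y - ?X"
        proof
          show "?Y - (x(i := y j)) ` {..<p} \<subseteq> ?Y - ?X"
          proof
            fix z assume z: "z \<in> ?Y - (x(i := y j)) ` {..<p}"
            have "z \<noteq> x k" if "k < p" for k
            proof
              assume "z = x k"
              moreover from this have "k \<noteq> i" using z \<open>x i \<notin> ?Y\<close> by blast
              ultimately have "z \<in> (x(i := y j)) ` {..<p}"
                using \<open>k < p\<close> by (intro image_eqI[of _ _ k]) auto
              then show False using z by blast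
            qed
            then show "z \<in> ?Y - ?X" using z by blast
          qed
          have "y j \<in> (x(i := y j)) ` {..<p}" using that by (auto intro!: image_eqI[of _ _ i])
          then show "?Y - (x(i := y j)) ` {..<p} \<noteq> ?Y - ?X" using yj by blast
        qed
        then show "straight (x(i := y j)) y \<in> translates"
          using less.prems j by (intro less.hyps psubset_card_mono[OF fin]) auto
      qed
      have bad: "T i j = 0" if i: "i < p" "x i \<in> ?Y" for i
        unfolding T_def
      proof (rule straight_repeated, intro disjI2 notI)
        assume inj: "inj_on (y(j := x i)) {..<q}"
        obtain k where k: "k < q" "x i = y k" using i by auto
        then have "k \<noteq> j" using False i by (metis imageI lessThan_iff)
        then show False using inj j k by (auto dest: inj_onD[of _ _ j k])
      qed
      have "(\<Sum>i<p. T i j) = (\<Sum>i\<in>{i\<in>{..<p}. x i \<notin> ?Y}. T i j)"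
        by (rule sum.mono_neutral_right) (auto simp: bad)
      also have "\<dots> = (\<Sum>i\<in>{i\<in>{..<p}. x i \<notin> ?Y}. ?R + T i j) - fscale (of_nat N) ?R"
        by (rule ext) (simp add: sum_fun_apply sum.distrib N_def)
      finally have "fscale (of_nat (Suc N)) ?R + ((\<Sum>i<p. T i j) - ?R) =
          (\<Sum>i\<in>{i\<in>{..<p}. x i \<notin> ?Y}. ?R + T i j)"
        by (simp add: fs.scale_left_distrib algebra_simps)
      also have "\<dots> \<in> translates" using good unfolding span by (intro fs.span_sum) auto
      finally show ?thesis by blast
    qed
    then obtain w :: "nat \<Rightarrow> nat" where
      w: "\<And>j. j < q \<Longrightarrow> fscale (of_nat (w j)) ?R + ((\<Sum>i<p. T i j) - ?R) \<in> translates"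
        "\<And>j. j < q \<Longrightarrow> y j \<notin> ?X \<Longrightarrow> 0 < w j" by metis
    let ?W = "\<Sum>j<q. w j"
    \<comment> \<open>Summed over \<open>j\<close>, the exchanges cancel the q copies of
      \<open>?R\<close> by \<open>straight_exchange\<close>; a positive multiple of
      \<open>?R\<close> remains, and it can be divided out in characteristic 0.\<close>
    have "(\<Sum>j<q. fscale (of_nat (w j)) ?R + ((\<Sum>i<p. T i j) - ?R)) =
        fscale (of_nat ?W) ?R + ((\<Sum>j<q. \<Sum>i<p. T i j) - fscale (of_nat q) ?R)"
      by (rule ext) (simp add: sum_fun_apply sum.distrib sum_subtractf sum_distrib_right)
    also have "\<dots> = fscale (of_nat ?W) ?R"
      unfolding T_def straight_exchange by simp
    finally have eq: "(\<Sum>j<q. fscale (of_nat (w j)) ?R + ((\<Sum>i<p. T i j) - ?R)) = fscale (of_nat ?W) ?R" .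
    have "(\<Sum>j<q. fscale (of_nat (w j)) ?R + ((\<Sum>i<p. T i j) - ?R)) \<in> translates"
      unfolding span by (intro fs.span_sum w(1)[unfolded span]) simp
    then have W: "fscale (of_nat ?W) ?R \<in> translates" by (simp only: eq)
    obtain j where "j < q" "y j \<notin> ?X" using 3(3) by auto
    then have "?W \<noteq> 0" using w(2) by (auto simp: sum_eq_0_iff)
    then have ne: "(of_nat ?W :: 'k) \<noteq> 0" by (simp only: of_nat_eq_0_iff not_False_eq_True)
    have "fscale (inverse (of_nat ?W)) (fscale (of_nat ?W) ?R) = ?R"
      by (simp only: fs.scale_scale left_inverse[OF ne] fs.scale_one)
    moreover have "fscale (inverse (of_nat ?W)) (fscale (of_nat ?W) ?R) \<in> translates"
      using W unfolding span by (rule fs.span_scale)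
    ultimately show ?thesis by (simp only:)
  qed
qed

section \<open>The Schur module inside the span of the translates\<close>

lemma schur_eq: "schur s X \<mu> = column_sym \<mu> ` row_tensor 2 (\<lambda>i. ext_power s X (\<mu> i))"
  using num_rows_two_row[OF u_less] by (simp add: schur_def)

lemma row_product_in_schur:
  assumes "g \<in> ext_power s X p" and "h \<in> ext_power s X q"
  shows "column_sym \<mu> (\<lambda>a. g (\<lambda>j. a (0, j)) * h (\<lambda>j. a (1, j))) \<in> schur s X \<mu>"
proof -
  let ?f = "\<lambda>i::nat. if i = 0 then g else h"
  have "(\<lambda>a. g (\<lambda>j. a (0, j)) * h (\<lambda>j. a (1, j))) = (\<lambda>a. \<Prod>i<2. ?f i (\<lambda>j. a (i, j)))"
    by (simp add: numeral_2_eq_2)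
  moreover have "\<forall>i<2. ?f i \<in> ext_power s X (\<mu> i)"
    using assms by (simp add: numeral_2_eq_2 less_Suc_eq)
  ultimately have "(\<lambda>a. g (\<lambda>j. a (0, j)) * h (\<lambda>j. a (1, j))) \<in>
      {\<lambda>a. \<Prod>i<2. f i (\<lambda>j. a (i, j)) | f. \<forall>i<2. f i \<in> ext_power s X (\<mu> i)}"
    by (intro CollectI exI[of _ ?f] conjI)
  then show ?thesis
    unfolding schur_eq row_tensor_def by (intro imageI fs.span_base)
qed

lemma ext_power_\<Gamma>:
  assumes f: "f \<in> ext_power s X r" and \<kappa>: "\<kappa> \<in> \<Gamma>"
  shows "(\<lambda>a. f (\<lambda>j. \<kappa> (a j))) \<in> ext_power s X r"
proof -
  have ml: "multilinear {..<r} f" and alt: "\<And>a i j. i < j \<Longrightarrow> j < r \<Longrightarrow> a i = a j \<Longrightarrow> f a = 0"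
    using f by (auto simp: ext_power_iff)
  have upd: "(\<lambda>j. \<kappa> ((a(i := v)) j)) = (\<lambda>j. \<kappa> (a j))(i := \<kappa> v)" for a :: "nat \<Rightarrow> 'x" and i v by auto
  show ?thesis
    unfolding ext_power_iff multilinear_def upd
  proof (intro conjI allI ballI impI)
    fix a b :: "nat \<Rightarrow> 'x" assume "\<forall>i\<in>{..<r}. a i = b i"
    then show "f (\<lambda>j. \<kappa> (a j)) = f (\<lambda>j. \<kappa> (b j))" by (intro multilinear_cong[OF ml]) auto
  next
    fix a :: "nat \<Rightarrow> 'x" assume "\<exists>i\<in>{..<r}. a i \<notin> X"
    then obtain i where "i \<in> {..<r}" "\<kappa> (a i) \<notin> X" using \<Gamma>_in[OF \<kappa>] by blast
    then show "f (\<lambda>j. \<kappa> (a j)) = 0" by (rule multilinear_outside[OF ml])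
  next
    fix a i c x y assume "i \<in> {..<r}" "x \<in> X" "y \<in> X"
    then show "f ((\<lambda>j. \<kappa> (a j))(i := \<kappa> (s c x + y))) =
        c * f ((\<lambda>j. \<kappa> (a j))(i := \<kappa> x)) + f ((\<lambda>j. \<kappa> (a j))(i := \<kappa> y))"
      using \<Gamma>_in[OF \<kappa>] by (simp add: \<Gamma>_linear[OF \<kappa>] multilinear_linear[OF ml])
  next
    fix a :: "nat \<Rightarrow> 'x" and i j assume "i < j \<and> j < r \<and> a i = a j"
    then show "f (\<lambda>j. \<kappa> (a j)) = 0" by (intro alt[of i j]) auto
  qed
qed

lemma highest_\<Gamma>_in_schur:
  assumes "\<kappa> \<in> \<Gamma>"
  shows "(\<lambda>a. highest (\<kappa> \<circ> a)) \<in> schur s X \<mu>"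
proof -
  have "(\<lambda>b. coord_det r (\<lambda>i. i) (\<lambda>j. \<kappa> (b j))) \<in> ext_power s X r" if "r \<le> m" for r
    using that by (intro ext_power_\<Gamma>[OF _ assms] coord_det_in_ext_power) auto
  from row_product_in_schur[OF this this, OF p_le_m q_le_m] show ?thesis
    unfolding highest_def straight_comp row_det_def comp_apply
    by (simp add: column_sym_def)
qed

lemma highest_in_schur: "highest \<in> schur s X \<mu>"
  using highest_\<Gamma>_in_schur[OF \<Gamma>_id] by simp

text \<open>Expanding both rows in coordinate determinants turns a product of alternating forms into
  a combination of tableaux, each of which is already known to be a combination of
  translates.\<close>

lemma schur_subset_translates: "schur s X \<mu> \<subseteq> translates"
proof -
  have "column_sym \<mu> f \<in> translates" if "f \<in> row_tensor 2 (\<lambda>i. ext_power s X (\<mu> i))" for f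
    using that unfolding row_tensor_def
  proof (induction rule: fs.span_induct_alt)
    case base
    show ?case unfolding column_sym_zero translates_def by (rule fs.span_zero)
  next
    case (step c f g)
    then obtain F where F: "f = (\<lambda>a. \<Prod>i<2. F i (\<lambda>j. a (i, j)))" "\<forall>i<2. F i \<in> ext_power s X (\<mu> i)"
      by blast
    let ?A = "PiE {..<p} (\<lambda>_. {..<m})" and ?B = "PiE {..<q} (\<lambda>_. {..<m})"
    have F01: "F 0 \<in> ext_power s X p" "F 1 \<in> ext_power s X q"
      using F(2)[rule_format, of 0] F(2)[rule_format, of 1] by auto
    define c0 where "c0 x = F 0 (\<lambda>i. e (x i)) / fact p" for x
    define c1 where "c1 x = F 1 (\<lambda>i. e (x i)) / fact q" for x
    have 0: "F 0 b = (\<Sum>x\<in>?A. c0 x * coord_det p x b)" for b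
      using fun_cong[OF ext_power_expand[OF F01(1)], of b] by (simp add: sum_fun_apply c0_def)
    have 1: "F 1 b = (\<Sum>x\<in>?B. c1 x * coord_det q x b)" for b
      using fun_cong[OF ext_power_expand[OF F01(2)], of b] by (simp add: sum_fun_apply c1_def)
    have "f = (\<Sum>x\<in>?A. \<Sum>y\<in>?B. fscale (c0 x * c1 y) (row_det x y))"
    proof
      fix a
      have "f a = F 0 (\<lambda>j. a (0, j)) * F 1 (\<lambda>j. a (1, j))" by (simp add: F(1) numeral_2_eq_2)
      then show "f a = (\<Sum>x\<in>?A. \<Sum>y\<in>?B. fscale (c0 x * c1 y) (row_det x y)) a"
        unfolding 0 1 sum_product by (simp add: sum_fun_apply row_det_def mult_ac)
    qed
    then have "column_sym \<mu> f = (\<Sum>x\<in>?A. \<Sum>y\<in>?B. fscale (c0 x * c1 y) (straight x y))"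
      by (simp only: column_sym_sum column_sym_scale straight_def)
    also have "\<dots> \<in> translates"
      unfolding translates_def
      by (intro fs.span_sum fs.span_scale straight_in_translates[unfolded translates_def]) auto
    finally have "column_sym \<mu> f \<in> translates" .
    then show ?case
      using step.IH unfolding column_sym_add column_sym_scale translates_def
      by (intro fs.span_add fs.span_scale)
  qed
  then show ?thesis unfolding schur_eq by blast
qed

lemma schur_multilinear:
  assumes "f \<in> schur s X \<mu>"
  shows "multilinear (boxes \<mu>) f"
proof -
  obtain h where h: "h \<in> row_tensor 2 (\<lambda>i. ext_power s X (\<mu> i))" and f: "f = column_sym \<mu> h"
    using assms unfolding schur_eq by blast
  have "(SIGMA i:{..<2}. {..<\<mu> i}) = boxes \<mu>"
    by (auto simp: boxes_two_row two_row_apply less_Suc_eq numeral_2_eq_2 split: if_splits)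
  then have "multilinear (boxes \<mu>) h" using row_tensor_multilinear[OF h] by simp
  moreover have "f = (\<Sum>\<pi>\<in>column_group \<mu>. (\<lambda>a. h (a \<circ> \<pi>)))"
    by (rule ext) (simp add: f column_sym_def sum_fun_apply)
  ultimately have "f \<in> Collect (multilinear (boxes \<mu>))"
    by (simp only:) (intro fs.subspace_sum[OF multilinear_subspace] CollectI multilinear_permute,
      auto simp: column_group_def)
  then show ?thesis by simp
qed


section \<open>The homomorphism to the tensor square\<close>

text \<open>
  The boxes of a \<open>2 \<times> t\<close> rectangle are distributed over the diagram \<open>(t + u, t - u)\<close>: the last
  \<open>u\<close> boxes of row 1 are appended to row 0.
\<close>

definition fold_rows :: "(nat \<Rightarrow> nat) \<Rightarrow> (nat \<Rightarrow> nat) \<Rightarrow> (nat \<times> nat \<Rightarrow> 'x) \<Rightarrow> nat \<times> nat \<Rightarrow> 'x" where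
  "fold_rows \<sigma> \<tau> a = (\<lambda>(i, j). if i = 0 then if j < t then a (0, \<sigma> j) else a (1, \<tau> (j - u))
     else a (1, \<tau> j))"

text \<open>The rearranged function is antisymmetrized separately in the two rows of the rectangle.
  Only positions are permuted, so this commutes with maps applied to the entries.\<close>

definition \<theta> :: "((nat \<times> nat \<Rightarrow> 'x) \<Rightarrow> 'k) \<Rightarrow> (nat \<times> nat \<Rightarrow> 'x) \<Rightarrow> 'k" where
  "\<theta> f a = (\<Sum>\<sigma> | \<sigma> permutes {..<t}. \<Sum>\<tau> | \<tau> permutes {..<t}.
     of_int (sign \<sigma>) * of_int (sign \<tau>) * f (fold_rows \<sigma> \<tau> a))"

lemma \<theta>_add: "\<theta> (f + g) = \<theta> f + \<theta> g" and \<theta>_scale: "\<theta> (fscale c f) = fscale c (\<theta> f)"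
  by (auto simp: \<theta>_def fun_eq_iff sum.distrib distrib_left sum_distrib_left mult_ac)

lemma \<theta>_sum: "\<theta> (\<Sum>i\<in>A. f i) a = (\<Sum>i\<in>A. \<theta> (f i) a)"
proof (induction A rule: infinite_finite_induct)
  case (insert x F)
  have "\<theta> (sum f (insert x F)) = \<theta> (f x) + \<theta> (sum f F)"
    unfolding sum.insert[OF insert.hyps] by (rule \<theta>_add)
  then have "\<theta> (sum f (insert x F)) a = \<theta> (f x) a + \<theta> (sum f F) a"
    by (simp only: plus_fun_apply)
  also have "\<dots> = (\<Sum>i\<in>insert x F. \<theta> (f i) a)"
    unfolding insert.IH sum.insert[OF insert.hyps, of "\<lambda>i. \<theta> (f i) a"] ..
  finally show ?case .
qed (simp_all add: \<theta>_def)

lemma \<theta>_comp: "\<theta> f (\<kappa> \<circ> a) = \<theta> (\<lambda>a. f (\<kappa> \<circ> a)) a"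
proof -
  have "fold_rows \<sigma> \<tau> (\<kappa> \<circ> a) = \<kappa> \<circ> fold_rows \<sigma> \<tau> a" for \<sigma> \<tau>
    by (auto simp: fold_rows_def fun_eq_iff)
  then show ?thesis by (simp add: \<theta>_def)
qed

lemma row_product_in_row_tensor:
  assumes "g \<in> ext_power s X r" and "h \<in> ext_power s X r"
  shows "(\<lambda>a. g (\<lambda>j. a (0, j)) * h (\<lambda>j. a (1, j))) \<in> row_tensor 2 (\<lambda>_. ext_power s X r)"
proof -
  let ?f = "\<lambda>i::nat. if i = 0 then g else h"
  have "(\<lambda>a. g (\<lambda>j. a (0, j)) * h (\<lambda>j. a (1, j))) = (\<lambda>a. \<Prod>i<2. ?f i (\<lambda>j. a (i, j)))"
    by (simp add: numeral_2_eq_2)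
  moreover have "\<forall>i<2. ?f i \<in> ext_power s X r" using assms by simp
  ultimately have "(\<lambda>a. g (\<lambda>j. a (0, j)) * h (\<lambda>j. a (1, j))) \<in>
      {\<lambda>a. \<Prod>i<2::nat. f i (\<lambda>j. a (i, j)) | f. \<forall>i<2. f i \<in> ext_power s X r}"
    by (intro CollectI exI[of _ ?f] conjI)
  then show ?thesis unfolding row_tensor_def by (rule fs.span_base)
qed

text \<open>Antisymmetrizing a monomial gives one minor of size t for each row of the rectangle,
  which is why \<theta> lands in the tensor square of an exterior power. Position j \<ge> q of the
  second row stems from box (0, j + u) of the diagram.\<close>

lemma \<theta>_monomial:
  "\<theta> (\<lambda>a. \<Prod>b\<in>boxes \<mu>. co (x b) (a b)) a =
    coord_det t (\<lambda>j. x (0, j)) (\<lambda>j. a (0, j)) *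
    coord_det t (\<lambda>j. if j < q then x (1, j) else x (0, j + u)) (\<lambda>j. a (1, j))"
proof -
  let ?y = "\<lambda>j. if j < q then x (1, j) else x (0, j + u)"
  have boxes: "boxes \<mu> = Pair 0 ` {..<p} \<union> Pair 1 ` {..<q}"
    by (auto simp: boxes_two_row)
  have split: "(\<Prod>b\<in>boxes \<mu>. h b) = (\<Prod>j<p. h (0, j)) * (\<Prod>j<q. h (1, j))" for h :: "nat \<times> nat \<Rightarrow> 'k"
    unfolding boxes by (subst prod.union_disjoint) (auto simp: prod.reindex inj_on_def)
  have cut: "(\<Prod>j<a + b. h j) = (\<Prod>j<a. h j) * (\<Prod>j<b. h (a + j))" for a b and h :: "nat \<Rightarrow> 'k"
    by (induction b) (simp_all add: mult_ac)
  have key: "(\<Prod>b\<in>boxes \<mu>. co (x b) (fold_rows \<sigma> \<tau> a b)) =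
      (\<Prod>j<t. co (x (0, j)) (a (0, \<sigma> j))) * (\<Prod>j<t. co (?y j) (a (1, \<tau> j)))" for \<sigma> \<tau>
  proof -
    have "(\<Prod>j<q + u. co (?y j) (a (1, \<tau> j))) =
        (\<Prod>j<q. co (x (1, j)) (a (1, \<tau> j))) * (\<Prod>j<u. co (x (0, t + j)) (a (1, \<tau> (q + j))))"
      unfolding cut using u_less by (intro arg_cong2[of _ _ _ _ "(*)"] prod.cong) (auto simp: add_ac)
    then have "(\<Prod>j<t. co (?y j) (a (1, \<tau> j))) =
        (\<Prod>j<q. co (x (1, j)) (a (1, \<tau> j))) * (\<Prod>j<u. co (x (0, t + j)) (a (1, \<tau> (q + j))))"
      using u_less by simp
    moreover have "(\<Prod>j<u. co (x (0, t + j)) (a (1, \<tau> (t + j - u)))) =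
        (\<Prod>j<u. co (x (0, t + j)) (a (1, \<tau> (q + j))))"
      using u_less by (intro prod.cong refl) simp
    ultimately show ?thesis
      unfolding split cut by (simp add: fold_rows_def mult_ac)
  qed
  show ?thesis
    by (simp add: \<theta>_def key coord_det_def sum_product mult_ac)
qed

lemma \<theta>_in_row_tensor:
  assumes f: "multilinear (boxes \<mu>) f"
  shows "\<theta> f \<in> row_tensor 2 (\<lambda>_. ext_power s X t)"
proof -
  let ?S = "PiE (boxes \<mu>) (\<lambda>_. {..<m})"
  let ?mono = "\<lambda>x a. \<Prod>b\<in>boxes \<mu>. co (x b) (a b)"
  let ?g = "\<lambda>x. fscale (f (\<lambda>b. e (x b))) (?mono x)"
  have "f = (\<Sum>x\<in>?S. ?g x)"
    by (rule ext, subst multilinear_expand[OF f finite_boxes_two_row])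
      (simp only: sum_fun_apply fscale_apply)
  then have "\<theta> f = \<theta> (\<Sum>x\<in>?S. ?g x)" by (rule arg_cong)
  also have "\<dots> = (\<Sum>x\<in>?S. \<theta> (?g x))"
    by (rule ext) (simp only: \<theta>_sum sum_fun_apply)
  also have "\<dots> = (\<Sum>x\<in>?S. fscale (f (\<lambda>b. e (x b))) (\<theta> (?mono x)))"
    by (simp only: \<theta>_scale)
  also have "\<dots> \<in> row_tensor 2 (\<lambda>_. ext_power s X t)"
    unfolding row_tensor_def
  proof (intro fs.span_sum fs.span_scale)
    fix x assume x: "x \<in> ?S"
    have "x (0, j) < m" if "j < p" for j
      using x that by (auto simp: boxes_two_row dest!: PiE_mem[of _ _ _ "(0, j)"])
    moreover have "x (1, j) < m" if "j < q" for j
      using x that by (auto simp: boxes_two_row dest!: PiE_mem[of _ _ _ "(1, j)"])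
    ultimately have
      "(\<lambda>a. coord_det t (\<lambda>j. x (0, j)) (\<lambda>j. a (0, j)) *
        coord_det t (\<lambda>j. if j < q then x (1, j) else x (0, j + u)) (\<lambda>j. a (1, j)))
        \<in> row_tensor 2 (\<lambda>_. ext_power s X t)"
      by (intro row_product_in_row_tensor coord_det_in_ext_power) auto
    moreover have "\<theta> (?mono x) = (\<lambda>a. coord_det t (\<lambda>j. x (0, j)) (\<lambda>j. a (0, j)) *
        coord_det t (\<lambda>j. if j < q then x (1, j) else x (0, j + u)) (\<lambda>j. a (1, j)))"
      by (rule ext) (rule \<theta>_monomial)
    ultimately show "\<theta> (?mono x) \<in> module.span fscale
        {\<lambda>a. \<Prod>i<2. f i (\<lambda>j. a (i, j)) | f. \<forall>i<2. f i \<in> ext_power s X t}"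
      by (simp only: row_tensor_def)
  qed
  finally show ?thesis .
qed

text \<open>The involution exchanging the blocks q, .., t - 1 and t, .., p - 1, both of length u.
  When the first row of the rectangle holds 0, .., t - 1, the weight requires 0, .., q - 1 and t,
  .., p - 1 in the second row; these are the values of \<open>flip\<close> on its positions.\<close>

definition flip :: "nat \<Rightarrow> nat" where
  "flip j = (if q \<le> j \<and> j < t then j + u else if t \<le> j \<and> j < p then j - u else j)"

lemma flip_flip: "flip (flip j) = j"
  using u_less by (auto simp: flip_def)

lemma flip_permutes: "flip permutes {..<p}"
  using flip_flip by (intro bij_imp_permutes bij_betw_byWitness[where f' = flip])
    (auto simp: flip_def)

text \<open>The place of evaluation: folded with identity permutations, it has the basis vectors in
  natural order in both rows of the diagram, so the corresponding term is 1.\<close>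

definition corner :: "nat \<times> nat \<Rightarrow> 'x" where
  "corner = (\<lambda>(i, j). e (if i = 0 then j else flip j))"

text \<open>
  The rows of the rearranged array are permutations only if they arise from \<open>\<sigma>\<close> and a conjugate
  of \<open>\<tau>\<close> by exchanging values on a set of columns; then \<open>exchange_sign\<close> shows that all signs cancel.
\<close>

lemma \<theta>_highest_term:
  assumes \<sigma>: "\<sigma> permutes {..<t}" and \<tau>: "\<tau> permutes {..<t}" and \<pi>: "\<pi> \<in> column_group \<mu>"
  defines "v \<equiv> of_int (sign \<sigma>) * of_int (sign \<tau>) *
    row_det (\<lambda>i. i) (\<lambda>i. i) (fold_rows \<sigma> \<tau> corner \<circ> \<pi>)"
  shows "v = 0 \<or> v = 1"
proof (cases "v = 0")
  case False
  obtain S where S: "S \<subseteq> {..<q}"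
    "\<And>j. \<pi> (0, j) = (if j \<in> S then (1, j) else (0, j))"
    "\<And>j. \<pi> (1, j) = (if j \<in> S then (0, j) else (1, j))"
    using column_group_cases[OF \<pi>] by blast
  \<comment> \<open>\<tau> permutes positions of the second row; conjugation by \<open>flip\<close>
    makes it a permutation of the indices that \<open>corner\<close> places there, with the same
    sign.\<close>
  define \<tau>' where "\<tau>' = flip \<circ> \<tau> \<circ> flip"
  \<comment> \<open>The columns where row 0 of the folded array takes its value from the second row
    of the rectangle: those exchanged by \<pi> and the u appended ones.\<close>
  define B where "B = S \<union> {t..<p}"
  define \<rho> where "\<rho> = (\<lambda>j. if j \<in> B then \<tau>' j else \<sigma> j)"
  define \<rho>' where "\<rho>' = (\<lambda>j. if j \<in> B then \<sigma> j else \<tau>' j)"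
  have \<sigma>p: "\<sigma> permutes {..<p}" and \<tau>p: "\<tau> permutes {..<p}"
    using \<sigma> \<tau> by (auto intro: permutes_subset)
  have \<tau>': "\<tau>' permutes {..<p}"
    unfolding \<tau>'_def using flip_permutes \<tau>p by (intro permutes_compose)
  have sign_\<tau>': "sign \<tau>' = sign \<tau>"
    unfolding \<tau>'_def using flip_permutes \<tau>p
    by (simp add: sign_compose permutation_of_bounded permutation_compose mult_ac)
  have \<sigma>_id: "\<sigma> j = j" if "t \<le> j" for j using \<sigma> that by (simp add: permutes_not_in)
  have \<tau>_id: "\<tau> j = j" if "t \<le> j" for j using \<tau> that by (simp add: permutes_not_in)
  have \<tau>'_lo: "\<tau>' j = flip (\<tau> j)" if "j < q" for j
  proof -
    have "flip j = j" using that by (auto simp: flip_def)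
    then show ?thesis by (simp add: \<tau>'_def)
  qed
  have \<tau>'_hi: "\<tau>' j = flip (\<tau> (j - u))" if "t \<le> j" "j < p" for j
    using that by (simp add: \<tau>'_def flip_def)
  have \<tau>'_id: "\<tau>' j = j" if "q \<le> j" "j < t" for j
  proof -
    have "t \<le> flip j" using that by (simp add: flip_def)
    then show ?thesis by (simp add: \<tau>'_def \<tau>_id flip_flip)
  qed
  have row0: "(fold_rows \<sigma> \<tau> corner \<circ> \<pi>) (0, j) = e (\<rho> j)" if "j < p" for j
    using S(1) that \<tau>'_lo[of j] \<tau>'_hi[of j] u_less
    by (auto simp: S(2) fold_rows_def corner_def \<rho>_def B_def)
  have row1: "(fold_rows \<sigma> \<tau> corner \<circ> \<pi>) (1, j) = e (\<rho>' j)" if "j < q" for j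
    using S(1) that \<tau>'_lo[of j] by (auto simp: S(3)[simplified] fold_rows_def corner_def \<rho>'_def B_def)
  have v: "v = of_int (sign \<sigma>) * of_int (sign \<tau>) *
      (coord_det p (\<lambda>i. i) (\<lambda>j. e (\<rho> j)) * coord_det q (\<lambda>i. i) (\<lambda>j. e (\<rho>' j)))"
    unfolding v_def row_det_def
    by (intro arg_cong2[of _ _ _ _ "(*)"] refl coord_det_cong row0 row1)
  have \<rho>_lt: "\<rho> j < p" "\<rho>' j < p" if "j < p" for j
    using that \<sigma>p \<tau>' by (auto simp: \<rho>_def \<rho>'_def)
  have "bij_betw \<rho> {..<p} {..<p}"
    using False v p_le_m \<rho>_lt(1) by (intro coord_det_basis_nonzero) (auto intro: less_le_trans)
  moreover have "\<rho> j = j" if "j \<notin> {..<p}" for j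
    using that \<sigma>_id[of j] S(1) by (auto simp: \<rho>_def B_def)
  ultimately have \<rho>: "\<rho> permutes {..<p}" by (rule bij_imp_permutes)
  have "\<rho>' j < m" if "j < q" for j using \<rho>_lt(2)[of j] that p_le_m by linarith
  then have "bij_betw \<rho>' {..<q} {..<q}"
    using False v q_le_m by (intro coord_det_basis_nonzero) auto
  moreover have "\<rho>' j = j" if "j \<notin> {..<q}" for j
    using that \<sigma>_id[of j] \<tau>'_id[of j] S(1) permutes_not_in[OF \<tau>', of j]
    by (cases "j < t") (auto simp: \<rho>'_def B_def)
  ultimately have \<rho>': "\<rho>' permutes {..<q}" by (rule bij_imp_permutes)
  have "sign \<rho> * sign \<rho>' = sign \<sigma> * sign \<tau>'"
    using exchange_sign[OF \<sigma>p \<tau>', of B] \<rho> permutes_subset[OF \<rho>', of "{..<p}"] q_le_p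
    unfolding \<rho>_def \<rho>'_def by simp
  then have "of_int (sign \<rho>) * of_int (sign \<rho>') = (of_int (sign \<sigma>) * of_int (sign \<tau>) :: 'k)"
    unfolding sign_\<tau>' by (metis of_int_mult)
  then have "v = of_int (sign \<sigma>) * of_int (sign \<tau>) * (of_int (sign \<sigma>) * of_int (sign \<tau>))"
    unfolding v coord_det_basis_permutes[OF \<rho> p_le_m] coord_det_basis_permutes[OF \<rho>' q_le_m] by simp
  then show ?thesis by (simp add: mult_ac of_int_sign_idem) (simp flip: of_int_mult)
qed simp

lemma \<theta>_highest_nonzero: "\<theta> highest corner \<noteq> 0"
proof -
  let ?P = "{\<sigma>. \<sigma> permutes {..<t}}"
  let ?h = "\<lambda>(\<sigma>, \<tau>, \<pi>). of_int (sign \<sigma>) * of_int (sign \<tau>) *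
    row_det (\<lambda>i. i) (\<lambda>i. i) (fold_rows \<sigma> \<tau> corner \<circ> \<pi>)"
  have "\<theta> highest corner = (\<Sum>z\<in>?P \<times> ?P \<times> column_group \<mu>. ?h z)"
    by (simp add: \<theta>_def highest_def straight_def column_sym_def sum_distrib_left sum.cartesian_product)
  moreover have "(\<Sum>z\<in>?P \<times> ?P \<times> column_group \<mu>. ?h z) \<noteq> 0"
  proof (rule sum_zero_one_nonzero)
    show "finite (?P \<times> ?P \<times> column_group \<mu>)"
      by (intro finite_cartesian_product finite_column_group finite_permutations) auto
    show "?h z = 0 \<or> ?h z = 1" if "z \<in> ?P \<times> ?P \<times> column_group \<mu>" for z
    proof -
      obtain \<sigma> \<tau> \<pi> where z: "z = (\<sigma>, \<tau>, \<pi>)" by (cases z)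
      then have "\<sigma> permutes {..<t}" "\<tau> permutes {..<t}" "\<pi> \<in> column_group \<mu>" using that by auto
      from \<theta>_highest_term[OF this] show ?thesis by (simp only: z prod.case)
    qed
    show "(id, id, id) \<in> ?P \<times> ?P \<times> column_group \<mu>"
      using permutes_id[of "boxes \<mu>"] permutes_id[of "{..<t}"] by (auto simp: column_group_def)
    have "fold_rows id id corner (0, j) = e (id j)" if "j < p" for j
      using that u_less by (auto simp: fold_rows_def corner_def flip_def)
    moreover have "fold_rows id id corner (1, j) = e (id j)" if "j < q" for j
      using that by (auto simp: fold_rows_def corner_def flip_def)
    ultimately have "row_det (\<lambda>i. i) (\<lambda>i. i) (fold_rows id id corner) =
      coord_det p (\<lambda>i. i) (\<lambda>i. e (id i)) * coord_det q (\<lambda>i. i) (\<lambda>i. e (id i))"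
      unfolding row_det_def by (intro arg_cong2[of _ _ _ _ "(*)"] coord_det_cong refl)
    also have "\<dots> = 1"
      using p_le_m q_le_m by (subst (1 2) coord_det_basis_permutes) auto
    finally show "?h (id, id, id) = 1" by simp
  qed
  ultimately show ?thesis by simp
qed


section \<open>Vectors that transform like the highest weight vector\<close>

text \<open>A substitute for weight and Borel conditions: \<open>f\<close> has the eigenvalue of
  \<open>highest\<close> under every group element for which \<open>highest\<close> is an
  eigenvector. The image of \<open>highest\<close> under any equivariant map inherits this.\<close>

definition semi_invariant :: "((nat \<times> nat \<Rightarrow> 'x) \<Rightarrow> 'k) \<Rightarrow> bool" where
  "semi_invariant f \<longleftrightarrow> (\<forall>\<kappa>\<in>\<Gamma>. \<forall>\<chi>. (\<forall>a. highest (\<kappa> \<circ> a) = \<chi> * highest a) \<longrightarrow>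
     (\<forall>a. f (\<kappa> \<circ> a) = \<chi> * f a))"

lemma semi_invariant_\<theta>: "semi_invariant (\<theta> highest)"
  unfolding semi_invariant_def
proof (intro ballI allI impI)
  fix \<kappa> \<chi> a assume "\<forall>a. highest (\<kappa> \<circ> a) = \<chi> * highest a"
  then have "(\<lambda>a. highest (\<kappa> \<circ> a)) = fscale \<chi> highest" by (intro ext) simp
  then show "\<theta> highest (\<kappa> \<circ> a) = \<chi> * \<theta> highest a" by (simp add: \<theta>_comp \<theta>_scale)
qed

lemma highest_scaled:
  assumes "\<And>a. coord_det p (\<lambda>i. i) (\<lambda>j. \<kappa> (a j)) = \<chi>p * coord_det p (\<lambda>i. i) a"
    and "\<And>a. coord_det q (\<lambda>i. i) (\<lambda>j. \<kappa> (a j)) = \<chi>q * coord_det q (\<lambda>i. i) a"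
  shows "highest (\<kappa> \<circ> a) = \<chi>p * \<chi>q * highest a"
  unfolding highest_def straight_comp row_det_def comp_apply assms
  by (simp add: straight_def column_sym_def row_det_def sum_distrib_left mult_ac)

lemma highest_dilation:
  assumes "\<And>l x. l < m \<Longrightarrow> co l (\<kappa> x) = (if l = i then 2 else 1) * co l x"
  shows "highest (\<kappa> \<circ> a) = 2 ^ ((if i < p then 1 else 0) + (if i < q then 1 else 0)) * highest a"
proof -
  have "coord_det r (\<lambda>i. i) (\<lambda>j. \<kappa> (a j)) = (if i < r then 2 else 1) * coord_det r (\<lambda>i. i) a"
    if "r \<le> m" for r a
  proof -
    have "(\<Prod>l<r. co l (\<kappa> (a (\<sigma> l)))) = (if i < r then 2 else 1) * (\<Prod>l<r. co l (a (\<sigma> l)))" for \<sigma>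
    proof -
      have "(\<Prod>l<r. co l (\<kappa> (a (\<sigma> l)))) = (\<Prod>l<r. (if l = i then 2 else 1) * co l (a (\<sigma> l)))"
        using assms that by (intro prod.cong refl) auto
      also have "\<dots> = (\<Prod>l<r. if l = i then 2 else 1) * (\<Prod>l<r. co l (a (\<sigma> l)))"
        by (rule prod.distrib)
      also have "(\<Prod>l<r. if l = i then 2 else 1) = (if i < r then 2 else 1 :: 'k)"
        by (simp add: prod.delta)
      finally show ?thesis .
    qed
    then show ?thesis by (simp add: coord_det_def sum_distrib_left mult_ac)
  qed
  from highest_scaled[OF this this, OF p_le_m q_le_m, of a] show ?thesis
    by simp
qed

text \<open>The shorter minor uses only indices fixed by \<zeta>, so the longer one alone
  contributes, with the sign of \<zeta>. Such permutations shuffle the indices that occur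
  once.\<close>

lemma highest_permute:
  assumes \<zeta>: "\<zeta> permutes {..<p}" and fixes_q: "\<And>i. i < q \<Longrightarrow> \<zeta> i = i"
    and "\<And>l x. l < m \<Longrightarrow> co l (\<kappa> x) = co (\<zeta> l) x"
  shows "highest (\<kappa> \<circ> a) = of_int (sign \<zeta>) * highest a"
proof -
  have *: "coord_det r (\<lambda>i. i) (\<lambda>j. \<kappa> (a j)) = coord_det r \<zeta> a" if "r \<le> m" for r a
    unfolding coord_det_def using that assms(3)
    by (intro sum.cong refl arg_cong2[of _ _ _ _ "(*)"] prod.cong) auto
  have "coord_det p (\<lambda>i. i) (\<lambda>j. \<kappa> (a j)) = of_int (sign \<zeta>) * coord_det p (\<lambda>i. i) a" for a
    using *[OF p_le_m] coord_det_permute_index[OF \<zeta>, of "\<lambda>i. i" a] by (simp add: comp_def)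
  moreover have "coord_det q (\<lambda>i. i) (\<lambda>j. \<kappa> (a j)) = 1 * coord_det q (\<lambda>i. i) a" for a
    unfolding *[OF q_le_m] using fixes_q by (simp cong: coord_det_cong)
  ultimately show ?thesis using highest_scaled[of \<kappa> "of_int (sign \<zeta>)" 1 a] by simp
qed

text \<open>
  Since \<open>2\<close> is not a root of unity, doubling one basis vector at a time detects how often each
  basis vector occurs.
\<close>

lemma semi_invariant_weight:
  assumes f: "f \<in> row_tensor d (\<lambda>_. ext_power s X t)" and inv: "semi_invariant f"
    and z: "\<And>b. b \<in> {..<d} \<times> {..<t} \<Longrightarrow> z b < m" and nz: "f (\<lambda>b. e (z b)) \<noteq> 0" and i: "i < m"
  shows "card {b \<in> {..<d} \<times> {..<t}. z b = i} = (if i < p then 1 else 0) + (if i < q then 1 else 0)"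
    (is "card ?B = ?w")
proof -
  let ?I = "{..<d} \<times> {..<t}"
  have ml: "multilinear ?I f" using row_tensor_multilinear[OF f] by simp
  obtain \<kappa> where \<kappa>: "\<kappa> \<in> \<Gamma>" "\<And>l x. l < m \<Longrightarrow> co l (\<kappa> x) = (if l = i then 2 else 1) * co l x"
    using \<Gamma>_dilation[OF i] by blast
  have \<kappa>e: "\<kappa> (e j) = s (if j = i then 2 else 1) (e j)" if "j < m" for j
    using that \<Gamma>_in[OF \<kappa>(1)] by (intro co_eqI X_scale) (auto simp: e_in \<kappa>(2) co_scale co_e)
  have "f (\<kappa> \<circ> (\<lambda>b. e (z b))) = 2 ^ ?w * f (\<lambda>b. e (z b))"
    using inv[unfolded semi_invariant_def] \<kappa>(1) highest_dilation[OF \<kappa>(2)] by blast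
  moreover have "f (\<kappa> \<circ> (\<lambda>b. e (z b))) = f (\<lambda>b. s (if z b = i then 2 else 1) (e (z b)))"
    using z by (intro multilinear_cong[OF ml]) (simp add: \<kappa>e)
  moreover have "\<dots> = (\<Prod>b\<in>?I. if z b = i then 2 else 1) * f (\<lambda>b. e (z b))"
    using z by (intro multilinear_scale_all[OF ml]) (auto intro: e_in)
  moreover have "(\<Prod>b\<in>?I. if z b = i then 2 else 1) = (2 ^ card ?B :: 'k)"
    by (simp add: prod.If_cases Int_def)
  ultimately have "(2 ^ card ?B :: 'k) = 2 ^ ?w" using nz by simp
  then have "(of_nat (2 ^ card ?B) :: 'k) = of_nat (2 ^ ?w)" by simp
  then show ?thesis unfolding of_nat_eq_iff by (simp only: power_inject_exp) 
qed

text \<open>Counting entries by weight gives d t = p + q = 2t. Rows have distinct entries, so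
  indices below q lie in both rows and those from q to p - 1 in exactly one. A permutation \<zeta>
  fixing the former turns the index set of row 0 into 0, .., t - 1; \<sigma> and \<tau> record the
  order of the entries.\<close>

lemma normal_form:
  assumes f: "f \<in> row_tensor d (\<lambda>_. ext_power s X t)" and inv: "semi_invariant f"
    and z: "\<And>b. b \<in> {..<d} \<times> {..<t} \<Longrightarrow> z b < m" and nz: "f (\<lambda>b. e (z b)) \<noteq> 0"
  shows "d = 2" and "\<exists>\<zeta> \<sigma> \<tau>. \<zeta> permutes {..<p} \<and> (\<forall>i<q. \<zeta> i = i) \<and>
    \<sigma> permutes {..<t} \<and> \<tau> permutes {..<t} \<and>
    (\<forall>j<t. z (0, j) = \<zeta> (\<sigma> j) \<and> z (1, j) = \<zeta> (flip (\<tau> j)))"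
proof -
  let ?I = "{..<d} \<times> {..<t}"
  have weight: "card {b \<in> ?I. z b = i} = (if i < p then 1 else 0) + (if i < q then 1 else 0)"
    if "i < m" for i using semi_invariant_weight[OF f inv z nz that] .
  have "card ?I = (\<Sum>i<m. card {b \<in> ?I. z b = i})"
  proof -
    have "?I = (\<Union>i<m. {b \<in> ?I. z b = i})" using z by auto
    then have "card ?I = card (\<Union>i<m. {b \<in> ?I. z b = i})" by simp
    also have "\<dots> = (\<Sum>i<m. card {b \<in> ?I. z b = i})" by (rule card_UN_disjoint) auto
    finally show ?thesis .
  qed
  also have "\<dots> = (\<Sum>i<m. if i < p then 1 else 0) + (\<Sum>i<m. if i < q then 1 else 0)"
    using weight by (simp add: sum.distrib)
  also have "\<dots> = p + q"
  proof -
    have "{i. i < m \<and> i < r} = {..<r}" if "r \<le> m" for r using that by auto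
    then show ?thesis using p_le_m q_le_m by (simp add: sum.If_cases Int_def)
  qed
  finally have "d * t = 2 * t" using u_less by simp
  then show d: "d = 2" using u_less by simp
  have inj: "inj_on (\<lambda>j. z (i, j)) {..<t}" if i: "i < 2" for i
  proof (rule inj_onI, rule ccontr)
    fix j k assume jk: "j \<in> {..<t}" "k \<in> {..<t}" "z (i, j) = z (i, k)" "j \<noteq> k"
    let ?a = "\<lambda>b. e (z b)"
    have "(\<lambda>r. f (replace_row i r ?a)) \<in> ext_power s X t"
      using row_tensor_row[OF f] i d by simp
    then have *: "f (replace_row i r ?a) = 0" if "r j = r k" for r
      using jk that unfolding ext_power_iff by (metis lessThan_iff linorder_neqE_nat)
    have "replace_row i (\<lambda>j. ?a (i, j)) ?a = ?a" by (auto simp: replace_row_def fun_eq_iff)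
    then show False using *[of "\<lambda>j. ?a (i, j)"] jk(3) nz by simp
  qed
  define A where "A i = (\<lambda>j. z (i, j)) ` {..<t}" for i
  have A_lt: "A i \<subseteq> {..<m}" if "i < 2" for i using that z d by (auto simp: A_def)
  have card_row: "card {j\<in>{..<t}. z (i, j) = k} = (if k \<in> A i then 1 else 0)" if i: "i < 2" for i k
  proof (cases "k \<in> A i")
    case True
    then obtain j where j: "j < t" "z (i, j) = k" by (auto simp: A_def)
    then have "{j\<in>{..<t}. z (i, j) = k} = {j}" using inj[OF i] by (auto dest: inj_onD)
    then show ?thesis using True by simp
  next
    case False
    then have "{j\<in>{..<t}. z (i, j) = k} = {}" by (auto simp: A_def)
    then show ?thesis using False by simp
  qed
  have wt: "(if k \<in> A 0 then 1 else 0) + (if k \<in> A 1 then 1 else 0) =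
      (if k < p then 1 else 0) + (if k < q then 1 else 0 :: nat)" if "k < m" for k
  proof -
    have "{b \<in> ?I. z b = k} = Pair 0 ` {j\<in>{..<t}. z (0, j) = k} \<union> Pair 1 ` {j\<in>{..<t}. z (1, j) = k}"
      unfolding d by (auto simp: less_2_cases_iff)
    then have "card {b \<in> ?I. z b = k} =
        card (Pair (0::nat) ` {j\<in>{..<t}. z (0, j) = k}) + card (Pair (1::nat) ` {j\<in>{..<t}. z (1, j) = k})"
      by (simp only:) (rule card_Un_disjoint, auto)
    also have "\<dots> = card {j\<in>{..<t}. z (0, j) = k} + card {j\<in>{..<t}. z (1, j) = k}"
      by (simp add: card_image inj_on_def)
    finally show ?thesis using weight[OF that] card_row[of 0 k] card_row[of 1 k] by simp
  qed
  have A_iff: "k \<in> A 0 \<or> k \<in> A 1 \<longleftrightarrow> k < p" "k \<in> A 0 \<and> k \<in> A 1 \<longleftrightarrow> k < q" for k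
  proof -
    have "(k \<in> A 0 \<or> k \<in> A 1 \<longleftrightarrow> k < p) \<and> (k \<in> A 0 \<and> k \<in> A 1 \<longleftrightarrow> k < q)"
    proof (cases "k < m")
      case True
      have "k < q \<Longrightarrow> k < p" by simp
      then show ?thesis
        using wt[OF True] by (cases "k \<in> A 0"; cases "k \<in> A 1"; cases "k < p"; cases "k < q"; simp)
    next
      case False
      then have "k \<notin> A 0" "k \<notin> A 1" using A_lt[of 0] A_lt[of 1] by auto
      then show ?thesis using False p_le_m q_le_m by auto
    qed
    then show "k \<in> A 0 \<or> k \<in> A 1 \<longleftrightarrow> k < p" "k \<in> A 0 \<and> k \<in> A 1 \<longleftrightarrow> k < q" by blast+
  qed
  have q_A: "{..<q} \<subseteq> A 0" and A_p: "A 0 \<subseteq> {..<p}" using A_iff by blast+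
  have "card (A 0 - {..<q}) = card {q..<t}"
    using q_A inj[of 0] by (subst card_Diff_subset) (auto simp: A_def card_image)
  then obtain b where b: "bij_betw b {q..<t} (A 0 - {..<q})"
    using finite_same_card_bij[of "{q..<t}" "A 0 - {..<q}"] by (auto simp: A_def)
  \<comment> \<open>An enumeration of the indices in row 0 that starts with 0, .., q - 1, so that
    its extension \<zeta> fixes these.\<close>
  define h where "h i = (if i < q then i else b i)" for i
  have "bij_betw h {..<q} {..<q}" by (auto simp: bij_betw_def inj_on_def h_def)
  moreover have "bij_betw h {q..<t} (A 0 - {..<q})"
    using b by (rule bij_betw_cong[THEN iffD1, rotated]) (auto simp: h_def)
  ultimately have "bij_betw h ({..<q} \<union> {q..<t}) ({..<q} \<union> (A 0 - {..<q}))"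
    by (rule bij_betw_combine) auto
  moreover have "{..<q} \<union> {q..<t} = {..<t}" "{..<q} \<union> (A 0 - {..<q}) = A 0"
    using q_A by auto
  ultimately have h: "bij_betw h {..<t} (A 0)" by simp
  then obtain \<zeta> where \<zeta>: "\<zeta> permutes {..<p}" "\<forall>i<t. \<zeta> i = h i"
    using extend_to_permutation[of h t p] A_p by (auto simp: bij_betw_def)
  have \<zeta>_q: "\<zeta> i = i" if "i < q" for i using \<zeta>(2) that by (simp add: h_def)
  have \<zeta>0: "\<zeta> k \<in> A 0 \<longleftrightarrow> k < t" for k
  proof
    assume "\<zeta> k \<in> A 0"
    then have "\<zeta> k \<in> h ` {..<t}" using h by (simp add: bij_betw_def)
    then obtain j where "j < t" "\<zeta> k = h j" by auto
    then have "\<zeta> j = \<zeta> k" using \<zeta>(2) by simp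
    then show "k < t" using \<open>j < t\<close> permutes_inj[OF \<zeta>(1)] by (auto dest: injD)
  qed (use \<zeta>(2) h in \<open>auto simp: bij_betw_def\<close>)
  \<comment> \<open>After relabelling by \<zeta>, row 1 contains exactly the indices that
    \<open>flip\<close> sends below t, which makes \<tau> well defined.\<close>
  have \<zeta>1: "\<zeta> k \<in> A 1 \<longleftrightarrow> k < q \<or> t \<le> k \<and> k < p" for k
  proof -
    have "\<zeta> k < p \<longleftrightarrow> k < p" using \<zeta>(1) by simp
    moreover have "\<zeta> k < q \<longleftrightarrow> k < q"
      using \<zeta>_q permutes_inj[OF \<zeta>(1)] by (metis injD)
    ultimately show ?thesis using A_iff[of "\<zeta> k"] \<zeta>0[of k] by auto
  qed
  have inv\<zeta>: "\<zeta> (inv \<zeta> k) = k" for k using permutes_inverses(1)[OF \<zeta>(1)] .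
  have inj_inv: "inv \<zeta> k = inv \<zeta> l \<longleftrightarrow> k = l" for k l by (metis inv\<zeta>)
  have flip_lt: "k < q \<or> t \<le> k \<and> k < p \<Longrightarrow> flip k < t" for k
    using u_less by (auto simp: flip_def)
  have flip_inj: "flip k = flip l \<longleftrightarrow> k = l" for k l by (metis flip_flip)
  define \<sigma> where "\<sigma> j = (if j < t then inv \<zeta> (z (0, j)) else j)" for j
  define \<tau> where "\<tau> j = (if j < t then flip (inv \<zeta> (z (1, j))) else j)" for j
  have perm: "g permutes {..<t}"
    if "\<And>j. j < t \<Longrightarrow> g j < t" "inj_on g {..<t}" "\<And>j. t \<le> j \<Longrightarrow> g j = j" for g
  proof (rule bij_imp_permutes)
    have "g ` {..<t} = {..<t}" using that(1,2) by (intro endo_inj_surj) auto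
    then show "bij_betw g {..<t} {..<t}" using that(2) by (simp add: bij_betw_def)
  qed (use that in auto)
  have "\<sigma> permutes {..<t}"
  proof (rule perm)
    show "\<sigma> j < t" if "j < t" for j
      using \<zeta>0[of "inv \<zeta> (z (0, j))"] that by (auto simp: \<sigma>_def inv\<zeta> A_def)
    show "inj_on \<sigma> {..<t}" using inj[of 0] by (auto simp: inj_on_def \<sigma>_def inj_inv)
  qed (simp add: \<sigma>_def)
  moreover have "\<tau> permutes {..<t}"
  proof (rule perm)
    show "\<tau> j < t" if "j < t" for j
      using \<zeta>1[of "inv \<zeta> (z (1, j))"] that flip_lt by (auto simp: \<tau>_def inv\<zeta> A_def)
    show "inj_on \<tau> {..<t}" using inj[of 1] by (auto simp: inj_on_def \<tau>_def inj_inv flip_inj)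
  qed (simp add: \<tau>_def)
  moreover have "\<forall>j<t. z (0, j) = \<zeta> (\<sigma> j) \<and> z (1, j) = \<zeta> (flip (\<tau> j))"
    by (simp add: \<sigma>_def \<tau>_def inv\<zeta> flip_flip)
  ultimately show "\<exists>\<zeta> \<sigma> \<tau>. \<zeta> permutes {..<p} \<and> (\<forall>i<q. \<zeta> i = i) \<and>
    \<sigma> permutes {..<t} \<and> \<tau> permutes {..<t} \<and>
    (\<forall>j<t. z (0, j) = \<zeta> (\<sigma> j) \<and> z (1, j) = \<zeta> (flip (\<tau> j)))"
    using \<zeta>(1) \<zeta>_q by blast
qed

text \<open>\<zeta> is undone by semi-invariance, \<sigma> and \<tau> by alternation in the rows.
  The resulting sign does not depend on \<open>f\<close>, so any two such functions are proportional
  on these arrays.\<close>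

lemma semi_invariant_normalize:
  assumes f: "f \<in> row_tensor 2 (\<lambda>_. ext_power s X t)" and inv: "semi_invariant f"
    and \<zeta>: "\<zeta> permutes {..<p}" "\<And>i. i < q \<Longrightarrow> \<zeta> i = i"
    and \<sigma>: "\<sigma> permutes {..<t}" and \<tau>: "\<tau> permutes {..<t}"
    and z: "\<And>j. j < t \<Longrightarrow> z (0, j) = \<zeta> (\<sigma> j) \<and> z (1, j) = \<zeta> (flip (\<tau> j))"
  shows "f (\<lambda>b. e (z b)) = of_int (sign (inv \<zeta>) * sign \<sigma> * sign \<tau>) * f corner"
proof -
  have ml: "multilinear ({..<2} \<times> {..<t}) f" using row_tensor_multilinear[OF f] by simp
  have inv\<zeta>: "inv \<zeta> permutes {..<p}" using permutes_inv[OF \<zeta>(1)] .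
  have inv\<zeta>m: "inv \<zeta> permutes {..<m}" using permutes_subset[OF inv\<zeta>] p_le_m by auto
  have \<zeta>_lt: "\<zeta> l < m" if "l < m" for l
    using permutes_subset[OF \<zeta>(1), of "{..<m}"] p_le_m that by auto
  obtain \<kappa> where \<kappa>: "\<kappa> \<in> \<Gamma>" "\<And>l x. l < m \<Longrightarrow> co l (\<kappa> x) = co (inv \<zeta> l) x"
    using \<Gamma>_permute[OF inv\<zeta>m] by blast
  have \<kappa>e: "\<kappa> (e l) = e (\<zeta> l)" if "l < m" for l
  proof (rule co_eqI)
    show "\<kappa> (e l) \<in> X" "e (\<zeta> l) \<in> X" using that \<Gamma>_in[OF \<kappa>(1)] e_in \<zeta>_lt by auto
    show "co k (\<kappa> (e l)) = co k (e (\<zeta> l))" if "k < m" for k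
      using that \<open>l < m\<close> \<zeta>_lt inv\<zeta>m permutes_inverses[OF \<zeta>(1)]
      by (auto simp: \<kappa>(2) co_e)
  qed
  have "inv \<zeta> i = i" if "i < q" for i using \<zeta> that permutes_inverses(2)[OF \<zeta>(1)] by metis
  then have "highest (\<kappa> \<circ> a) = of_int (sign (inv \<zeta>)) * highest a" for a
    using highest_permute[OF inv\<zeta>, of \<kappa>] \<kappa>(2) by blast
  then have f\<kappa>: "f (\<kappa> \<circ> a) = of_int (sign (inv \<zeta>)) * f a" for a
    using inv[unfolded semi_invariant_def] \<kappa>(1) by blast
  have perm: "f (replace_row i (r \<circ> \<rho>) a) = of_int (sign \<rho>) * f (replace_row i r a)"
    if "i < 2" "\<rho> permutes {..<t}" for i r \<rho> a
    by (rule ext_power_permute[OF row_tensor_row[OF f that(1)] that(2)])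
  \<comment> \<open>Rows other than 0 and 1 are filled as in \<open>corner\<close>, so that the
    arrays below are equal as functions and not merely on the boxes in use.\<close>
  define a where "a = (\<lambda>(i::nat, j). e (if i = 0 then \<sigma> j else flip (if i = 1 then \<tau> j else j)))"
  have "f (\<lambda>b. e (z b)) = f (\<kappa> \<circ> a)"
  proof (rule multilinear_cong[OF ml])
    fix b :: "nat \<times> nat" assume "b \<in> {..<2} \<times> {..<t}"
    then obtain i j where b: "b = (i, j)" "i = 0 \<or> i = 1" "j < t" by (auto simp: less_2_cases_iff)
    have "\<sigma> j < t" "\<tau> j < t" using \<sigma> \<tau> b(3) by auto
    moreover have "flip (\<tau> j) < p" using \<open>\<tau> j < t\<close> flip_permutes by simp
    ultimately show "e (z b) = (\<kappa> \<circ> a) b"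
      using b(2) z[OF b(3)] p_le_m t_le_m by (auto simp: b(1) a_def \<kappa>e)
  qed
  also have "\<dots> = of_int (sign (inv \<zeta>)) * f a" by (rule f\<kappa>)
  also have "a = replace_row 0 (e \<circ> \<sigma>) a" by (auto simp: a_def replace_row_def fun_eq_iff)
  also have "f \<dots> = of_int (sign \<sigma>) * f (replace_row 0 e a)" by (rule perm[OF _ \<sigma>]) simp
  also have "replace_row 0 e a = replace_row 1 ((e \<circ> flip) \<circ> \<tau>) corner"
    by (auto simp: a_def replace_row_def corner_def fun_eq_iff)
  also have "f \<dots> = of_int (sign \<tau>) * f (replace_row 1 (e \<circ> flip) corner)"
    by (rule perm[OF _ \<tau>]) simp
  also have "f (replace_row 1 (e \<circ> flip) corner) = f corner"
    by (rule multilinear_cong[OF ml]) (auto simp: replace_row_def corner_def less_2_cases_iff)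
  finally show ?thesis by (simp add: mult_ac)
qed

text \<open>At a basis array either both functions vanish, or \<open>normal_form\<close> applies to
  one of them and the array yields the same sign for both; multilinearity does the rest. The
  cross-multiplied form postpones division until the value at \<open>corner\<close> is known to be
  nonzero.\<close>

lemma semi_invariant_unique:
  assumes f: "f \<in> row_tensor d (\<lambda>_. ext_power s X t)" and inv: "semi_invariant f" and "f \<noteq> 0"
  shows "d = 2" and "f a * \<theta> highest corner = f corner * \<theta> highest a"
proof -
  let ?E = "\<lambda>d. row_tensor d (\<lambda>_. ext_power s X t)"
  have ml: "multilinear ({..<d} \<times> {..<t}) f" using row_tensor_multilinear[OF f] by simp
  have "\<exists>z. (\<forall>b \<in> {..<d} \<times> {..<t}. z b < m) \<and> f (\<lambda>b. e (z b)) \<noteq> 0"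
  proof (rule ccontr)
    assume "\<not> ?thesis"
    then have "f = 0"
      using fs.subspace_0[OF multilinear_subspace, of "{..<d} \<times> {..<t}"]
      by (intro multilinear_eqI[OF ml]) auto
    then show False using assms(3) by simp
  qed
  then show d: "d = 2"
  proof (elim exE conjE)
    fix z assume "\<forall>b\<in>{..<d} \<times> {..<t}. z b < m" "f (\<lambda>b. e (z b)) \<noteq> 0"
    then show "d = 2" by (intro normal_form(1)[OF f inv, of z]) (rule bspec)
  qed
  let ?g = "\<theta> highest"
  have g: "?g \<in> ?E 2" by (intro \<theta>_in_row_tensor schur_multilinear highest_in_schur)
  have f2: "f \<in> ?E 2" using f d by simp
  have mlf: "multilinear ({..<2} \<times> {..<t}) f" and mlg: "multilinear ({..<2} \<times> {..<t}) ?g"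
    using row_tensor_multilinear[OF f2] row_tensor_multilinear[OF g] by simp_all
  have "fscale (?g corner) f = fscale (f corner) ?g"
  proof (rule multilinear_eqI)
    show "multilinear ({..<2} \<times> {..<t}) (fscale (?g corner) f)"
      "multilinear ({..<2} \<times> {..<t}) (fscale (f corner) ?g)"
      by (intro multilinear_fscale mlf mlg)+
  next
    fix z :: "nat \<times> nat \<Rightarrow> nat"
    assume z: "\<And>b. b \<in> {..<2} \<times> {..<t} \<Longrightarrow> z b < m"
    let ?a = "\<lambda>b. e (z b)"
    show "fscale (?g corner) f ?a = fscale (f corner) ?g ?a"
    proof (cases "f ?a = 0 \<and> ?g ?a = 0")
      case False
      then have "f ?a \<noteq> 0 \<or> ?g ?a \<noteq> 0" by blast
      then have "\<exists>\<zeta> \<sigma> \<tau>. \<zeta> permutes {..<p} \<and> (\<forall>i<q. \<zeta> i = i) \<and>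
        \<sigma> permutes {..<t} \<and> \<tau> permutes {..<t} \<and>
        (\<forall>j<t. z (0, j) = \<zeta> (\<sigma> j) \<and> z (1, j) = \<zeta> (flip (\<tau> j)))"
        by (rule disjE) (rule normal_form(2)[OF f2 inv z], assumption+,
            rule normal_form(2)[OF g semi_invariant_\<theta> z], assumption+)
      then obtain \<zeta> \<sigma> \<tau> where *: "\<zeta> permutes {..<p}" "\<And>i. i < q \<Longrightarrow> \<zeta> i = i"
        "\<sigma> permutes {..<t}" "\<tau> permutes {..<t}"
        "\<And>j. j < t \<Longrightarrow> z (0, j) = \<zeta> (\<sigma> j) \<and> z (1, j) = \<zeta> (flip (\<tau> j))" by blast
      show ?thesis
        using semi_invariant_normalize[OF f2 inv *] semi_invariant_normalize[OF g semi_invariant_\<theta> *]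
        by simp
    qed simp
  qed simp
  from fun_cong[OF this, of a] show "f a * ?g corner = f corner * ?g a" by (simp add: mult_ac)
qed

end


section \<open>The multiplicity of a two-row diagram\<close>

lemma vector_space_maps:
  "vector_space (\<lambda>c \<Phi> x. fscale (c :: 'k::field) (\<Phi> x :: 'q \<Rightarrow> 'k))"
  by unfold_locales (simp_all add: fun_eq_iff algebra_simps)

text \<open>Freezing one argument of a tensor leaves an element of the other factor, so results
  about one factor can be applied to each variable separately.\<close>

lemma tensor_section1:
  assumes "F \<in> tensor A B" and "fs.subspace A"
  shows "(\<lambda>a. F (a, b)) \<in> A"
  using assms(1) unfolding tensor_def
proof (induction rule: fs.span_induct_alt)
  case base
  show ?case using fs.subspace_0[OF assms(2)] by (simp add: zero_fun_def)
next
  case (step c x y)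
  then obtain f g where "x = (\<lambda>(p, q). f p * g q)" and f: "f \<in> A" by blast
  then have "(\<lambda>a. (fscale c x + y) (a, b)) = fscale (c * g b) f + (\<lambda>a. y (a, b))"
    by (intro ext) simp
  then show ?case
    using fs.subspace_add[OF assms(2) fs.subspace_scale[OF assms(2) f] step.IH] by (simp only:)
qed

lemma tensor_section2:
  assumes "F \<in> tensor A B" and "fs.subspace B"
  shows "(\<lambda>b. F (a, b)) \<in> B"
  using assms(1) unfolding tensor_def
proof (induction rule: fs.span_induct_alt)
  case base
  show ?case using fs.subspace_0[OF assms(2)] by (simp add: zero_fun_def)
next
  case (step c x y)
  then obtain f g where "x = (\<lambda>(p, q). f p * g q)" and g: "g \<in> B" by blast
  then have "(\<lambda>b. (fscale c x + y) (a, b)) = fscale (c * f a) g + (\<lambda>b. y (a, b))"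
    by (intro ext) simp
  then show ?case
    using fs.subspace_add[OF assms(2) fs.subspace_scale[OF assms(2) g] step.IH] by (simp only:)
qed

lemma pure_in_tensor:
  "f \<in> A \<Longrightarrow> g \<in> B \<Longrightarrow> (\<lambda>(a, b). f a * g b) \<in> tensor A B"
  unfolding tensor_def by (intro fs.span_base) blast

lemma row_tensor_subspace: "fs.subspace (row_tensor d M)"
  by (simp add: row_tensor_def)

lemma tensor_subspace: "fs.subspace (tensor A B)"
  by (simp add: tensor_def)

text \<open>\<open>G\<close> is a mere index set that acts through pairs of maps;
  \<open>\<kappa>_ex\<close> says that every pair from \<Gamma> and \<Gamma>' occurs, so either
  factor can be moved while the other is kept fixed.\<close>

locale two_row_pair =
  A: two_row_space s X m e co \<Gamma> t u + B: two_row_space s' Y n e' co' \<Gamma>' t u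
  for s :: "'k::field_char_0 \<Rightarrow> 'x::ab_group_add \<Rightarrow> 'x" and X m e co \<Gamma>
    and s' :: "'k \<Rightarrow> 'y::ab_group_add \<Rightarrow> 'y" and Y n e' co' \<Gamma>' and t u :: nat +
  fixes G :: "'g set" and \<kappa>1 :: "'g \<Rightarrow> 'x \<Rightarrow> 'x" and \<kappa>2 :: "'g \<Rightarrow> 'y \<Rightarrow> 'y"
  assumes \<kappa>_in: "x \<in> G \<Longrightarrow> \<kappa>1 x \<in> \<Gamma> \<and> \<kappa>2 x \<in> \<Gamma>'"
    and \<kappa>_ex: "\<kappa> \<in> \<Gamma> \<Longrightarrow> \<kappa>' \<in> \<Gamma>' \<Longrightarrow> \<exists>x\<in>G. \<kappa>1 x = \<kappa> \<and> \<kappa>2 x = \<kappa>'"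
begin

abbreviation "L \<equiv> tensor (schur s X (two_row t u)) (schur s' Y (two_row t u))"
abbreviation "T_part d \<equiv> tensor (row_tensor d (\<lambda>_. ext_power s X t)) (row_tensor d (\<lambda>_. ext_power s' Y t))"
abbreviation "T \<equiv> direct_sum T_part"

definition \<rho> :: "'g \<Rightarrow> ((nat \<times> nat \<Rightarrow> 'x) \<times> (nat \<times> nat \<Rightarrow> 'y) \<Rightarrow> 'k) \<Rightarrow>
    (nat \<times> nat \<Rightarrow> 'x) \<times> (nat \<times> nat \<Rightarrow> 'y) \<Rightarrow> 'k" where
  "\<rho> x F = (\<lambda>(a, b). F (\<kappa>1 x \<circ> a, \<kappa>2 x \<circ> b))"

definition \<rho>_graded :: "'g \<Rightarrow> (nat \<times> (nat \<times> nat \<Rightarrow> 'x) \<times> (nat \<times> nat \<Rightarrow> 'y) \<Rightarrow> 'k) \<Rightarrow>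
    nat \<times> (nat \<times> nat \<Rightarrow> 'x) \<times> (nat \<times> nat \<Rightarrow> 'y) \<Rightarrow> 'k" where
  "\<rho>_graded x F = (\<lambda>(d, p). \<rho> x (\<lambda>q. F (d, q)) p)"

definition generator :: "(nat \<times> nat \<Rightarrow> 'x) \<times> (nat \<times> nat \<Rightarrow> 'y) \<Rightarrow> 'k" where
  "generator = (\<lambda>(a, b). A.highest a * B.highest b)"

lemma \<rho>_linear: "\<rho> x (fscale c F + H) = fscale c (\<rho> x F) + \<rho> x H"
  by (auto simp: \<rho>_def fun_eq_iff)

lemma \<rho>_generator: "\<rho> x generator = (\<lambda>(a, b). A.highest (\<kappa>1 x \<circ> a) * B.highest (\<kappa>2 x \<circ> b))"
  by (simp add: \<rho>_def generator_def)

lemma \<rho>_generator_in: "x \<in> G \<Longrightarrow> \<rho> x generator \<in> L"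
  unfolding \<rho>_generator using \<kappa>_in
  by (intro pure_in_tensor A.highest_\<Gamma>_in_schur B.highest_\<Gamma>_in_schur) auto

lemma generator_in: "generator \<in> L"
  unfolding generator_def by (intro pure_in_tensor A.highest_in_schur B.highest_in_schur)

text \<open>Bilinearity, one factor at a time: the first function ranges over the span while the
  second is a single translate, and then the second is released as well.\<close>

lemma L_span: "L = fs.span ((\<lambda>x. \<rho> x generator) ` G)" (is "_ = ?S")
proof
  have 1: "(\<lambda>(a, b). f a * B.highest (\<kappa>' \<circ> b)) \<in> ?S" if f: "f \<in> A.translates" and \<kappa>': "\<kappa>' \<in> \<Gamma>'" for f \<kappa>'
    using f unfolding A.translates_def
  proof (induction rule: fs.span_induct_alt)
    case base
    have "(\<lambda>(a, b). (0 :: (nat \<times> nat \<Rightarrow> 'x) \<Rightarrow> 'k) a * B.highest (\<kappa>' \<circ> b)) = 0"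
      by (auto simp: fun_eq_iff)
    then show ?case using fs.span_zero by metis
  next
    case (step c f g)
    then obtain \<kappa> where \<kappa>: "\<kappa> \<in> \<Gamma>" "f = (\<lambda>a. A.highest (\<kappa> \<circ> a))" by blast
    obtain x where "x \<in> G" "\<kappa>1 x = \<kappa>" "\<kappa>2 x = \<kappa>'" using \<kappa>_ex[OF \<kappa>(1) \<kappa>'] by blast
    then have "(\<lambda>(a, b). f a * B.highest (\<kappa>' \<circ> b)) \<in> ?S"
      by (intro fs.span_base image_eqI[of _ _ x]) (simp_all add: \<rho>_generator \<kappa>(2))
    moreover have "(\<lambda>(a, b). (fscale c f + g) a * B.highest (\<kappa>' \<circ> b)) =
        fscale c (\<lambda>(a, b). f a * B.highest (\<kappa>' \<circ> b)) + (\<lambda>(a, b). g a * B.highest (\<kappa>' \<circ> b))"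
      by (auto simp: fun_eq_iff algebra_simps)
    ultimately show ?case using step.IH fs.span_add[OF fs.span_scale] by metis
  qed
  have 2: "(\<lambda>(a, b). f a * g b) \<in> ?S" if f: "f \<in> A.translates" and g: "g \<in> B.translates" for f g
    using g unfolding B.translates_def
  proof (induction rule: fs.span_induct_alt)
    case base
    have "(\<lambda>(a, b). f a * (0 :: (nat \<times> nat \<Rightarrow> 'y) \<Rightarrow> 'k) b) = 0"
      by (auto simp: fun_eq_iff)
    then show ?case using fs.span_zero by metis
  next
    case (step c g h)
    then obtain \<kappa>' where "\<kappa>' \<in> \<Gamma>'" "g = (\<lambda>a. B.highest (\<kappa>' \<circ> a))" by blast
    then have "(\<lambda>(a, b). f a * g b) \<in> ?S" using 1[OF f] by simp
    moreover have "(\<lambda>(a, b). f a * (fscale c g + h) b) =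
        fscale c (\<lambda>(a, b). f a * g b) + (\<lambda>(a, b). f a * h b)"
      by (auto simp: fun_eq_iff algebra_simps)
    ultimately show ?case using step.IH fs.span_add[OF fs.span_scale] by metis
  qed
  show "L \<subseteq> ?S"
    unfolding tensor_def
  proof (rule fs.span_minimal)
    show "{\<lambda>(p, q). f p * g q | f g. f \<in> schur s X (two_row t u) \<and> g \<in> schur s' Y (two_row t u)} \<subseteq> ?S"
      using 2 A.schur_subset_translates B.schur_subset_translates by blast
  qed simp
  show "?S \<subseteq> L"
    by (rule fs.span_minimal[OF _ tensor_subspace]) (use \<rho>_generator_in in blast)
qed

lemma \<rho>_comp_generator:
  assumes "x \<in> G" "y \<in> G"
  shows "\<exists>z\<in>G. \<rho> x (\<rho> y generator) = \<rho> z generator"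
proof -
  \<comment> \<open>The action is on the arguments, hence the reversed order of composition.\<close>
  obtain z where "z \<in> G" "\<kappa>1 z = \<kappa>1 y \<circ> \<kappa>1 x" "\<kappa>2 z = \<kappa>2 y \<circ> \<kappa>2 x"
    using \<kappa>_ex[OF A.\<Gamma>_comp B.\<Gamma>_comp] \<kappa>_in assms by metis
  then show ?thesis by (intro bexI[of _ z]) (simp_all add: \<rho>_def comp_assoc)
qed

lemma L_induct [consumes 1, case_names zero step]:
  assumes "F \<in> L" and "P 0"
    and "\<And>c x F. x \<in> G \<Longrightarrow> F \<in> L \<Longrightarrow> P F \<Longrightarrow> P (fscale c (\<rho> x generator) + F)"
  shows "P F"
proof -
  have "F \<in> fs.span ((\<lambda>x. \<rho> x generator) ` G)" using assms(1) by (simp only: L_span)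
  then have "F \<in> L \<and> P F"
  proof (induction rule: fs.span_induct_alt)
    case base
    show ?case using assms(2) fs.subspace_0[OF tensor_subspace] by blast
  next
    case (step c y F)
    then obtain x where x: "x \<in> G" "y = \<rho> x generator" by blast
    then have "fscale c y + F \<in> L"
      using step.IH \<rho>_generator_in fs.subspace_add[OF tensor_subspace fs.subspace_scale[OF tensor_subspace]] by blast
    then show ?case using assms(3) x step.IH by blast
  qed
  then show ?thesis by blast
qed

lemma \<rho>_in:
  assumes "F \<in> L" and x: "x \<in> G"
  shows "\<rho> x F \<in> L"
  using assms(1)
proof (induction rule: L_induct)
  case zero
  have "\<rho> x 0 = 0" by (auto simp: \<rho>_def fun_eq_iff)
  then show ?case using fs.subspace_0[OF tensor_subspace] by metis
next
  case (step c y F)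
  obtain z where "z \<in> G" "\<rho> x (\<rho> y generator) = \<rho> z generator"
    using \<rho>_comp_generator[OF x step.hyps(1)] by blast
  then show ?case
    unfolding \<rho>_linear
    using step.IH \<rho>_generator_in fs.subspace_add[OF tensor_subspace fs.subspace_scale[OF tensor_subspace]] by metis
qed

definition \<Theta> :: "((nat \<times> nat \<Rightarrow> 'x) \<times> (nat \<times> nat \<Rightarrow> 'y) \<Rightarrow> 'k) \<Rightarrow>
    nat \<times> (nat \<times> nat \<Rightarrow> 'x) \<times> (nat \<times> nat \<Rightarrow> 'y) \<Rightarrow> 'k" where
  "\<Theta> F = (\<lambda>(d, a, b). if d = 2 then A.\<theta> (\<lambda>a'. B.\<theta> (\<lambda>b'. F (a', b')) b) a else 0)"

lemma \<Theta>_linear: "\<Theta> (fscale c F + H) = fscale c (\<Theta> F) + \<Theta> H"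
proof -
  have B: "B.\<theta> (\<lambda>b'. c * F (a', b') + H (a', b')) b =
      c * B.\<theta> (\<lambda>b'. F (a', b')) b + B.\<theta> (\<lambda>b'. H (a', b')) b" for a' b
  proof -
    have "(\<lambda>b'. c * F (a', b') + H (a', b')) = fscale c (\<lambda>b'. F (a', b')) + (\<lambda>b'. H (a', b'))"
      by (simp add: fun_eq_iff)
    then show ?thesis by (simp only: B.\<theta>_add B.\<theta>_scale plus_fun_apply fscale_apply)
  qed
  have A: "A.\<theta> (\<lambda>a'. c * f a' + h a') a = c * A.\<theta> f a + A.\<theta> h a" for f h a
  proof -
    have "(\<lambda>a'. c * f a' + h a') = fscale c f + h" by (simp add: fun_eq_iff)
    then show ?thesis by (simp only: A.\<theta>_add A.\<theta>_scale plus_fun_apply fscale_apply)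
  qed
  show ?thesis by (auto simp: \<Theta>_def fun_eq_iff A B)
qed

lemma \<Theta>_equivariant: "\<Theta> (\<rho> x F) = \<rho>_graded x (\<Theta> F)"
  by (auto simp: \<Theta>_def \<rho>_def \<rho>_graded_def fun_eq_iff A.\<theta>_comp B.\<theta>_comp)

lemma \<Theta>_pure: "\<Theta> (\<lambda>(a, b). f a * g b) (d, a, b) = (if d = 2 then A.\<theta> f a * B.\<theta> g b else 0)"
proof -
  have "B.\<theta> (\<lambda>b'. r * g b') b = r * B.\<theta> g b" for r
    using fun_cong[OF B.\<theta>_scale[of r g], of b] by (simp add: fscale_def)
  moreover have "A.\<theta> (\<lambda>a'. f a' * r) a = A.\<theta> f a * r" for r
    using fun_cong[OF A.\<theta>_scale[of r f], of a] by (simp add: fscale_def mult.commute)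
  ultimately show ?thesis by (simp add: \<Theta>_def)
qed

lemma T_subspace: "fs.subspace T"
proof (rule fs.subspaceI)
  show "0 \<in> T"
    by (simp add: direct_sum_def fs.subspace_0[OF tensor_subspace, unfolded zero_fun_def])
next
  fix F H assume F: "F \<in> T" and H: "H \<in> T"
  have "(\<lambda>p. (F + H) (d, p)) \<in> T_part d" for d
  proof -
    have "(\<lambda>p. F (d, p)) + (\<lambda>p. H (d, p)) \<in> T_part d"
      by (rule fs.subspace_add[OF tensor_subspace]) (use F H in \<open>simp_all add: direct_sum_def\<close>)
    then show ?thesis by (simp add: plus_fun_def)
  qed
  moreover have "finite {d. \<exists>p. (F + H) (d, p) \<noteq> 0}"
    by (rule finite_subset[of _ "{d. \<exists>p. F (d, p) \<noteq> 0} \<union> {d. \<exists>p. H (d, p) \<noteq> 0}"])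
      (use F H in \<open>auto simp: direct_sum_def simp del: split_paired_Ex split_paired_All\<close>)
  ultimately show "F + H \<in> T"
    unfolding direct_sum_def by blast
next
  fix F c assume F: "F \<in> T"
  have "(\<lambda>p. (fscale c F) (d, p)) \<in> T_part d" for d
  proof -
    have "fscale c (\<lambda>p. F (d, p)) \<in> T_part d"
      by (rule fs.subspace_scale[OF tensor_subspace]) (use F in \<open>simp add: direct_sum_def\<close>)
    then show ?thesis by (simp add: fscale_def)
  qed
  moreover have "finite {d. \<exists>p. (fscale c F) (d, p) \<noteq> 0}"
    by (rule finite_subset[of _ "{d. \<exists>p. F (d, p) \<noteq> 0}"])
      (use F in \<open>auto simp: direct_sum_def simp del: split_paired_Ex split_paired_All\<close>)
  ultimately show "fscale c F \<in> T"
    unfolding direct_sum_def by blast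
qed

lemma \<Theta>_generator_in: "x \<in> G \<Longrightarrow> \<Theta> (\<rho> x generator) \<in> T"
proof -
  assume x: "x \<in> G"
  let ?f = "\<lambda>a. A.highest (\<kappa>1 x \<circ> a)" and ?g = "\<lambda>b. B.highest (\<kappa>2 x \<circ> b)"
  have val: "\<Theta> (\<rho> x generator) (d, p) = (if d = 2 then (\<lambda>(a, b). A.\<theta> ?f a * B.\<theta> ?g b) p else 0)" for d p
    unfolding \<rho>_generator by (cases p) (simp only: \<Theta>_pure prod.case)
  have "A.\<theta> ?f \<in> row_tensor 2 (\<lambda>_. ext_power s X t)" "B.\<theta> ?g \<in> row_tensor 2 (\<lambda>_. ext_power s' Y t)"
    using \<kappa>_in[OF x] by (simp_all add: A.\<theta>_in_row_tensor A.schur_multilinear A.highest_\<Gamma>_in_schur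
        B.\<theta>_in_row_tensor B.schur_multilinear B.highest_\<Gamma>_in_schur)
  then have 2: "(\<lambda>(a, b). A.\<theta> ?f a * B.\<theta> ?g b) \<in> T_part 2" by (rule pure_in_tensor)
  have "(\<lambda>p. \<Theta> (\<rho> x generator) (d, p)) \<in> T_part d" for d
  proof (cases "d = 2")
    case True
    then have "(\<lambda>p. \<Theta> (\<rho> x generator) (d, p)) = (\<lambda>(a, b). A.\<theta> ?f a * B.\<theta> ?g b)"
      by (intro ext) (simp only: val if_True refl)
    then show ?thesis using 2 True by (simp only:)
  next
    case False
    then have "(\<lambda>p. \<Theta> (\<rho> x generator) (d, p)) = 0" by (intro ext) (simp only: val if_False zero_fun_apply)
    then show ?thesis using fs.subspace_0[OF tensor_subspace] by metis
  qed
  moreover have "finite {d. \<exists>p. \<Theta> (\<rho> x generator) (d, p) \<noteq> 0}"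
    by (rule finite_subset[of _ "{2}"]) (auto simp: val split: if_splits)
  ultimately show ?thesis unfolding direct_sum_def by blast
qed

lemma \<Theta>_in: "F \<in> L \<Longrightarrow> \<Theta> F \<in> T"
proof (induction rule: L_induct)
  case zero
  have "\<Theta> 0 = 0" using \<Theta>_linear[of "-1" 0 0] by (simp add: fun_eq_iff)
  then show ?case using fs.subspace_0[OF T_subspace] by metis
next
  case (step c x F)
  then show ?case
    unfolding \<Theta>_linear
    by (intro fs.subspace_add[OF T_subspace] fs.subspace_scale[OF T_subspace] \<Theta>_generator_in)
qed

text \<open>Homomorphisms are represented by their extensions by 0 outside \<open>L\<close>, so
  \<Theta> has to be cut off there.\<close>

definition \<Theta>\<^sub>0 where "\<Theta>\<^sub>0 F = (if F \<in> L then \<Theta> F else 0)"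

lemma \<Theta>\<^sub>0_hom: "\<Theta>\<^sub>0 \<in> equivariant_homs G \<rho> L \<rho>_graded T"
proof -
  have add: "\<Theta> (F + H) = \<Theta> F + \<Theta> H" for F H using \<Theta>_linear[of 1 F H] by simp
  have scale: "\<Theta> (fscale c F) = fscale c (\<Theta> F)" for c F
  proof -
    have "\<Theta> 0 = 0" using \<Theta>_linear[of "-1" 0 0] by (simp add: fun_eq_iff)
    then show ?thesis using \<Theta>_linear[of c F 0] by (metis add.right_neutral)
  qed
  show ?thesis
    unfolding equivariant_homs_def mem_Collect_eq \<Theta>\<^sub>0_def
  proof (intro conjI allI ballI impI)
    fix F H assume "F \<in> L" "H \<in> L"
    then show "(if F + H \<in> L then \<Theta> (F + H) else 0) =
        (if F \<in> L then \<Theta> F else 0) + (if H \<in> L then \<Theta> H else 0)"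
      by (simp only: fs.subspace_add[OF tensor_subspace] if_True add)
  next
    fix c F assume "F \<in> L"
    then show "(if fscale c F \<in> L then \<Theta> (fscale c F) else 0) = fscale c (if F \<in> L then \<Theta> F else 0)"
      by (simp only: fs.subspace_scale[OF tensor_subspace] if_True scale)
  next
    fix x F assume "x \<in> G" "F \<in> L"
    then show "(if \<rho> x F \<in> L then \<Theta> (\<rho> x F) else 0) = \<rho>_graded x (if F \<in> L then \<Theta> F else 0)"
      by (simp only: \<rho>_in if_True \<Theta>_equivariant)
  qed (simp_all only: if_True if_False \<Theta>_in)
qed

lemma \<Theta>_generator: "\<Theta> generator (d, a, b) = (if d = 2 then A.\<theta> A.highest a * B.\<theta> B.highest b else 0)"
  unfolding generator_def by (rule \<Theta>_pure)

text \<open>Elements of \<open>G\<close> acting on one factor only show that the image of the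
  generator is semi-invariant in each variable with the other one frozen. Uniqueness then applies
  twice and also removes every degree except 2.\<close>

lemma hom_generator:
  assumes \<Phi>: "\<Phi> \<in> equivariant_homs G \<rho> L \<rho>_graded T"
  shows "\<exists>c. \<Phi> generator = fscale c (\<Theta> generator)"
proof -
  let ?F = "\<Phi> generator"
  have F: "?F \<in> T" using \<Phi> generator_in by (simp add: equivariant_homs_def)
  have F_part: "(\<lambda>p. ?F (d, p)) \<in> T_part d" for d using F by (simp add: direct_sum_def)
  have semi: "?F (d, \<kappa>1 x \<circ> a, \<kappa>2 x \<circ> b) = \<chi> * ?F (d, a, b)"
    if "x \<in> G" "\<rho> x generator = fscale \<chi> generator" for x \<chi> d a b
  proof -
    have "\<rho>_graded x ?F = \<Phi> (\<rho> x generator)" "\<Phi> (fscale \<chi> generator) = fscale \<chi> ?F"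
      using \<Phi> generator_in that(1) by (simp_all add: equivariant_homs_def)
    then have "\<rho>_graded x ?F = fscale \<chi> ?F" by (simp only: that(2))
    from fun_cong[OF this, of "(d, a, b)"] show ?thesis by (simp add: \<rho>_graded_def \<rho>_def)
  qed
  have semiA: "A.semi_invariant (\<lambda>a. ?F (d, a, b))" for d b
    unfolding A.semi_invariant_def
  proof (intro ballI allI impI)
    fix \<kappa> \<chi> a assume \<kappa>: "\<kappa> \<in> \<Gamma>" "\<forall>a. A.highest (\<kappa> \<circ> a) = \<chi> * A.highest a"
    obtain x where x: "x \<in> G" "\<kappa>1 x = \<kappa>" "\<kappa>2 x = id" using \<kappa>_ex[OF \<kappa>(1) B.\<Gamma>_id] by blast
    have "\<rho> x generator = fscale \<chi> generator"
      unfolding \<rho>_generator x(2,3)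
      by (rule ext) (simp add: generator_def case_prod_unfold \<kappa>(2)[rule_format] mult_ac)
    from semi[OF x(1) this, of d a b] show "?F (d, \<kappa> \<circ> a, b) = \<chi> * ?F (d, a, b)" using x by simp
  qed
  have semiB: "B.semi_invariant (\<lambda>b. ?F (d, a, b))" for d a
    unfolding B.semi_invariant_def
  proof (intro ballI allI impI)
    fix \<kappa> \<chi> b assume \<kappa>: "\<kappa> \<in> \<Gamma>'" "\<forall>a. B.highest (\<kappa> \<circ> a) = \<chi> * B.highest a"
    obtain x where x: "x \<in> G" "\<kappa>1 x = id" "\<kappa>2 x = \<kappa>" using \<kappa>_ex[OF A.\<Gamma>_id \<kappa>(1)] by blast
    have "\<rho> x generator = fscale \<chi> generator"
      unfolding \<rho>_generator x(2,3)
      by (rule ext) (simp add: generator_def case_prod_unfold \<kappa>(2)[rule_format] mult_ac)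
    from semi[OF x(1) this, of d a b] show "?F (d, a, \<kappa> \<circ> b) = \<chi> * ?F (d, a, b)" using x by simp
  qed
  let ?K = "A.\<theta> A.highest A.corner" and ?K' = "B.\<theta> B.highest B.corner"
  have secA: "(\<lambda>a. ?F (d, a, b)) \<in> row_tensor d (\<lambda>_. ext_power s X t)" for d b
    using tensor_section1[OF F_part row_tensor_subspace] .
  have secB: "(\<lambda>b. ?F (d, a, b)) \<in> row_tensor d (\<lambda>_. ext_power s' Y t)" for d a
    using tensor_section2[OF F_part row_tensor_subspace] .
  have zero: "?F (d, a, b) = 0" if "d \<noteq> 2" for d a b
  proof (rule ccontr)
    assume "?F (d, a, b) \<noteq> 0"
    then have "(\<lambda>a. ?F (d, a, b)) \<noteq> 0" by (metis zero_fun_apply)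
    then show False using A.semi_invariant_unique(1)[OF secA semiA] that by blast
  qed
  have two_A: "?F (2, a, b) * ?K = ?F (2, A.corner, b) * A.\<theta> A.highest a" for a b
  proof (cases "(\<lambda>a. ?F (2, a, b)) = 0")
    case True
    then have "?F (2, a, b) = 0" for a by (metis zero_fun_apply)
    then show ?thesis by simp
  next
    case False
    then show ?thesis using A.semi_invariant_unique(2)[OF secA semiA] by blast
  qed
  have two_B: "?F (2, a, b) * ?K' = ?F (2, a, B.corner) * B.\<theta> B.highest b" for a b
  proof (cases "(\<lambda>b. ?F (2, a, b)) = 0")
    case True
    then have "?F (2, a, b) = 0" for b by (metis zero_fun_apply)
    then show ?thesis by simp
  next
    case False
    then show ?thesis using B.semi_invariant_unique(2)[OF secB semiB] by blast
  qed
  have K: "?K \<noteq> 0" "?K' \<noteq> 0" by (rule A.\<theta>_highest_nonzero) (rule B.\<theta>_highest_nonzero)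
  \<comment> \<open>The constant is read off at the two corners, where the image of the generator
    under \<Theta> is nonzero.\<close>
  let ?c = "?F (2, A.corner, B.corner) / (?K * ?K')"
  have val: "?F (d, a, b) = ?c * \<Theta> generator (d, a, b)" for d a b
  proof (cases "d = 2")
    case True
    have "?F (2, a, b) * ?K * ?K' = ?F (2, A.corner, b) * ?K' * A.\<theta> A.highest a"
      unfolding two_A by simp
    also have "\<dots> = ?F (2, A.corner, B.corner) * B.\<theta> B.highest b * A.\<theta> A.highest a"
      unfolding two_B ..
    finally show ?thesis using K True by (simp add: \<Theta>_generator field_simps)
  next
    case False
    then show ?thesis by (simp add: \<Theta>_generator zero)
  qed
  have "?F = fscale ?c (\<Theta> generator)"
  proof
    fix z :: "nat \<times> (nat \<times> nat \<Rightarrow> 'x) \<times> (nat \<times> nat \<Rightarrow> 'y)"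
    obtain d a b where z: "z = (d, a, b)" by (cases z)
    show "?F z = fscale ?c (\<Theta> generator) z" unfolding z fscale_apply by (rule val)
  qed
  then show ?thesis by blast
qed

lemma dim_equivariant_homs:
  "vector_space.dim (\<lambda>c \<Phi> x. fscale c (\<Phi> x)) (equivariant_homs G \<rho> L \<rho>_graded T) = 1"
proof -
  let ?sc = "\<lambda>(c::'k) (\<Phi> :: ((nat \<times> nat \<Rightarrow> 'x) \<times> (nat \<times> nat \<Rightarrow> 'y) \<Rightarrow> 'k) \<Rightarrow>
    nat \<times> (nat \<times> nat \<Rightarrow> 'x) \<times> (nat \<times> nat \<Rightarrow> 'y) \<Rightarrow> 'k) x. fscale c (\<Phi> x)"
  interpret M: vector_space ?sc by (rule vector_space_maps)
  have nz: "\<Theta>\<^sub>0 \<noteq> 0"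
  proof
    assume "\<Theta>\<^sub>0 = 0"
    then have "\<Theta>\<^sub>0 generator (2, A.corner, B.corner) = 0" by simp
    then show False
      using A.\<theta>_highest_nonzero B.\<theta>_highest_nonzero by (simp add: \<Theta>\<^sub>0_def generator_in \<Theta>_generator)
  qed
  have "equivariant_homs G \<rho> L \<rho>_graded T \<subseteq> M.span {\<Theta>\<^sub>0}"
  proof
    fix \<Phi> assume \<Phi>: "\<Phi> \<in> equivariant_homs G \<rho> L \<rho>_graded T"
    obtain c where c: "\<Phi> generator = fscale c (\<Theta> generator)" using hom_generator[OF \<Phi>] by blast
    have add: "\<And>F H. F \<in> L \<Longrightarrow> H \<in> L \<Longrightarrow> \<Phi> (F + H) = \<Phi> F + \<Phi> H"
      and scale: "\<And>r F. F \<in> L \<Longrightarrow> \<Phi> (fscale r F) = fscale r (\<Phi> F)"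
      and equi: "\<And>x F. x \<in> G \<Longrightarrow> F \<in> L \<Longrightarrow> \<Phi> (\<rho> x F) = \<rho>_graded x (\<Phi> F)"
      and out: "\<And>F. F \<notin> L \<Longrightarrow> \<Phi> F = 0"
      using \<Phi> unfolding equivariant_homs_def by blast+
    have "\<Phi> F = fscale c (\<Theta> F)" if "F \<in> L" for F
      using that
    proof (induction rule: L_induct)
      case zero
      have 0: "(0 :: (nat \<times> nat \<Rightarrow> 'x) \<times> (nat \<times> nat \<Rightarrow> 'y) \<Rightarrow> 'k) \<in> L" by (rule fs.subspace_0[OF tensor_subspace])
      have "\<Phi> 0 = 0" using scale[OF 0, of 0] by (metis fs.scale_zero_left)
      moreover have "\<Theta> 0 = 0" using \<Theta>_linear[of "-1" 0 0] by (simp add: fun_eq_iff)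
      ultimately show ?case by (metis fs.scale_zero_right)
    next
      case (step r x F)
      have gen: "\<rho> x generator \<in> L" using step.hyps(1) by (rule \<rho>_generator_in)
      have "\<Phi> (\<rho> x generator) = \<rho>_graded x (fscale c (\<Theta> generator))"
        using equi[OF step.hyps(1) generator_in] c by simp
      also have "\<dots> = fscale c (\<Theta> (\<rho> x generator))"
        unfolding \<Theta>_equivariant by (auto simp: \<rho>_graded_def \<rho>_def fun_eq_iff)
      finally have g: "\<Phi> (\<rho> x generator) = fscale c (\<Theta> (\<rho> x generator))" .
      have "\<Phi> (fscale r (\<rho> x generator) + F) = fscale r (\<Phi> (\<rho> x generator)) + \<Phi> F"
        using add[OF fs.subspace_scale[OF tensor_subspace gen] step.hyps(2)] scale[OF gen] by simp
      also have "\<dots> = fscale c (\<Theta> (fscale r (\<rho> x generator) + F))"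
        unfolding g step.IH \<Theta>_linear by (simp add: fun_eq_iff algebra_simps)
      finally show ?case .
    qed
    then have "\<Phi> F = fscale c (\<Theta>\<^sub>0 F)" for F
      using out[of F] by (cases "F \<in> L") (auto simp: \<Theta>\<^sub>0_def)
    then have "\<Phi> = ?sc c \<Theta>\<^sub>0" by blast
    then show "\<Phi> \<in> M.span {\<Theta>\<^sub>0}" using M.span_scale[OF M.span_base[of \<Theta>\<^sub>0 "{\<Theta>\<^sub>0}"]] by blast
  qed
  then show ?thesis
    using \<Theta>\<^sub>0_hom nz by (intro M.dim_unique[of "{\<Theta>\<^sub>0}"]) auto
qed

end

section \<open>Linear groups, bases and dual spaces\<close>

lemma GL_iff:
  assumes "vector_space s"
  shows "g \<in> GL s \<longleftrightarrow> (\<forall>x y. g (x + y) = g x + g y) \<and> (\<forall>c x. g (s c x) = s c (g x)) \<and> bij g"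
  using assms by (auto simp: GL_def Vector_Spaces.linear_iff)

lemma GL_inv:
  assumes s: "vector_space s" and g: "g \<in> GL s"
  shows "inv g \<in> GL s"
proof -
  have add: "\<And>x y. g (x + y) = g x + g y" and scale: "\<And>c x. g (s c x) = s c (g x)" and bij: "bij g"
    using g by (auto simp: GL_iff[OF s])
  have gi: "g (inv g x) = x" for x using bij by (simp add: bij_is_surj surj_f_inv_f)
  have eq: "g x = y \<Longrightarrow> inv g y = x" for x y using bij by (metis bij_inv_eq_iff)
  show ?thesis
    unfolding GL_iff[OF s] using bij_imp_bij_inv[OF bij] by (auto intro!: eq simp: add scale gi)
qed

lemma GL_comp:
  assumes s: "vector_space s" and "g \<in> GL s" and "h \<in> GL s"
  shows "g \<circ> h \<in> GL s"
  using assms(2,3) by (simp add: GL_iff[OF s] bij_comp)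

lemma GL_id: "vector_space s \<Longrightarrow> id \<in> GL s"
  by (simp add: GL_iff)

lemma dual_space_iff:
  assumes "vector_space s"
  shows "\<phi> \<in> dual_space s \<longleftrightarrow> (\<forall>x y. \<phi> (x + y) = \<phi> x + \<phi> y) \<and> (\<forall>c x. \<phi> (s c x) = c * \<phi> x)"
proof -
  have "vector_space ((*) :: 'a \<Rightarrow> 'a \<Rightarrow> 'a)" by unfold_locales (auto simp: algebra_simps)
  with assms show ?thesis by (simp add: dual_space_def Vector_Spaces.linear_iff)
qed

lemma coord_space_of_dim:
  fixes s :: "'k::field_char_0 \<Rightarrow> 'v::ab_group_add \<Rightarrow> 'v"
  assumes "vector_space s" and dim: "vector_space.dim s UNIV = m" and "1 \<le> m"
  obtains e co where "coord_space s UNIV m e co"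
proof -
  interpret vector_space s by fact
  obtain B where B: "independent B" "UNIV \<subseteq> span B" "card B = m"
    using basis_exists[of UNIV] dim by auto
  \<comment> \<open>An infinite basis would have cardinality 0, which 1 \<le> m rules out.\<close>
  have "finite B" using B(3) assms(3) by (metis card.infinite not_one_le_zero)
  then obtain e where e: "bij_betw e {..<m} B"
    using ex_bij_betw_nat_finite[of B] B(3) by (auto simp: atLeast0LessThan)
  have in_span: "v \<in> span B" for v using B(2) by auto
  have "coord_space s UNIV m e (\<lambda>i v. representation B v (e i))"
  proof
    fix i j assume ij: "i < m" "j < m"
    then have "e j \<in> B" "e i = e j \<longleftrightarrow> i = j"
      using e by (auto simp: bij_betw_def inj_on_def)
    then show "representation B (e j) (e i) = (if i = j then 1 else 0)"
      by (simp add: representation_basis[OF B(1)])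
  next
    fix i x y r
    show "representation B (s r x + y) (e i) = r * representation B x (e i) + representation B y (e i)"
      by (simp add: representation_add[OF B(1)] representation_scale[OF B(1)] in_span)
  next
    fix x
    have "(\<Sum>i<m. s (representation B x (e i)) (e i)) = (\<Sum>b\<in>B. s (representation B x b) b)"
      by (rule sum.reindex_bij_betw[OF e])
    also have "\<dots> = x" using \<open>finite B\<close> by (intro sum_representation_eq B(1) in_span) auto
    finally show "(\<Sum>i<m. s (representation B x (e i)) (e i)) = x" .
  qed auto
  then show ?thesis by (rule that)
qed

text \<open>Basis and coordinates change roles: the forms \<open>co i\<close> are the basis, and
  evaluation at \<open>e i\<close>, cut off outside the dual space, is the i-th coordinate.\<close>

lemma coord_space_dual:
  fixes s :: "'k::field_char_0 \<Rightarrow> 'v::ab_group_add \<Rightarrow> 'v"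
  assumes "coord_space s UNIV m e co"
  shows "coord_space fscale (dual_space s) m co (\<lambda>i \<phi>. if \<phi> \<in> dual_space s then \<phi> (e i) else 0)"
proof -
  interpret V: coord_space s UNIV m e co by fact
  note dual = dual_space_iff[OF V.vector_space_axioms]
  show ?thesis
  proof
    show "fs.subspace (dual_space s)"
      by (rule fs.subspaceI) (auto simp: dual algebra_simps)
    show "co i \<in> dual_space s" if "i < m" for i
      using that by (simp add: dual V.co_add V.co_scale)
    then show "(if co j \<in> dual_space s then co j (e i) else 0) = (if i = j then 1 else 0)"
      if "i < m" "j < m" for i j using that by (simp add: V.co_e)
    show "(if fscale r x + y \<in> dual_space s then (fscale r x + y) (e i) else 0) =
        r * (if x \<in> dual_space s then x (e i) else 0) + (if y \<in> dual_space s then y (e i) else 0)"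
      if "x \<in> dual_space s" "y \<in> dual_space s" for r x y i
    proof -
      have "fscale r x + y \<in> dual_space s" using that by (simp add: dual algebra_simps)
      then show ?thesis using that by simp
    qed
    show "(\<Sum>i<m. fscale (if \<phi> \<in> dual_space s then \<phi> (e i) else 0) (co i)) = \<phi>"
      if \<phi>: "\<phi> \<in> dual_space s" for \<phi>
    proof
      fix v
      have add: "\<phi> (x + y) = \<phi> x + \<phi> y" and scale: "\<phi> (s c x) = c * \<phi> x" for x y c
        using \<phi> by (auto simp: dual)
      have 0: "\<phi> 0 = 0" using scale[of 0 0] by (simp add: V.scale_zero_left)
      have "\<phi> (sum h A) = (\<Sum>i\<in>A. \<phi> (h i))" for h and A :: "nat set"
        by (induction A rule: infinite_finite_induct) (auto simp: add 0)
      then have "\<phi> (\<Sum>i<m. s (co i v) (e i)) = (\<Sum>i<m. co i v * \<phi> (e i))"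
        by (simp add: scale)
      then show "(\<Sum>i<m. fscale (if \<phi> \<in> dual_space s then \<phi> (e i) else 0) (co i)) v = \<phi> v"
        using \<phi> by (simp add: V.co_expand sum_fun_apply mult.commute)
    qed
  qed auto
qed

text \<open>\<open>act\<close> applies \<open>inv h\<close> to the vectors of W, so the maps acting
  on arguments are the inverses; they form the full linear group again.\<close>

lemma two_row_space_UNIV:
  fixes s :: "'k::field_char_0 \<Rightarrow> 'v::ab_group_add \<Rightarrow> 'v"
  assumes "coord_space s UNIV m e co" and "u < t" and "t + u \<le> m"
  shows "two_row_space s UNIV m e co (inv ` GL s) t u"
proof -
  interpret V: coord_space s UNIV m e co by fact
  note vs = V.vector_space_axioms
  have \<Gamma>: "inv ` GL s = GL s"
  proof
    show "inv ` GL s \<subseteq> GL s" using GL_inv[OF vs] by blast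
    show "GL s \<subseteq> inv ` GL s"
    proof
      fix g assume g: "g \<in> GL s"
      then have "g = inv (inv g)" by (simp add: GL_iff[OF vs] inv_inv_eq)
      then show "g \<in> inv ` GL s" using GL_inv[OF vs g] by blast
    qed
  qed
  show ?thesis
    unfolding \<Gamma>
  proof
    fix k k' assume "\<And>r x y. x \<in> UNIV \<Longrightarrow> y \<in> UNIV \<Longrightarrow> k (s r x + y) = s r (k x) + k y"
      and inv: "\<And>x. x \<in> UNIV \<Longrightarrow> k' (k x) = x" "\<And>x. x \<in> UNIV \<Longrightarrow> k (k' x) = x"
    then have lin: "k (s r x + y) = s r (k x) + k y" for r x y by simp
    have add: "k (x + y) = k x + k y" for x y using lin[of 1 x y] by simp
    have 0: "k 0 = 0" using add[of 0 0] by simp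
    have scale: "k (s r x) = s r (k x)" for r x using lin[of r x 0] 0 by simp
    have "bij k" using inv by (intro o_bij[of k']) auto
    then have "k \<in> GL s" by (simp add: GL_iff[OF vs] add scale)
    then show "\<exists>\<kappa>\<in>GL s. \<forall>x\<in>UNIV. \<kappa> x = k x" by blast
  qed (use assms(2,3) GL_comp[OF vs] GL_id[OF vs] in \<open>auto simp: GL_iff[OF vs]\<close>)
qed

text \<open>The substantial point is that every automorphism of the dual space is the transpose of
  one of V. This rests on the finite basis: linear forms separate points, which shows that the
  transposes of mutually inverse maps are mutually inverse.\<close>

lemma two_row_space_dual:
  fixes s :: "'k::field_char_0 \<Rightarrow> 'v::ab_group_add \<Rightarrow> 'v"
  assumes "coord_space s UNIV m e co" and "u < t" and "t + u \<le> m"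
  shows "two_row_space fscale (dual_space s) m co
    (\<lambda>i \<phi>. if \<phi> \<in> dual_space s then \<phi> (e i) else 0) ((\<lambda>g \<phi>. \<phi> \<circ> g) ` GL s) t u"
proof -
  interpret V: coord_space s UNIV m e co by fact
  let ?X = "dual_space s"
  interpret D: coord_space fscale ?X m co "\<lambda>i \<phi>. if \<phi> \<in> dual_space s then \<phi> (e i) else 0"
    by (rule coord_space_dual[OF assms(1)])
  note vs = V.vector_space_axioms
  note dual = dual_space_iff[OF vs]
  have comp_in: "\<phi> \<circ> g \<in> ?X" if "g \<in> GL s" "\<phi> \<in> ?X" for g \<phi>
    using that by (simp add: dual GL_iff[OF vs])
  have dual_sum: "\<phi> (\<Sum>i<m. s (h i) (e i)) = (\<Sum>i<m. h i * \<phi> (e i))" if "\<phi> \<in> ?X" for \<phi> h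
  proof -
    have "\<phi> (\<Sum>i<m. s (h i) (e i)) = (\<Sum>i<m. fscale (\<phi> (e i)) (co i)) (\<Sum>i<m. s (h i) (e i))"
      using D.co_expand[OF that] that by simp
    also have "\<dots> = (\<Sum>i<m. \<phi> (e i) * h i)"
      by (simp add: sum_fun_apply V.co_sum V.co_scale V.co_e V.X_scale if_distrib[of "(*) _"] cong: if_cong)
    finally show ?thesis by (simp add: mult.commute)
  qed
  have separate: "v = w" if "\<And>\<phi>. \<phi> \<in> ?X \<Longrightarrow> \<phi> v = \<phi> w" for v w
    using that D.e_in by (intro V.co_eqI) auto
  \<comment> \<open>The transpose in coordinates: the i-th coordinate of the image of
    \<open>v\<close> is the value at \<open>v\<close> of the image of the i-th coordinate
    form.\<close>
  define tr where "tr k v = (\<Sum>i<m. s (k (co i) v) (e i))" for k :: "('v \<Rightarrow> 'k) \<Rightarrow> 'v \<Rightarrow> 'k" and v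
  have tr: "k \<phi> = \<phi> \<circ> tr k"
    if lin: "\<And>r \<phi> \<psi>. \<phi> \<in> ?X \<Longrightarrow> \<psi> \<in> ?X \<Longrightarrow> k (fscale r \<phi> + \<psi>) = fscale r (k \<phi>) + k \<psi>"
      and \<phi>: "\<phi> \<in> ?X" for k \<phi>
  proof
    fix v
    have k0: "k 0 = 0"
      using lin[of 0 0 "-1"] fs.subspace_0[OF D.subspace_X] by simp
    have "k (\<Sum>i\<in>A. fscale (c i) (co i)) = (\<Sum>i\<in>A. fscale (c i) (k (co i)))" if "A \<subseteq> {..<m}" for A c
      using finite_subset[OF that finite_lessThan] that
    proof (induction A rule: finite_induct)
      case (insert i A)
      have "(\<Sum>i\<in>A. fscale (c i) (co i)) \<in> ?X"
        using insert.prems D.e_in by (intro D.X_sum D.X_scale) auto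
      moreover have "co i \<in> ?X" using insert.prems D.e_in by simp
      ultimately have "k (fscale (c i) (co i) + (\<Sum>i\<in>A. fscale (c i) (co i))) =
          fscale (c i) (k (co i)) + (\<Sum>i\<in>A. fscale (c i) (k (co i)))"
        using insert by (simp only: lin) (simp only: insert_subset)
      then show ?case by (simp only: sum.insert[OF insert.hyps])
    qed (use k0 in \<open>simp only: sum.empty\<close>)
    from this[of "{..<m}" "\<lambda>i. \<phi> (e i)"] D.co_expand[OF \<phi>]
    have "k \<phi> = (\<Sum>i<m. fscale (\<phi> (e i)) (k (co i)))" using \<phi> by simp
    then show "k \<phi> v = (\<phi> \<circ> tr k) v"
      using dual_sum[OF \<phi>] by (simp add: tr_def sum_fun_apply mult.commute)
  qed
  note tr_apply = tr[THEN fun_cong, unfolded comp_apply, symmetric]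
  show ?thesis
  proof
    fix \<kappa> :: "('v \<Rightarrow> 'k) \<Rightarrow> 'v \<Rightarrow> 'k" and x :: "'v \<Rightarrow> 'k"
    assume "\<kappa> \<in> (\<lambda>g \<phi>. \<phi> \<circ> g) ` GL s"
    then obtain g where g: "g \<in> GL s" "\<kappa> = (\<lambda>\<phi>. \<phi> \<circ> g)" by blast
    have "surj g" using g(1) by (simp add: GL_iff[OF vs] bij_is_surj)
    then have "g \<circ> inv g = id" by (simp only: surj_iff)
    then have x: "\<kappa> x \<circ> inv g = x" by (simp add: g(2) comp_assoc)
    show "\<kappa> x \<in> ?X \<longleftrightarrow> x \<in> ?X"
    proof
      assume "\<kappa> x \<in> ?X"
      then have "\<kappa> x \<circ> inv g \<in> ?X" by (rule comp_in[OF GL_inv[OF vs g(1)]])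
      then show "x \<in> ?X" by (simp only: x)
    qed (simp add: g(2) comp_in[OF g(1)])
  next
    fix \<kappa> \<kappa>' :: "('v \<Rightarrow> 'k) \<Rightarrow> 'v \<Rightarrow> 'k"
    assume "\<kappa> \<in> (\<lambda>g \<phi>. \<phi> \<circ> g) ` GL s" "\<kappa>' \<in> (\<lambda>g \<phi>. \<phi> \<circ> g) ` GL s"
    then obtain g g' where g: "g \<in> GL s" "\<kappa> = (\<lambda>\<phi>. \<phi> \<circ> g)" "g' \<in> GL s" "\<kappa>' = (\<lambda>\<phi>. \<phi> \<circ> g')" by blast
    have "\<kappa> \<circ> \<kappa>' = (\<lambda>\<phi>. \<phi> \<circ> (g' \<circ> g))" by (simp add: g fun_eq_iff)
    then show "\<kappa> \<circ> \<kappa>' \<in> (\<lambda>g \<phi>. \<phi> \<circ> g) ` GL s" using GL_comp[OF vs g(3,1)] by blast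
  next
    have "id = (\<lambda>\<phi> :: 'v \<Rightarrow> 'k. \<phi> \<circ> id)" by (simp add: fun_eq_iff)
    then show "id \<in> (\<lambda>g (\<phi> :: 'v \<Rightarrow> 'k). \<phi> \<circ> g) ` GL s" using GL_id[OF vs] by blast
  next
    fix k k' :: "('v \<Rightarrow> 'k) \<Rightarrow> 'v \<Rightarrow> 'k"
    assume k_in: "\<And>x. x \<in> ?X \<Longrightarrow> k x \<in> ?X" and k'_in: "\<And>x. x \<in> ?X \<Longrightarrow> k' x \<in> ?X"
      and lin: "\<And>r x y. x \<in> ?X \<Longrightarrow> y \<in> ?X \<Longrightarrow> k (fscale r x + y) = fscale r (k x) + k y"
      and inv: "\<And>x. x \<in> ?X \<Longrightarrow> k' (k x) = x" "\<And>x. x \<in> ?X \<Longrightarrow> k (k' x) = x"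
    have lin': "k' (fscale r x + y) = fscale r (k' x) + k' y" if "x \<in> ?X" "y \<in> ?X" for r x y
    proof -
      have "k (fscale r (k' x) + k' y) = fscale r x + y"
        using lin[OF k'_in[OF that(1)] k'_in[OF that(2)]] inv(2) that by simp
      then show ?thesis
        using inv(1)[of "fscale r (k' x) + k' y"] k'_in that D.X_add D.X_scale by metis
    qed
    have co_in: "co i \<in> ?X" if "i < m" for i using D.e_in that .
    have "tr k \<in> GL s"
      unfolding GL_iff[OF vs]
    proof (intro conjI allI)
      fix v w c
      show "tr k (v + w) = tr k v + tr k w"
        using k_in[OF co_in] by (simp add: tr_def dual V.scale_left_distrib sum.distrib)
      show "tr k (s c v) = s c (tr k v)"
        using k_in[OF co_in] by (simp add: tr_def dual V.scale_sum_right)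
      have "tr k (tr k' v) = v" for v
      proof (rule separate)
        fix \<phi> assume \<phi>: "\<phi> \<in> ?X"
        have "\<phi> (tr k (tr k' v)) = k \<phi> (tr k' v)" by (rule tr_apply[OF lin \<phi>])
        also have "\<dots> = k' (k \<phi>) v" by (rule tr_apply[OF lin' k_in[OF \<phi>]])
        finally show "\<phi> (tr k (tr k' v)) = \<phi> v" using inv(1)[OF \<phi>] by simp
      qed
      moreover have "tr k' (tr k v) = v" for v
      proof (rule separate)
        fix \<phi> assume \<phi>: "\<phi> \<in> ?X"
        have "\<phi> (tr k' (tr k v)) = k' \<phi> (tr k v)" by (rule tr_apply[OF lin' \<phi>])
        also have "\<dots> = k (k' \<phi>) v" by (rule tr_apply[OF lin k'_in[OF \<phi>]])
        finally show "\<phi> (tr k' (tr k v)) = \<phi> v" using inv(2)[OF \<phi>] by simp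
      qed
      ultimately show "bij (tr k)" by (intro o_bij[of "tr k'"]) auto
    qed
    then have "(\<lambda>\<phi>. \<phi> \<circ> tr k) \<in> (\<lambda>g (\<phi> :: 'v \<Rightarrow> 'k). \<phi> \<circ> g) ` GL s" by (rule imageI)
    moreover have "\<forall>\<phi>\<in>?X. \<phi> \<circ> tr k = k \<phi>" using tr[OF lin, symmetric] by (rule ballI)
    ultimately show "\<exists>\<kappa>\<in>(\<lambda>g \<phi>. \<phi> \<circ> g) ` GL s. \<forall>x\<in>?X. \<kappa> x = k x" by (intro bexI[where x = "\<lambda>\<phi>. \<phi> \<circ> tr k"])
  qed (use assms(2,3) in \<open>auto simp: fun_eq_iff\<close>)
qed

section \<open>The multiplicity for the two linear groups, and the classification\<close>

lemma T_multiplicity_two_row: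
  fixes sV :: "'k::field_char_0 \<Rightarrow> 'v::ab_group_add \<Rightarrow> 'v"
    and sW :: "'k \<Rightarrow> 'w::ab_group_add \<Rightarrow> 'w"
  assumes "vector_space sV" and "vector_space sW"
    and m: "vector_space.dim sV UNIV = m" and n: "vector_space.dim sW UNIV = n"
    and "u < t" and "t + u \<le> m" and "t + u \<le> n"
  shows "T_multiplicity sV sW t (two_row t u) (two_row t u) = 1"
proof -
  obtain eV cV where V: "coord_space sV UNIV m eV cV"
    by (rule coord_space_of_dim[OF assms(1) m]) (use assms in auto)
  obtain eW cW where W: "coord_space sW UNIV n eW cW"
    by (rule coord_space_of_dim[OF assms(2) n]) (use assms in auto)
  let ?cV = "\<lambda>i \<phi>. if \<phi> \<in> dual_space sV then \<phi> (eV i) else 0"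
  let ?k1 = "\<lambda>(x :: ('v \<Rightarrow> 'v) \<times> ('w \<Rightarrow> 'w)) (\<phi> :: 'v \<Rightarrow> 'k). \<phi> \<circ> fst x"
  let ?k2 = "\<lambda>x :: ('v \<Rightarrow> 'v) \<times> ('w \<Rightarrow> 'w). inv (snd x)"
  interpret A: two_row_space fscale "dual_space sV" m cV ?cV "(\<lambda>g \<phi>. \<phi> \<circ> g) ` GL sV" t u
    using two_row_space_dual[OF V] assms by blast
  interpret B: two_row_space sW UNIV n eW cW "inv ` GL sW" t u
    using two_row_space_UNIV[OF W] assms by blast
  interpret P: two_row_pair fscale "dual_space sV" m cV ?cV "(\<lambda>g \<phi>. \<phi> \<circ> g) ` GL sV"
    sW UNIV n eW cW "inv ` GL sW" t u "GL sV \<times> GL sW" ?k1 ?k2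
  proof
    fix x assume "x \<in> GL sV \<times> GL sW"
    then show "?k1 x \<in> (\<lambda>g \<phi>. \<phi> \<circ> g) ` GL sV \<and> ?k2 x \<in> inv ` GL sW" by auto
  next
    fix \<kappa> \<kappa>' assume "\<kappa> \<in> (\<lambda>g (\<phi> :: 'v \<Rightarrow> 'k). \<phi> \<circ> g) ` GL sV" "\<kappa>' \<in> inv ` GL sW"
    then obtain g h where "g \<in> GL sV" "h \<in> GL sW" "\<kappa> = (\<lambda>\<phi>. \<phi> \<circ> g)" "\<kappa>' = inv h" by blast
    then show "\<exists>x\<in>GL sV \<times> GL sW. ?k1 x = \<kappa> \<and> ?k2 x = \<kappa>'" by (intro bexI[of _ "(g, h)"]) auto
  qed
  have "P.\<rho> = act"
    unfolding P.\<rho>_def act_def by (intro ext) (auto simp: comp_def)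
  moreover from this have "P.\<rho>_graded = act_graded"
    unfolding P.\<rho>_graded_def act_graded_def by (simp only:)
  ultimately show ?thesis
    using P.dim_equivariant_homs
    by (simp only: T_multiplicity_def multiplicity_in_def bi_schur_def tensor_algebra_def)
qed

lemma nth_default_three:
  "nth_default 0 [x, y, w] i = (if i = 0 then x else if i = 1 then y else if i = 2 then w else (0::nat))"
  by (auto simp: nth_default_def nth_Cons' numeral_2_eq_2)

lemma T_shape_relation_three:
  fixes sV :: "'k::field_char_0 \<Rightarrow> 'v::ab_group_add \<Rightarrow> 'v"
    and sW :: "'k \<Rightarrow> 'w::ab_group_add \<Rightarrow> 'w"
  assumes V: "vector_space sV" and W: "vector_space sW"
    and m: "vector_space.dim sV UNIV = m" and n: "vector_space.dim sW UNIV = n"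
    and u: "u \<in> {1..t div 2}" and bi: "bi_diagram m n \<gamma> \<mu>"
    and shape: "(\<gamma>, \<mu>) = (gamma_diagram t u, lambda_diagram t u) \<or>
      (\<gamma>, \<mu>) = (lambda_diagram t u, gamma_diagram t u)"
  shows "T_shape_relation sV sW t 3 \<gamma> \<mu>"
proof -
  have u': "1 \<le> u" "2 * u \<le> t" using u by auto
  let ?g = "gamma_diagram t u" and ?l = "lambda_diagram t u"
  have g: "?g i = (if i = 0 then t + u else if i = 1 then t + u else if i = 2 then t - 2 * u else 0)"
    and l: "?l i = (if i = 0 then t + 2 * u else if i = 1 then t - u else if i = 2 then t - u else 0)" for i
    by (simp_all add: gamma_diagram_def lambda_diagram_def nth_default_three)
  have sum3: "(\<Sum>i<3. f i) = f 0 + f 1 + f 2" for f :: "nat \<Rightarrow> nat"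
    by (simp add: numeral_3_eq_3 numeral_2_eq_2)
  have adm: "admissible t 3 ?g" "admissible t 3 ?l"
    unfolding admissible_iff antimono_iff_le_Suc sum3 using u' by (auto simp: g l)
  have ne: "?g \<noteq> ?l" using u' g[of 0] l[of 0] by auto
  have pred: "\<alpha> = two_row t u" if p: "predecessor t 3 \<alpha> \<nu>" and \<nu>: "\<nu> = ?g \<or> \<nu> = ?l" for \<alpha> \<nu>
  proof -
    have s: "\<alpha> 0 + \<alpha> 1 = 2 * t" using predecessorD(5)[OF p] by (simp add: numeral_2_eq_2)
    have b: "\<nu> 1 \<le> \<alpha> 0" "\<alpha> 0 \<le> \<nu> 0" "\<nu> 2 \<le> \<alpha> 1" "\<alpha> 1 \<le> \<nu> 1"
      using predecessorD(2,3)[OF p, of 0] predecessorD(2,3)[OF p, of 1] by (simp_all add: numeral_2_eq_2)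
    have "\<alpha> 0 = t + u \<and> \<alpha> 1 = t - u" using \<nu> b s u' by (auto simp: g l)
    moreover have "\<alpha> i = 0" if "2 \<le> i" for i using predecessorD(4)[OF p] that by simp
    ultimately have "\<alpha> i = two_row t u i" for i by (auto simp: two_row_apply)
    then show ?thesis by blast
  qed
  \<comment> \<open>In either order both diagrams have a first row of at least t + u, so fitting
    into m and n columns leaves room for (t + u, t - u) on both sides.\<close>
  have le: "t + u \<le> m" "t + u \<le> n" using bi shape u' by (auto simp: bi_diagram_def g l)
  have "T_multiplicity sV sW t (two_row t u) (two_row t u) = 1"
    using u' le by (intro T_multiplicity_two_row[OF V W m n]) auto
  then show ?thesis
    unfolding T_shape_relation_def m n using bi shape adm ne pred by auto
qed

theorem theorem3p13:
  fixes sV :: "'k::field_char_0 \<Rightarrow> 'v::ab_group_add \<Rightarrow> 'v"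
    and sW :: "'k \<Rightarrow> 'w::ab_group_add \<Rightarrow> 'w"
    and t m n d :: nat
  assumes "vector_space sV" and "vector_space sW"
    and "vector_space.dim sV UNIV = m" and "vector_space.dim sW UNIV = n"
    and "1 \<le> t" and "t \<le> m" and "m \<le> n"
    and "d \<ge> 3"
  shows "{(\<gamma>, \<mu>). T_shape_relation sV sW t d \<gamma> \<mu>} =
    {(\<gamma>, \<mu>). d = 3 \<and> bi_diagram m n \<gamma> \<mu> \<and>
       (\<exists>u\<in>{1..t div 2}.
          (\<gamma>, \<mu>) = (gamma_diagram t u, lambda_diagram t u) \<or>
          (\<gamma>, \<mu>) = (lambda_diagram t u, gamma_diagram t u))}"
proof -
  have "T_shape_relation sV sW t d \<gamma> \<mu> \<longleftrightarrow> d = 3 \<and> bi_diagram m n \<gamma> \<mu> \<and>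
       (\<exists>u\<in>{1..t div 2}.
          (\<gamma>, \<mu>) = (gamma_diagram t u, lambda_diagram t u) \<or>
          (\<gamma>, \<mu>) = (lambda_diagram t u, gamma_diagram t u))" (is "_ \<longleftrightarrow> ?R") for \<gamma> \<mu>
  proof
    assume T: "T_shape_relation sV sW t d \<gamma> \<mu>"
    then have "bi_diagram m n \<gamma> \<mu>" using assms(3,4) by (simp add: T_shape_relation_def)
    with T_shape_relation_cases[OF T assms(8)] show ?R by blast
  next
    assume ?R
    then show "T_shape_relation sV sW t d \<gamma> \<mu>"
      using T_shape_relation_three[OF assms(1-4)] by blast
  qed
  then show ?thesis by blast
qed

end
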